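(* Let $D\subset\mathbb C$ be a smoothly bounded domain. Let $\mathcal H^{p,q}_2(D)$ be the space of square integrable harmonic $(p,q)$-forms on $D$ relative to the capacity metric $ds=c_D(z)|dz|$. Then $$\dim\mathcal H^{p,q}_2(D)=\begin{cases}0,&\text{if }p+q\ne1,\\ \infty,&\text{if }p+q=1.\end{cases}$$
   Context: A smoothly bounded domain is a bounded domain with $C^\infty$-smooth boundary. $G_D(z,p)$ is the Green's function of $D$ with pole $p$ (harmonic on $D\setminus\{p\}$, tending to $0$ at $\partial D$, with $G_D(z,p)+\log|z-p|$ harmonic near $p$); $\Lambda_D(p)=\lim_{z\to p}(G_D(z,p)+\log|z-p|)$ and $c_D(p)=e^{-\Lambda_D(p)}$. The capacity metric $ds=c_D(z)|dz|$ is a complete conformal (Kähler) metric on $D$. Square integrability and harmonicity of forms are with respect to this metric (its pointwise norm, volume form and Laplacian), and the bidegrees are $0\le p,q\le1$. *)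

theory Defs
  imports
    "HOL-Analysis.Analysis"
    "HOL-Library.Function_Algebras"
    "HOL-Library.Extended_Nat"
begin

section \<open>Smooth functions and smoothly bounded domains\<close>

text \<open>The predicates below are meant for open sets \<open>S\<close>.\<close>

primrec Ck_on ::
  "nat \<Rightarrow> ('a::real_normed_vector \<Rightarrow> 'b::real_normed_vector) \<Rightarrow> 'a set \<Rightarrow> bool"
where
  "Ck_on 0 f S \<longleftrightarrow> continuous_on S f"
| "Ck_on (Suc k) f S \<longleftrightarrow>
     f differentiable_on S \<and> (\<forall>v. Ck_on k (\<lambda>x. frechet_derivative f (at x) v) S)"

definition smooth_on ::
  "('a::real_normed_vector \<Rightarrow> 'b::real_normed_vector) \<Rightarrow> 'a set \<Rightarrow> bool"
where
  "smooth_on f S \<longleftrightarrow> (\<forall>k. Ck_on k f S)"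

text \<open>Smoothness of the boundary is expressed by local defining functions with
  nonvanishing differential; in particular \<open>D\<close> lies locally on one side of its boundary.\<close>

definition smoothly_bounded_domain :: "complex set \<Rightarrow> bool" where
  "smoothly_bounded_domain D \<longleftrightarrow>
     D \<noteq> {} \<and> open D \<and> connected D \<and> bounded D \<and>
     (\<forall>\<zeta>\<in>frontier D. \<exists>U (\<rho> :: complex \<Rightarrow> real).
        open U \<and> \<zeta> \<in> U \<and> smooth_on \<rho> U \<and>
        (\<forall>z\<in>U. frechet_derivative \<rho> (at z) \<noteq> (\<lambda>v. 0)) \<and>
        D \<inter> U = {z \<in> U. \<rho> z < 0})"

section \<open>Green's function and the capacity metric\<close>

definition pderiv_x :: "(complex \<Rightarrow> 'b::real_normed_vector) \<Rightarrow> complex \<Rightarrow> 'b" where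
  "pderiv_x f z = frechet_derivative f (at z) 1"

definition pderiv_y :: "(complex \<Rightarrow> 'b::real_normed_vector) \<Rightarrow> complex \<Rightarrow> 'b" where
  "pderiv_y f z = frechet_derivative f (at z) \<i>"

definition harmonic_on :: "(complex \<Rightarrow> real) \<Rightarrow> complex set \<Rightarrow> bool" where
  "harmonic_on u S \<longleftrightarrow>
     Ck_on 2 u S \<and> (\<forall>z\<in>S. pderiv_x (pderiv_x u) z + pderiv_y (pderiv_y u) z = 0)"

definition is_green_function ::
  "complex set \<Rightarrow> complex \<Rightarrow> (complex \<Rightarrow> real) \<Rightarrow> bool"
where
  "is_green_function D p g \<longleftrightarrow>
     harmonic_on g (D - {p}) \<and>
     (\<forall>\<zeta>\<in>frontier D. (g \<longlongrightarrow> 0) (at \<zeta> within D)) \<and>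
     (\<exists>r>0. ball p r \<subseteq> D \<and>
        (\<exists>h. harmonic_on h (ball p r) \<and>
           (\<forall>z\<in>ball p r - {p}. g z + ln (cmod (z - p)) = h z)))"

text \<open>The conditions determine the function on \<open>D - {p}\<close> only; the value \<open>0\<close>
  elsewhere is a normalization that makes the description definite.\<close>

definition green :: "complex set \<Rightarrow> complex \<Rightarrow> complex \<Rightarrow> real" where
  "green D z p =
     (THE g. is_green_function D p g \<and> (\<forall>w. w \<notin> D - {p} \<longrightarrow> g w = 0)) z"

definition robin :: "complex set \<Rightarrow> complex \<Rightarrow> real" where
  "robin D p = Lim (at p) (\<lambda>z. green D z p + ln (cmod (z - p)))"

definition capacity_density :: "complex set \<Rightarrow> complex \<Rightarrow> real" where
  "capacity_density D p = exp (- robin D p)"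

section \<open>Differential forms on plane domains\<close>

text \<open>A form is given by its coefficients in the global frame
  \<open>1, dz, d\<bar>z, dz \<and> d\<bar>z\<close>: the number \<open>\<omega> p q z\<close> is the coefficient of
  \<open>dz\<^sup>p \<and> d\<bar>z\<^sup>q\<close> at \<open>z\<close>.  Only the indices \<open>p, q \<le> 1\<close> are meaningful.\<close>

type_synonym form = "nat \<Rightarrow> nat \<Rightarrow> complex \<Rightarrow> complex"

definition wirt_z :: "(complex \<Rightarrow> complex) \<Rightarrow> complex \<Rightarrow> complex" where
  "wirt_z f z = (pderiv_x f z - \<i> * pderiv_y f z) / 2"

definition wirt_zbar :: "(complex \<Rightarrow> complex) \<Rightarrow> complex \<Rightarrow> complex" where
  "wirt_zbar f z = (pderiv_x f z + \<i> * pderiv_y f z) / 2"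

definition ext_d :: "form \<Rightarrow> form" where
  "ext_d \<omega> p q z =
     (if p = 1 \<and> q = 0 then wirt_z (\<omega> 0 0) z
      else if p = 0 \<and> q = 1 then wirt_zbar (\<omega> 0 0) z
      else if p = 1 \<and> q = 1 then wirt_z (\<omega> 0 1) z - wirt_zbar (\<omega> 1 0) z
      else 0)"

text \<open>In the remaining operators, \<open>c\<close> is the density of the conformal metric
  \<open>ds = c(z) |dz|\<close>, whose volume form is
  \<open>c\<^sup>2 dx \<and> dy = (\<i>/2) c\<^sup>2 dz \<and> d\<bar>z\<close>.  The Hodge star is complex linear, with
  \<open>*1 = c\<^sup>2 dx \<and> dy\<close>, \<open>*dx = dy\<close>, \<open>*dy = -dx\<close>, that is \<open>*dz = -\<i> dz\<close>
  and \<open>*d\<bar>z = \<i> d\<bar>z\<close>.\<close>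

definition hodge_star :: "(complex \<Rightarrow> real) \<Rightarrow> form \<Rightarrow> form" where
  "hodge_star c \<omega> p q z =
     (if p = 0 \<and> q = 0 then - 2 * \<i> / of_real ((c z)\<^sup>2) * \<omega> 1 1 z
      else if p = 1 \<and> q = 0 then - \<i> * \<omega> 1 0 z
      else if p = 0 \<and> q = 1 then \<i> * \<omega> 0 1 z
      else if p = 1 \<and> q = 1 then \<i> / 2 * of_real ((c z)\<^sup>2) * \<omega> 0 0 z
      else 0)"

text \<open>The real dimension is even, so the formal adjoint of \<open>d\<close> is \<open>-*d*\<close> in all degrees.\<close>

definition codiff :: "(complex \<Rightarrow> real) \<Rightarrow> form \<Rightarrow> form" where
  "codiff c \<omega> = - hodge_star c (ext_d (hodge_star c \<omega>))"

definition laplacian :: "(complex \<Rightarrow> real) \<Rightarrow> form \<Rightarrow> form" where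
  "laplacian c \<omega> = ext_d (codiff c \<omega>) + codiff c (ext_d \<omega>)"

text \<open>Pointwise norm: \<open>|dx| = |dy| = 1/c\<close> gives \<open>|dz|\<^sup>2 = |d\<bar>z|\<^sup>2 = 2/c\<^sup>2\<close>, and
  \<open>dz \<and> d\<bar>z = -2\<i> dx \<and> dy\<close> gives \<open>|dz \<and> d\<bar>z|\<^sup>2 = 4/c\<^sup>4\<close>.\<close>

definition form_norm_sq :: "(complex \<Rightarrow> real) \<Rightarrow> form \<Rightarrow> complex \<Rightarrow> real" where
  "form_norm_sq c \<omega> z = (\<Sum>p\<le>1. \<Sum>q\<le>1. (cmod (\<omega> p q z))\<^sup>2 * (2 / (c z)\<^sup>2) ^ (p + q))"

text \<open>Forms on \<open>D\<close> are extended by zero outside \<open>D\<close>, so that a form on \<open>D\<close>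
  has exactly one representative.\<close>

definition smooth_forms :: "complex set \<Rightarrow> nat \<Rightarrow> nat \<Rightarrow> form set" where
  "smooth_forms D p q =
     {\<omega>. smooth_on (\<omega> p q) D \<and> (\<forall>z. z \<notin> D \<longrightarrow> \<omega> p q z = 0) \<and>
         (\<forall>r s z. (r, s) \<noteq> (p, q) \<longrightarrow> \<omega> r s z = 0)}"

definition L2_harmonic_forms ::
  "(complex \<Rightarrow> real) \<Rightarrow> complex set \<Rightarrow> nat \<Rightarrow> nat \<Rightarrow> form set"
where
  "L2_harmonic_forms c D p q =
     {\<omega> \<in> smooth_forms D p q.
        (\<forall>z\<in>D. \<forall>r s. laplacian c \<omega> r s z = 0) \<and>
        set_integrable lborel D (\<lambda>z. form_norm_sq c \<omega> z * (c z)\<^sup>2)}"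

definition form_scale :: "complex \<Rightarrow> form \<Rightarrow> form" where
  "form_scale a \<omega> = (\<lambda>p q z. a * \<omega> p q z)"

interpretation form: vector_space form_scale
  by unfold_locales (auto simp: form_scale_def fun_eq_iff algebra_simps)

text \<open>The library's \<open>dim\<close> is a natural number, without meaning for infinite-dimensional
  spaces.\<close>

definition form_dim :: "form set \<Rightarrow> enat" where
  "form_dim V =
     (if \<exists>B. finite B \<and> V \<subseteq> form.span B then enat (form.dim V) else \<infinity>)"

end

theory Submission
  imports Defs "HOL-Complex_Analysis.Complex_Analysis"
begin

text \<open>
  In real dimension two the middle degree is conformally invariant: in \<open>|f dz|\<^sup>2 dV\<close> the density
  \<open>c\<close> cancels, and a holomorphic \<open>(1,0)\<close>-form or an antiholomorphic \<open>(0,1)\<close>-form is closed and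
  coclosed for every conformal metric. As \<open>D\<close> is bounded, the forms \<open>z\<^sup>n dz\<close> and their conjugates
  are square integrable. They are linearly independent, so the dimension is infinite for
  \<open>p + q = 1\<close> (\<open>monomial_form_10_harmonic\<close>, \<open>form_dim_monomials\<close>).

  In the degrees \<open>(0,0)\<close> and \<open>(1,1)\<close> a square integrable harmonic form corresponds to a complex
  function \<open>f\<close> that solves the Euclidean Laplace equation and has \<open>\<integral> |f|\<^sup>2 c\<^sup>2 < \<infinity>\<close>; for
  \<open>(1,1)\<close>-forms \<open>f\<close> is the Hodge dual. Such an \<open>f\<close> vanishes because \<open>c\<close> is large at the boundary.
  With \<open>d\<close> the distance to the boundary, \<open>c \<ge> \<kappa> / d\<close> near every boundary point
  (\<open>capacity_density_lower_bound\<close>), so on a disc about \<open>z\<close> of radius comparable to \<open>d\<close> the integral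
  of \<open>|f|\<^sup>2 c\<^sup>2\<close> is at least a fixed multiple of \<open>|f z|\<^sup>2\<close>. As \<open>z\<close> approaches the boundary these
  integrals tend to \<open>0\<close>, hence so does \<open>f\<close>, and the maximum principle gives \<open>f = 0\<close>
  (\<open>re_hol_square_integrable_eq_0\<close>).

  The definition of \<open>c\<close> presupposes Green's function, which has to be constructed. The regular part of
  \<open>G\<close> with pole \<open>p\<close> is the harmonic function with boundary values \<open>ln |\<zeta> - p|\<close>. It is obtained by
  sweeping: starting from the subharmonic function \<open>ln (max |z - p| \<rho>)\<close>, Poisson modifications on
  countably many discs give an increasing sequence, whose limit is the least harmonic majorant
  (\<open>least_harmonic_majorant\<close>). The smooth boundary provides exterior discs
  (\<open>exterior_discs_near\<close>), these provide barriers, and the barriers show that the boundary values are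
  attained. The Robin constant is the value of the regular part at the pole (\<open>robin_eq\<close>).

  Two properties of the Robin constant are needed. Comparison with Green's function of the
  complement of an exterior disc bounds it from above (\<open>robin_le\<close>), which gives the lower bound for
  \<open>c\<close>. And it is smooth (\<open>Ck_on_robin\<close>), which is needed for \<open>(1,1)\<close>-forms, whose Laplacian
  differentiates \<open>c\<close>: the regular part is harmonic in the pole as well, so on small discs the Robin
  constant is a double Poisson integral and can be differentiated under the integral sign.
\<close>

section \<open>Calculus of finitely often differentiable functions\<close>

lemma frechet_derivative_cong_open:
  assumes "open S" "x \<in> S" "\<And>y. y \<in> S \<Longrightarrow> f y = g y"
  shows "frechet_derivative f (at x) = frechet_derivative g (at x)"
proof -
  have "(f has_derivative F) (at x) \<longleftrightarrow> (g has_derivative F) (at x)" for F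
    using has_derivative_transform_within_open[OF _ assms(1,2)] assms(3) by metis
  then show ?thesis by (simp add: frechet_derivative_def)
qed

lemma Ck_on_cong:
  assumes "open S" "\<And>y. y \<in> S \<Longrightarrow> f y = g y"
  shows "Ck_on k f S \<longleftrightarrow> Ck_on k g S"
  using assms(2)
proof (induction k arbitrary: f g)
  case 0
  then show ?case using continuous_on_cong by auto
next
  case (Suc k)
  have "f differentiable_on S \<longleftrightarrow> g differentiable_on S"
    unfolding differentiable_on_def
    using differentiable_transform_within[of f _ S 1 g] differentiable_transform_within[of g _ S 1 f]
      Suc.prems by auto
  moreover have "Ck_on k (\<lambda>x. frechet_derivative f (at x) v) S
      \<longleftrightarrow> Ck_on k (\<lambda>x. frechet_derivative g (at x) v) S" for v
    using frechet_derivative_cong_open[OF assms(1), of _ f g] Suc.prems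
    by (intro Suc.IH) simp
  ultimately show ?case by simp
qed

lemma Ck_on_SucI:
  assumes "open S" "\<And>x. x \<in> S \<Longrightarrow> (f has_derivative f' x) (at x)"
    "\<And>v. Ck_on k (\<lambda>x. f' x v) S"
  shows "Ck_on (Suc k) f S"
proof -
  have "f differentiable_on S"
    unfolding differentiable_on_eq_differentiable_at[OF assms(1)]
    using assms(2) differentiableI by blast
  moreover have "Ck_on k (\<lambda>x. frechet_derivative f (at x) v) S" for v
  proof -
    have "frechet_derivative f (at x) v = f' x v" if "x \<in> S" for x
      using frechet_derivative_at[OF assms(2)[OF that]] by simp
    then have "Ck_on k (\<lambda>x. frechet_derivative f (at x) v) S \<longleftrightarrow> Ck_on k (\<lambda>x. f' x v) S"
      by (rule Ck_on_cong[OF assms(1)])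
    then show ?thesis using assms(3) by blast
  qed
  ultimately show ?thesis by simp
qed

lemma Ck_on_SucD:
  assumes "Ck_on (Suc k) f S" "open S"
  shows "\<And>x. x \<in> S \<Longrightarrow> (f has_derivative frechet_derivative f (at x)) (at x)"
    and "\<And>v. Ck_on k (\<lambda>x. frechet_derivative f (at x) v) S"
  using assms(1) differentiable_on_eq_differentiable_at[OF assms(2), of f] frechet_derivative_works[of f]
  by auto

lemma Ck_on_imp_continuous_on: "Ck_on k f S \<Longrightarrow> continuous_on S f"
  by (cases k) (auto simp: differentiable_imp_continuous_on)

lemma Ck_on_Suc_lower: "Ck_on (Suc k) f S \<Longrightarrow> Ck_on k f S"
proof (induction k arbitrary: f)
  case 0
  then show ?case by (simp add: differentiable_imp_continuous_on)
next
  case (Suc k)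
  from Suc.prems have "f differentiable_on S"
    and "Ck_on (Suc k) (\<lambda>x. frechet_derivative f (at x) v) S" for v
    by simp_all
  then show ?case using Suc.IH by simp
qed

lemma Ck_on_subset:
  assumes "T \<subseteq> S"
  shows "Ck_on k f S \<Longrightarrow> Ck_on k f T"
proof (induction k arbitrary: f)
  case 0
  then show ?case using assms continuous_on_subset by auto
next
  case (Suc k)
  then have "f differentiable_on T" using differentiable_on_subset[of f S T] assms by simp
  with Suc show ?case by simp
qed

lemma Ck_on_local:
  assumes "\<forall>x\<in>S. \<exists>T. open T \<and> x \<in> T \<and> T \<subseteq> S \<and> Ck_on k f T"
  shows "Ck_on k f S"
  using assms
proof (induction k arbitrary: f)
  case 0
  have "continuous (at x within S) f" if x: "x \<in> S" for x
  proof -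
    obtain T where T: "open T" "x \<in> T" "Ck_on 0 f T" using bspec[OF 0 x] by blast
    then have "isCont f x" using continuous_on_eq_continuous_at[of T f] by simp
    then show ?thesis by (rule continuous_at_imp_continuous_at_within)
  qed
  then show ?case by (simp add: continuous_on_eq_continuous_within)
next
  case (Suc k)
  have "f differentiable at x" if x: "x \<in> S" for x
  proof -
    obtain T where T: "open T" "x \<in> T" "Ck_on (Suc k) f T" using bspec[OF Suc.prems x] by blast
    then show ?thesis using differentiable_on_eq_differentiable_at[of T f] by simp
  qed
  then have "f differentiable_on S"
    by (rule differentiable_at_imp_differentiable_on)
  moreover have "Ck_on k (\<lambda>x. frechet_derivative f (at x) v) S" for v
  proof (rule Suc.IH, rule ballI)
    fix x assume "x \<in> S"
    then obtain T where T: "open T" "x \<in> T" "T \<subseteq> S" "Ck_on (Suc k) f T"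
      using Suc.prems by blast
    from T(4) have "Ck_on k (\<lambda>x. frechet_derivative f (at x) v) T" by simp
    with T(1-3) show "\<exists>T. open T \<and> x \<in> T \<and> T \<subseteq> S
        \<and> Ck_on k (\<lambda>x. frechet_derivative f (at x) v) T" by blast
  qed
  ultimately show ?case by simp
qed

lemma Ck_on_const [simp]: "open S \<Longrightarrow> Ck_on k (\<lambda>x. c) S"
proof (induction k arbitrary: c)
  case (Suc k)
  show ?case
    by (rule Ck_on_SucI[where f' = "\<lambda>x v. 0"]) (use Suc in simp_all)
qed simp

lemma Ck_on_add:
  assumes "open S" "Ck_on k f S" "Ck_on k g S"
  shows "Ck_on k (\<lambda>x. f x + g x) S"
  using assms(2,3)
proof (induction k arbitrary: f g)
  case 0
  then show ?case by (auto intro!: continuous_intros)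
next
  case (Suc k)
  let ?f' = "\<lambda>x. frechet_derivative f (at x)"
  note f' = Ck_on_SucD[OF Suc.prems(1) assms(1)]
  let ?g' = "\<lambda>x. frechet_derivative g (at x)"
  note g' = Ck_on_SucD[OF Suc.prems(2) assms(1)]
  show ?case
    by (rule Ck_on_SucI[OF assms(1), where f' = "\<lambda>x v. ?f' x v + ?g' x v"])
      (use f' g' in \<open>auto intro: has_derivative_add Suc.IH\<close>)
qed

lemma Ck_on_mult:
  fixes f g :: "'a::real_normed_vector \<Rightarrow> 'b::real_normed_algebra"
  assumes "open S" "Ck_on k f S" "Ck_on k g S"
  shows "Ck_on k (\<lambda>x. f x * g x) S"
  using assms(2,3)
proof (induction k arbitrary: f g)
  case 0
  then show ?case by (auto intro!: continuous_intros)
next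
  case (Suc k)
  let ?f' = "\<lambda>x. frechet_derivative f (at x)"
  note f' = Ck_on_SucD[OF Suc.prems(1) assms(1)]
  let ?g' = "\<lambda>x. frechet_derivative g (at x)"
  note g' = Ck_on_SucD[OF Suc.prems(2) assms(1)]
  have "Ck_on k f S" "Ck_on k g S" using Suc.prems Ck_on_Suc_lower by blast+
  then show ?case
    by (intro Ck_on_SucI[OF assms(1), where f' = "\<lambda>x v. f x * ?g' x v + ?f' x v * g x"])
      (use f' g' in \<open>auto intro!: has_derivative_mult Ck_on_add assms(1) Suc.IH\<close>)
qed

lemma Ck_on_power:
  fixes f :: "'a::real_normed_vector \<Rightarrow> 'b::real_normed_algebra_1"
  assumes "open S" "Ck_on k f S"
  shows "Ck_on k (\<lambda>x. f x ^ n) S"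
  by (induction n) (use assms in \<open>auto intro: Ck_on_mult\<close>)

lemma Ck_on_bounded_linear:
  assumes "open S" "bounded_linear T" "Ck_on k f S"
  shows "Ck_on k (\<lambda>x. T (f x)) S"
  using assms(3)
proof (induction k arbitrary: f)
  case 0
  then show ?case using linear_continuous_on_compose assms(2)
    by (metis Ck_on.simps(1) bounded_linear.continuous_on)
next
  case (Suc k)
  let ?f' = "\<lambda>x. frechet_derivative f (at x)"
  note f' = Ck_on_SucD[OF Suc.prems(1) assms(1)]
  show ?case
    by (rule Ck_on_SucI[OF assms(1), where f' = "\<lambda>x v. T (?f' x v)"])
      (use f' in \<open>auto intro: bounded_linear.has_derivative[OF assms(2)] Suc.IH\<close>)
qed

lemma Ck_on_exp:
  fixes f :: "'a::real_normed_vector \<Rightarrow> real"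
  assumes "open S" "Ck_on k f S"
  shows "Ck_on k (\<lambda>x. exp (f x)) S"
  using assms(2)
proof (induction k)
  case 0
  then show ?case by (auto intro!: continuous_intros)
next
  case (Suc k)
  let ?f' = "\<lambda>x. frechet_derivative f (at x)"
  note f' = Ck_on_SucD[OF Suc.prems(1) assms(1)]
  have "Ck_on k (\<lambda>x. exp (f x)) S" using Suc Ck_on_Suc_lower by blast
  then show ?case
    by (intro Ck_on_SucI[OF assms(1), where f' = "\<lambda>x v. exp (f x) * ?f' x v"])
      (use f' in \<open>auto intro!: derivative_eq_intros Ck_on_mult assms(1)\<close>)
qed

lemma Ck_on_holomorphic:
  assumes "open S" "f holomorphic_on S"
  shows "Ck_on k f S"
  using assms(2)
proof (induction k arbitrary: f)
  case 0
  then show ?case by (simp add: holomorphic_on_imp_continuous_on)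
next
  case (Suc k)
  have "deriv f holomorphic_on S" using Suc.prems assms(1) by (rule holomorphic_deriv)
  then have "Ck_on k (\<lambda>x. deriv f x * v) S" for v
    by (rule Ck_on_mult[OF assms(1) Suc.IH Ck_on_const[OF assms(1)]])
  moreover have "(f has_derivative (\<lambda>v. deriv f x * v)) (at x)" if "x \<in> S" for x
    using holomorphic_derivI[OF Suc.prems assms(1) that] by (simp add: has_field_derivative_def)
  ultimately show ?case
    by (intro Ck_on_SucI[OF assms(1), where f' = "\<lambda>x v. deriv f x * v"])
qed

lemma smooth_on_imp_Ck_on: "smooth_on f S \<Longrightarrow> Ck_on k f S"
  by (simp add: smooth_on_def)

section \<open>Functions that are locally real parts of holomorphic functions\<close>

text \<open>Harmonicity in a form that gives access to holomorphic functions; it is equivalent to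
  Laplace's equation on open sets, by \<open>re_hol_imp_harmonic_on\<close> and \<open>harmonic_on_imp_re_hol\<close>.\<close>

definition re_hol :: "(complex \<Rightarrow> real) \<Rightarrow> complex set \<Rightarrow> bool" where
  "re_hol u S \<longleftrightarrow> (\<forall>z\<in>S. \<exists>r>0. \<exists>F. ball z r \<subseteq> S \<and> F holomorphic_on ball z r \<and>
     (\<forall>w\<in>ball z r. u w = Re (F w)))"

lemma re_holE:
  assumes "re_hol u S" "z \<in> S"
  obtains r F where "r > 0" "ball z r \<subseteq> S" "F holomorphic_on ball z r"
    "\<forall>w\<in>ball z r. u w = Re (F w)"
proof -
  have "\<exists>r>0. \<exists>F. ball z r \<subseteq> S \<and> F holomorphic_on ball z r \<and> (\<forall>w\<in>ball z r. u w = Re (F w))"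
    using assms unfolding re_hol_def by blast
  then show ?thesis using that by blast
qed

lemma re_hol_open:
  assumes "re_hol u S"
  shows "open S"
  unfolding open_contains_ball
proof
  fix z assume "z \<in> S"
  then obtain r F where "r > 0" "ball z r \<subseteq> S" by (rule re_holE[OF assms])
  then show "\<exists>r>0. ball z r \<subseteq> S" by blast
qed

lemma re_hol_subset:
  assumes "re_hol u S" "open T" "T \<subseteq> S"
  shows "re_hol u T"
  unfolding re_hol_def
proof
  fix z assume z: "z \<in> T"
  then have "z \<in> S" using assms(3) by blast
  then obtain r F where rF: "r > 0" "ball z r \<subseteq> S" "F holomorphic_on ball z r"
    "\<forall>w\<in>ball z r. u w = Re (F w)" by (rule re_holE[OF assms(1)])
  obtain s where s: "s > 0" "ball z s \<subseteq> T" using assms(2) z openE by blast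
  have sub: "ball z (min r s) \<subseteq> ball z r" "ball z (min r s) \<subseteq> ball z s"
    by (intro subset_ball; simp)+
  have "F holomorphic_on ball z (min r s)" using rF(3) sub(1) by (rule holomorphic_on_subset)
  moreover have "min r s > 0" using rF(1) s(1) by simp
  ultimately show "\<exists>r>0. \<exists>F. ball z r \<subseteq> T \<and> F holomorphic_on ball z r \<and>
      (\<forall>w\<in>ball z r. u w = Re (F w))"
    using sub s(2) rF(4) by blast
qed

lemma re_hol_local:
  assumes "\<And>z. z \<in> S \<Longrightarrow> \<exists>T. z \<in> T \<and> T \<subseteq> S \<and> re_hol u T"
  shows "re_hol u S"
  unfolding re_hol_def
proof
  fix z assume "z \<in> S"
  then obtain T where "z \<in> T" "T \<subseteq> S" "re_hol u T" using assms by blast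
  then obtain r F where F: "r > 0" "ball z r \<subseteq> T" "F holomorphic_on ball z r"
    "\<forall>w\<in>ball z r. u w = Re (F w)" by (elim re_holE)
  then have "ball z r \<subseteq> S" using \<open>T \<subseteq> S\<close> by blast
  with F show "\<exists>r>0. \<exists>F. ball z r \<subseteq> S \<and> F holomorphic_on ball z r \<and>
      (\<forall>w\<in>ball z r. u w = Re (F w))" by blast
qed

lemma re_hol_cong:
  assumes "re_hol u S" "\<And>z. z \<in> S \<Longrightarrow> u z = v z"
  shows "re_hol v S"
  unfolding re_hol_def
proof
  fix z assume "z \<in> S"
  then obtain r F where "r > 0" "ball z r \<subseteq> S" "F holomorphic_on ball z r"
    "\<forall>w\<in>ball z r. u w = Re (F w)" by (rule re_holE[OF assms(1)])
  moreover from this have "\<forall>w\<in>ball z r. v w = Re (F w)" using assms(2) by (metis subsetD)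
  ultimately show "\<exists>r>0. \<exists>F. ball z r \<subseteq> S \<and> F holomorphic_on ball z r \<and>
      (\<forall>w\<in>ball z r. v w = Re (F w))"
    by blast
qed

lemma re_hol_Re:
  assumes "open S" "F holomorphic_on S" "\<And>z. z \<in> S \<Longrightarrow> u z = Re (F z)"
  shows "re_hol u S"
  unfolding re_hol_def
proof
  fix z assume "z \<in> S"
  then obtain r where r: "r > 0" "ball z r \<subseteq> S" using assms(1) openE by blast
  have "F holomorphic_on ball z r" using assms(2) r(2) by (rule holomorphic_on_subset)
  moreover have "\<forall>w\<in>ball z r. u w = Re (F w)" using assms(3) r(2) by blast
  ultimately show "\<exists>r>0. \<exists>F. ball z r \<subseteq> S \<and> F holomorphic_on ball z r \<and>
      (\<forall>w\<in>ball z r. u w = Re (F w))"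
    using r by blast
qed

lemma re_hol_const: "open S \<Longrightarrow> re_hol (\<lambda>z. c) S"
  by (rule re_hol_Re[where F = "\<lambda>z. of_real c"]) auto

lemma re_hol_add:
  assumes "re_hol u S" "re_hol v S"
  shows "re_hol (\<lambda>z. u z + v z) S"
proof (rule re_hol_local)
  fix z assume z: "z \<in> S"
  obtain r F where F: "r > 0" "ball z r \<subseteq> S" "F holomorphic_on ball z r"
    "\<forall>w\<in>ball z r. u w = Re (F w)" by (rule re_holE[OF assms(1) z])
  have "re_hol v (ball z r)" using assms(2) open_ball F(2) by (rule re_hol_subset)
  moreover have "z \<in> ball z r" using F(1) by simp
  ultimately obtain s G where G: "s > 0" "ball z s \<subseteq> ball z r" "G holomorphic_on ball z s"
    "\<forall>w\<in>ball z s. v w = Re (G w)" by (rule re_holE)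
  have "re_hol (\<lambda>z. u z + v z) (ball z s)"
  proof (rule re_hol_Re[OF open_ball])
    show "(\<lambda>w. F w + G w) holomorphic_on ball z s"
      using holomorphic_on_subset[OF F(3) G(2)] G(3) by (rule holomorphic_on_add)
    show "u w + v w = Re (F w + G w)" if "w \<in> ball z s" for w
      using that F(4) G(4) subsetD[OF G(2) that] by simp
  qed
  moreover have "z \<in> ball z s" using G(1) by simp
  moreover have "ball z s \<subseteq> S" using F(2) G(2) by (rule order_trans[rotated])
  ultimately show "\<exists>T. z \<in> T \<and> T \<subseteq> S \<and> re_hol (\<lambda>z. u z + v z) T" by blast
qed

lemma re_hol_cmult:
  assumes "re_hol u S"
  shows "re_hol (\<lambda>z. c * u z) S"
proof (rule re_hol_local)
  fix z assume z: "z \<in> S"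
  obtain r F where F: "r > 0" "ball z r \<subseteq> S" "F holomorphic_on ball z r"
    "\<forall>w\<in>ball z r. u w = Re (F w)" by (rule re_holE[OF assms(1) z])
  have "re_hol (\<lambda>z. c * u z) (ball z r)"
    by (rule re_hol_Re[OF open_ball, where F = "\<lambda>w. of_real c * F w"])
      (use F in \<open>auto intro!: holomorphic_intros\<close>)
  then show "\<exists>T. z \<in> T \<and> T \<subseteq> S \<and> re_hol (\<lambda>z. c * u z) T" using F centre_in_ball by blast
qed

lemma re_hol_diff:
  assumes "re_hol u S" "re_hol v S"
  shows "re_hol (\<lambda>z. u z - v z) S"
  using re_hol_add[OF assms(1) re_hol_cmult[OF assms(2), of "-1"]] by simp

lemma re_hol_imp_continuous_on:
  assumes "re_hol u S"
  shows "continuous_on S u"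
proof -
  have "isCont u z" if z: "z \<in> S" for z
  proof -
    obtain r F where F: "r > 0" "F holomorphic_on ball z r"
      "\<forall>w\<in>ball z r. u w = Re (F w)" by (rule re_holE[OF assms z])
    have "continuous_on (ball z r) (\<lambda>w. Re (F w))"
      using F(2) by (intro continuous_on_Re holomorphic_on_imp_continuous_on)
    then have "continuous_on (ball z r) u"
      using F(3) continuous_on_cong[OF refl, of "ball z r" u "\<lambda>w. Re (F w)"] by simp
    then show ?thesis using F(1) by (simp add: continuous_on_eq_continuous_at)
  qed
  then show ?thesis by (rule continuous_at_imp_continuous_on[OF ballI])
qed

lemma re_hol_ln_cmod:
  assumes "open S" "f holomorphic_on S" "\<And>z. z \<in> S \<Longrightarrow> f z \<noteq> 0"
  shows "re_hol (\<lambda>z. ln (cmod (f z))) S"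
proof (rule re_hol_local)
  fix z assume "z \<in> S"
  then obtain r where r: "r > 0" "ball z r \<subseteq> S" using assms(1) openE by blast
  have "f holomorphic_on ball z r" using assms(2) r(2) by (rule holomorphic_on_subset)
  moreover have "contractible (ball z r)" by (simp add: convex_imp_contractible)
  ultimately obtain g where g: "g holomorphic_on ball z r" "\<And>w. w \<in> ball z r \<Longrightarrow> f w = exp (g w)"
    using contractible_imp_holomorphic_log[of f "ball z r"] assms(3) r(2) by blast
  have "re_hol (\<lambda>z. ln (cmod (f z))) (ball z r)"
    by (rule re_hol_Re[OF open_ball g(1)]) (simp add: g(2))
  then show "\<exists>T. z \<in> T \<and> T \<subseteq> S \<and> re_hol (\<lambda>z. ln (cmod (f z))) T"
    using r centre_in_ball by blast
qed

lemma has_derivative_Re_holomorphic: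
  assumes "open S" "F holomorphic_on S" "\<And>z. z \<in> S \<Longrightarrow> u z = Re (F z)" "z \<in> S"
  shows "(u has_derivative (\<lambda>v. Re (deriv F z * v))) (at z)"
proof -
  have "(F has_derivative (\<lambda>v. deriv F z * v)) (at z)"
    using holomorphic_derivI[OF assms(2,1,4)] by (simp add: has_field_derivative_def)
  then have "((\<lambda>z. Re (F z)) has_derivative (\<lambda>v. Re (deriv F z * v))) (at z)"
    by (rule has_derivative_Re)
  then show ?thesis
    by (rule has_derivative_transform_within_open[OF _ assms(1,4)]) (simp add: assms(3))
qed

lemma pderiv_Re_holomorphic:
  assumes "open S" "F holomorphic_on S" "\<And>z. z \<in> S \<Longrightarrow> u z = Re (F z)" "z \<in> S"
  shows "pderiv_x u z = Re (deriv F z)" "pderiv_y u z = Re (\<i> * deriv F z)"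
  using frechet_derivative_at[OF has_derivative_Re_holomorphic[OF assms], symmetric]
  by (simp_all add: pderiv_x_def pderiv_y_def mult.commute)

lemma re_hol_imp_Ck_on:
  assumes "re_hol u S"
  shows "Ck_on k u S"
proof (rule Ck_on_local, rule ballI)
  fix z assume z: "z \<in> S"
  obtain r F where F: "r > 0" "ball z r \<subseteq> S" "F holomorphic_on ball z r"
    "\<forall>w\<in>ball z r. u w = Re (F w)" by (rule re_holE[OF assms(1) z])
  have "Ck_on k (\<lambda>w. Re (F w)) (ball z r)"
    by (rule Ck_on_bounded_linear[OF open_ball bounded_linear_Re Ck_on_holomorphic[OF open_ball F(3)]])
  then have "Ck_on k u (ball z r)" using F(4) Ck_on_cong[OF open_ball, of z r u] by metis
  then show "\<exists>T. open T \<and> z \<in> T \<and> T \<subseteq> S \<and> Ck_on k u T"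
    using F(1,2) open_ball centre_in_ball by blast
qed

lemma re_hol_imp_harmonic_on:
  assumes "re_hol u S"
  shows "harmonic_on u S"
  unfolding harmonic_on_def
proof (intro conjI ballI)
  show "Ck_on 2 u S" by (rule re_hol_imp_Ck_on[OF assms])
  fix z assume z: "z \<in> S"
  obtain r F where F: "r > 0" "ball z r \<subseteq> S" "F holomorphic_on ball z r"
    "\<forall>w\<in>ball z r. u w = Re (F w)" by (rule re_holE[OF assms(1) z])
  have zb: "z \<in> ball z r" using F(1) by simp
  have 1: "\<And>w. w \<in> ball z r \<Longrightarrow> pderiv_x u w = Re (deriv F w)"
    "\<And>w. w \<in> ball z r \<Longrightarrow> pderiv_y u w = Re (\<i> * deriv F w)"
    using pderiv_Re_holomorphic[OF open_ball F(3), of u] F(4) by blast+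
  have D: "deriv F holomorphic_on ball z r" using F(3) open_ball by (rule holomorphic_deriv)
  then have D2: "(\<lambda>w. \<i> * deriv F w) holomorphic_on ball z r"
    by (rule holomorphic_on_mult[OF holomorphic_on_const])
  have "deriv F field_differentiable at z"
    using D open_ball zb by (rule holomorphic_on_imp_differentiable_at)
  then have "deriv (\<lambda>w. \<i> * deriv F w) z = \<i> * deriv (deriv F) z" by (rule deriv_cmult)
  then show "pderiv_x (pderiv_x u) z + pderiv_y (pderiv_y u) z = 0"
    using pderiv_Re_holomorphic(1)[OF open_ball D 1(1) zb]
      pderiv_Re_holomorphic(2)[OF open_ball D2 1(2) zb] by simp
qed

text \<open>Where \<open>u = Re F\<close>, an interior maximum of \<open>u\<close> is one of \<open>\<bar>exp F\<bar> = exp u\<close>, so the maximum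
  modulus principle makes the set of maximum points open. Being compact as well, it is empty.\<close>

lemma re_hol_maximum_principle:
  assumes u: "re_hol u S" and S: "bounded S"
    and bd: "\<And>\<zeta> \<epsilon>. \<zeta> \<in> frontier S \<Longrightarrow> \<epsilon> > 0 \<Longrightarrow> \<forall>\<^sub>F z in at \<zeta> within S. u z < c + \<epsilon>"
    and z: "z \<in> S"
  shows "u z \<le> c"
proof (rule ccontr)
  assume neg: "\<not> u z \<le> c"
  define K where "K = {w \<in> S. u z \<le> u w}"
  have opS: "open S" using u by (rule re_hol_open)
  have cont: "continuous_on S u" using u by (rule re_hol_imp_continuous_on)
  have "\<zeta> \<in> K" if \<zeta>: "\<zeta> islimpt K" for \<zeta>
  proof -
    have ntK: "\<not> trivial_limit (at \<zeta> within K)" using \<zeta> by (simp add: trivial_limit_within)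
    have le: "\<forall>\<^sub>F w in at \<zeta> within K. u z \<le> u w"
      by (auto simp: eventually_at_filter K_def)
    have "at \<zeta> within K \<le> at \<zeta> within S" by (rule at_le) (auto simp: K_def)
    show ?thesis
    proof (cases "\<zeta> \<in> S")
      case True
      then have "(u \<longlongrightarrow> u \<zeta>) (at \<zeta> within S)" using cont by (simp add: continuous_on_def)
      then have "(u \<longlongrightarrow> u \<zeta>) (at \<zeta> within K)"
        using \<open>at \<zeta> within K \<le> at \<zeta> within S\<close> by (rule tendsto_mono[rotated])
      then have "u z \<le> u \<zeta>" using tendsto_lowerbound le ntK by blast
      then show ?thesis using True by (simp add: K_def)
    next
      case False
      have "K \<subseteq> S" by (auto simp: K_def)
      then have "\<zeta> \<in> closure S" using \<zeta> islimpt_subset by (metis UnCI closure_def mem_Collect_eq)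
      then have "\<zeta> \<in> frontier S" using False opS by (simp add: frontier_def interior_open)
      then have "\<forall>\<^sub>F w in at \<zeta> within S. u w < c + (u z - c)" using neg by (intro bd) auto
      then have "\<forall>\<^sub>F w in at \<zeta> within K. u w < u z"
        using \<open>at \<zeta> within K \<le> at \<zeta> within S\<close> filter_leD by fastforce
      then have "\<forall>\<^sub>F w in at \<zeta> within K. False" using le by eventually_elim simp
      then show ?thesis using ntK by simp
    qed
  qed
  then have "closed K" using closed_limpt by blast
  moreover have "bounded K" using S by (rule bounded_subset) (auto simp: K_def)
  ultimately have K: "compact K" by (simp add: compact_eq_bounded_closed)
  have contK: "continuous_on K u" using cont by (rule continuous_on_subset) (auto simp: K_def)
  have "z \<in> K" using z by (simp add: K_def)
  then obtain z2 where z2: "z2 \<in> K" "\<And>w. w \<in> K \<Longrightarrow> u w \<le> u z2"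
    using continuous_attains_sup[OF K _ contK] by blast
  have max: "u w \<le> u z2" if "w \<in> S" for w
    using z2(2)[of w] z2(1) that by (cases "w \<in> K") (auto simp: K_def)
  define A where "A = {w \<in> K. u w = u z2}"
  have "closed A" unfolding A_def
    using continuous_closed_preimage_constant[OF contK] K compact_imp_closed by blast
  moreover have "open A" unfolding open_contains_ball
  proof
    fix w assume w: "w \<in> A"
    then have "w \<in> S" by (auto simp: A_def K_def)
    then obtain r F where F: "r > 0" "ball w r \<subseteq> S" "F holomorphic_on ball w r"
      "\<forall>y\<in>ball w r. u y = Re (F y)" by (rule re_holE[OF u])
    have wb: "w \<in> ball w r" using F(1) by simp
    have "(\<lambda>y. exp (F y)) constant_on ball w r"
    proof (rule maximum_modulus_principle[where S = "ball w r" and U = "ball w r" and \<xi> = w])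
      show "(\<lambda>y. exp (F y)) holomorphic_on ball w r" using F(3) by (intro holomorphic_intros)
      show "cmod (exp (F y)) \<le> cmod (exp (F w))" if "y \<in> ball w r" for y
        proof -
        have "u y \<le> u w" using max[of y] F(2) that w by (auto simp: A_def)
        moreover have "u y = Re (F y)" "u w = Re (F w)" using F(4) that wb by blast+
        ultimately show ?thesis by simp
      qed
    qed (use F(1) in auto)
    then have "exp (F y) = exp (F w)" if "y \<in> ball w r" for y
      using that wb unfolding constant_on_def by metis
    then have "cmod (exp (F y)) = cmod (exp (F w))" if "y \<in> ball w r" for y
      using that by metis
    then have "u y = u w" if "y \<in> ball w r" for y
      using that F(4) wb by (metis exp_inj_iff norm_exp_eq_Re)
    moreover have "u w = u z2" "u z \<le> u w" using w by (auto simp: A_def K_def)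
    ultimately have "ball w r \<subseteq> A" using F(2) unfolding A_def K_def by force
    then show "\<exists>e>0. ball w e \<subseteq> A" using F(1) by blast
  qed
  moreover have "z2 \<in> A" using z2(1) by (simp add: A_def)
  ultimately have "A = UNIV" using clopen[of A] by auto
  moreover have "A \<subseteq> S" by (auto simp: A_def K_def)
  ultimately show False using S not_bounded_UNIV by (metis top.extremum_uniqueI)
qed

lemma re_hol_le_boundary:
  assumes "re_hol u S" "bounded S" "z \<in> S"
    and "\<And>\<zeta>. \<zeta> \<in> frontier S \<Longrightarrow> (u \<longlongrightarrow> f \<zeta>) (at \<zeta> within S)"
    and "\<And>\<zeta>. \<zeta> \<in> frontier S \<Longrightarrow> f \<zeta> \<le> c"
  shows "u z \<le> c"
proof (rule re_hol_maximum_principle[OF assms(1,2) _ assms(3)])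
  fix \<zeta> and \<epsilon> :: real assume "\<zeta> \<in> frontier S" "\<epsilon> > 0"
  with assms(4,5) have "(u \<longlongrightarrow> f \<zeta>) (at \<zeta> within S)" "f \<zeta> < c + \<epsilon>" by force+
  then show "\<forall>\<^sub>F z in at \<zeta> within S. u z < c + \<epsilon>" by (rule order_tendstoD(2))
qed

lemma re_hol_le_on_closure:
  assumes "re_hol u S" "bounded S" "continuous_on (closure S) u"
    and "\<And>\<zeta>. \<zeta> \<in> frontier S \<Longrightarrow> u \<zeta> \<le> c" and "z \<in> closure S"
  shows "u z \<le> c"
proof (cases "z \<in> S")
  case True
  show ?thesis
  proof (rule re_hol_le_boundary[OF assms(1,2) True _ assms(4)])
    fix \<zeta> assume "\<zeta> \<in> frontier S"
    then have "(u \<longlongrightarrow> u \<zeta>) (at \<zeta> within closure S)"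
      using assms(3) by (simp add: continuous_on_def frontier_def)
    then show "(u \<longlongrightarrow> u \<zeta>) (at \<zeta> within S)"
      using closure_subset by (rule tendsto_within_subset)
  qed
next
  case False
  then show ?thesis using assms(4,5) re_hol_open[OF assms(1)] by (simp add: frontier_def interior_open)
qed

section \<open>The Poisson integral\<close>

definition poisson_kernel :: "complex \<Rightarrow> real \<Rightarrow> real" where
  "poisson_kernel w t = (1 - (cmod w)\<^sup>2) / (cmod (cis t - w))\<^sup>2"

lemma cis_neq_in_ball: "w \<in> ball 0 1 \<Longrightarrow> cis t - w \<noteq> 0"
  by (metis dist_0_norm eq_iff_diff_eq_0 less_irrefl mem_ball norm_cis)

lemma poisson_kernel_eq_Re:
  "poisson_kernel w t = Re ((cis t + w) / (cis t - w))"
proof -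
  have "(cis t + w) / (cis t - w) = (cis t + w) * cnj (cis t - w) / of_real ((cmod (cis t - w))\<^sup>2)"
    by (metis complex_div_cnj of_real_power)
  then have "Re ((cis t + w) / (cis t - w)) = Re ((cis t + w) * cnj (cis t - w)) / (cmod (cis t - w))\<^sup>2"
    by (metis Re_divide_of_real)
  moreover have "Re ((cis t + w) * cnj (cis t - w)) = (cmod (cis t))\<^sup>2 - (cmod w)\<^sup>2"
    unfolding cmod_power2 by (simp add: algebra_simps power2_eq_square)
  ultimately show ?thesis by (simp add: poisson_kernel_def)
qed

lemma poisson_kernel_nonneg: "w \<in> ball 0 1 \<Longrightarrow> 0 \<le> poisson_kernel w t"
  by (simp add: poisson_kernel_def power_le_one)

lemma poisson_kernel_le:
  assumes "w \<in> ball 0 1"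
  shows "poisson_kernel w t \<le> (1 + cmod w) / (1 - cmod w)"
proof -
  have pos: "0 < 1 - cmod w" using assms by simp
  have "1 - cmod w \<le> cmod (cis t - w)" using norm_triangle_ineq2[of "cis t" w] by simp
  then have "(1 - cmod w)\<^sup>2 \<le> (cmod (cis t - w))\<^sup>2" using pos by (intro power_mono) auto
  then have "poisson_kernel w t \<le> (1 - (cmod w)\<^sup>2) / (1 - cmod w)\<^sup>2"
    unfolding poisson_kernel_def using pos \<open>1 - cmod w \<le> cmod (cis t - w)\<close>
    by (intro divide_left_mono mult_pos_pos zero_less_power) (auto simp: power_le_one)
  also have "\<dots> = (1 + cmod w) / (1 - cmod w)"
  proof -
    have "1 - (cmod w)\<^sup>2 = (1 - cmod w) * (1 + cmod w)"
      by (simp add: power2_eq_square algebra_simps)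
    then show ?thesis using pos by (simp add: power2_eq_square)
  qed
  finally show ?thesis .
qed

lemma continuous_on_poisson_kernel_snd:
  assumes "w \<in> ball 0 1"
  shows "continuous_on A (poisson_kernel w)"
  unfolding poisson_kernel_def using cis_neq_in_ball[OF assms] by (intro continuous_intros) auto

lemma has_field_derivative_schwarz:
  assumes "continuous_on {0..2*pi} g" "w \<in> ball 0 1"
  shows "((\<lambda>w. integral {0..2*pi} (\<lambda>t. (cis t + w) / (cis t - w) * g t)) has_field_derivative
    integral {0..2*pi} (\<lambda>t. 2 * cis t / (cis t - w)\<^sup>2 * g t)) (at w)"
proof -
  have nz: "cis t - w \<noteq> 0" if "w \<in> ball 0 1" for t w using that by (rule cis_neq_in_ball)
  have "((\<lambda>w. integral (cbox 0 (2*pi)) (\<lambda>t. (cis t + w) / (cis t - w) * g t)) has_field_derivative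
    integral (cbox 0 (2*pi)) (\<lambda>t. 2 * cis t / (cis t - w)\<^sup>2 * g t)) (at w within ball 0 1)"
  proof (rule leibniz_rule_field_derivative[OF _ _ _ assms(2) convex_ball])
    fix x :: complex and t :: real assume x: "x \<in> ball 0 1"
    have "((\<lambda>x. (cis t + x) / (cis t - x)) has_field_derivative
        ((1 * (cis t - x) - (cis t + x) * (- 1)) / ((cis t - x) * (cis t - x)))) (at x within ball 0 1)"
      using nz[OF x, of t]
      by (intro DERIV_divide derivative_eq_intros) auto
    moreover have "(1 * (cis t - x) - (cis t + x) * (- 1)) / ((cis t - x) * (cis t - x))
        = 2 * cis t / (cis t - x)\<^sup>2"
      by (simp add: power2_eq_square)
    ultimately have "((\<lambda>x. (cis t + x) / (cis t - x)) has_field_derivative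
        2 * cis t / (cis t - x)\<^sup>2) (at x within ball 0 1)" by simp
    then show "((\<lambda>x. (cis t + x) / (cis t - x) * g t) has_field_derivative
        2 * cis t / (cis t - x)\<^sup>2 * g t) (at x within ball 0 1)"
      by (rule DERIV_cmult_right)
  next
    fix x :: complex assume x: "x \<in> ball 0 1"
    have "continuous_on {0..2*pi} (\<lambda>t. (cis t + x) / (cis t - x) * g t)"
      using nz[OF x] assms(1) by (intro continuous_intros) auto
    then show "(\<lambda>t. (cis t + x) / (cis t - x) * g t) integrable_on cbox 0 (2*pi)"
      by (simp add: integrable_continuous_real)
  next
    have "continuous_on (ball 0 1 \<times> {0..2*pi}) (\<lambda>p. g (snd p))"
      by (rule continuous_on_compose2[OF assms(1) continuous_on_snd[OF continuous_on_id]]) auto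
    then show "continuous_on (ball 0 1 \<times> cbox 0 (2*pi)) (\<lambda>(x, t). 2 * cis t / (cis t - x)\<^sup>2 * g t)"
      unfolding split_beta using nz by (auto intro!: continuous_intros)
  qed
  then show ?thesis using assms(2) by (simp add: at_within_open[OF _ open_ball])
qed

text \<open>The derivative of \<open>w \<mapsto> \<integral> (cis t + w) / (cis t - w) dt\<close> is the integral of
  \<open>d/dt (2 \<i> / (cis t - w))\<close> over a period, so this function has its value \<open>2 \<pi>\<close> at \<open>0\<close>
  everywhere.\<close>

lemma integral_schwarz_kernel:
  assumes w: "w \<in> ball 0 1"
  shows "integral {0..2*pi} (\<lambda>t. (cis t + w) / (cis t - w)) = 2 * pi"
proof -
  let ?S = "\<lambda>w. integral {0..2*pi} (\<lambda>t. (cis t + w) / (cis t - w) * 1)"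
  have D: "(?S has_field_derivative 0) (at x within ball 0 1)" if x: "x \<in> ball 0 1" for x
  proof -
    have "((\<lambda>t. 2 * cis t / (cis t - x)\<^sup>2 * 1) has_integral
        2 * \<i> / (cis (2*pi) - x) - 2 * \<i> / (cis 0 - x)) {0..2*pi}"
    proof (rule fundamental_theorem_of_calculus)
      fix t :: real
      have nz: "cis t - x \<noteq> 0" using x by (rule cis_neq_in_ball)
      have c: "(cis has_vector_derivative \<i> * cis t) (at t within {0..2*pi})"
        unfolding has_vector_derivative_def
        by (rule has_derivative_eq_rhs[OF has_derivative_cis[OF has_derivative_ident]])
          (auto simp: fun_eq_iff scaleR_conv_of_real)
      have d: "((\<lambda>z. 2 * \<i> / (z - x)) has_field_derivative - (2 * \<i>) / (cis t - x)\<^sup>2) (at (cis t))"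
        using nz by (auto intro!: derivative_eq_intros simp: power2_eq_square)
      have "((\<lambda>z. 2 * \<i> / (z - x)) \<circ> cis has_vector_derivative
          (\<i> * cis t) * (- (2 * \<i>) / (cis t - x)\<^sup>2)) (at t within {0..2*pi})"
        using field_vector_diff_chain_within[OF c has_field_derivative_at_within[OF d]] .
      moreover have "\<i> * cis t * (- (2 * \<i>)) = 2 * cis t" by (simp add: complex_eq_iff)
      ultimately show "((\<lambda>t. 2 * \<i> / (cis t - x)) has_vector_derivative
          2 * cis t / (cis t - x)\<^sup>2 * 1) (at t within {0..2*pi})"
        by (simp only: o_def times_divide_eq_right mult_1_right)
    qed simp
    from integral_unique[OF this]
    have "integral {0..2*pi} (\<lambda>t. 2 * cis t / (cis t - x)\<^sup>2 * 1) = 0"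
      by (simp only: cis_2pi cis_zero diff_self)
    with has_field_derivative_schwarz[OF continuous_on_const x, of 1]
    have "(?S has_field_derivative 0) (at x)" by simp
    then show ?thesis by (rule has_field_derivative_at_within)
  qed
  have "\<exists>c. \<forall>x\<in>ball 0 1. ?S x = c"
    by (rule has_field_derivative_zero_constant[OF convex_ball D])
  then obtain c where c: "\<forall>x\<in>ball 0 1. ?S x = c" ..
  have "?S w = ?S 0" using bspec[OF c w] bspec[OF c, of 0] by simp
  also have "?S 0 = 2 * pi" by (simp add: scaleR_conv_of_real)
  finally show ?thesis by simp
qed

lemma has_integral_poisson_kernel:
  assumes "w \<in> ball 0 1"
  shows "(poisson_kernel w has_integral 2 * pi) {0..2*pi}"
proof -
  have "continuous_on {0..2*pi} (\<lambda>t. (cis t + w) / (cis t - w))"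
    using cis_neq_in_ball[OF assms] by (intro continuous_intros) auto
  then have "((\<lambda>t. (cis t + w) / (cis t - w)) has_integral of_real (2 * pi)) {0..2*pi}"
    using integral_schwarz_kernel[OF assms]
    by (simp add: integrable_continuous_real has_integral_integrable_integral)
  from has_integral_linear[OF this bounded_linear_Re] show ?thesis
    by (simp add: o_def poisson_kernel_eq_Re[abs_def])
qed

text \<open>The Poisson modification of potential theory. It is an operator on functions on the whole
  plane, so that modifications on different discs can be composed.\<close>

definition poisson_mod :: "complex \<Rightarrow> real \<Rightarrow> (complex \<Rightarrow> real) \<Rightarrow> complex \<Rightarrow> real" where
  "poisson_mod a r v z =
     (if z \<in> ball a r
      then integral {0..2*pi} (\<lambda>t. poisson_kernel ((z - a) / of_real r) t * v (a + rcis r t)) / (2 * pi)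
      else v z)"

lemma poisson_mod_outside: "z \<notin> ball a r \<Longrightarrow> poisson_mod a r v z = v z"
  by (simp add: poisson_mod_def)

lemma circle_point_in_sphere: "r > 0 \<Longrightarrow> a + rcis r t \<in> sphere a r"
  by (simp add: dist_norm)

lemma scale_in_unit_ball:
  fixes a z :: complex
  assumes "z \<in> ball a r"
  shows "(z - a) / of_real r \<in> ball 0 1"
proof -
  have "0 < r" using assms by (metis ball_eq_empty empty_iff not_le)
  then show ?thesis using assms by (simp add: norm_divide dist_norm norm_minus_commute)
qed

lemma continuous_on_circle:
  assumes "continuous_on (sphere a r) v" "r > 0"
  shows "continuous_on A (\<lambda>t. v (a + rcis r t))"
  by (rule continuous_on_compose2[OF assms(1)])
    (auto simp: rcis_def dist_norm norm_mult assms(2) less_imp_le intro!: continuous_intros)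

lemma poisson_integrand_integrable:
  assumes "continuous_on (sphere a r) v" "z \<in> ball a r"
  shows "(\<lambda>t. poisson_kernel ((z - a) / of_real r) t * v (a + rcis r t)) integrable_on {0..2*pi}"
proof -
  have "r > 0" using assms(2) by (metis ball_eq_empty empty_iff not_le)
  then show ?thesis
    using assms scale_in_unit_ball continuous_on_poisson_kernel_snd continuous_on_circle
    by (intro integrable_continuous_real continuous_on_mult) auto
qed

text \<open>The Poisson integral is the real part of the Schwarz integral.\<close>

lemma re_hol_poisson_mod:
  assumes v: "continuous_on (sphere a r) v" and r: "r > 0"
  shows "re_hol (poisson_mod a r v) (ball a r)"
proof -
  define g where "g t = complex_of_real (v (a + rcis r t))" for t
  define S where "S w = integral {0..2*pi} (\<lambda>t. (cis t + w) / (cis t - w) * g t)" for w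
  have g: "continuous_on {0..2*pi} g"
    unfolding g_def by (intro continuous_intros continuous_on_circle v r)
  have S: "S holomorphic_on ball 0 1"
    unfolding S_def using has_field_derivative_schwarz[OF g] has_field_derivative_at_within
    by (intro holomorphic_onI) (auto simp: field_differentiable_def, blast)
  have "(\<lambda>z. S ((z - a) / of_real r)) holomorphic_on ball a r"
  proof -
    have "(\<lambda>z. (z - a) / of_real r) holomorphic_on ball a r"
      using r by (intro holomorphic_intros) auto
    moreover have "(\<lambda>z. (z - a) / of_real r) ` ball a r \<subseteq> ball 0 1"
      using scale_in_unit_ball by blast
    ultimately show ?thesis
      using holomorphic_on_compose_gen[OF _ S, of "\<lambda>z. (z - a) / of_real r" "ball a r"]
      by (simp add: o_def)
  qed
  then have hol: "(\<lambda>z. S ((z - a) / of_real r) / of_real (2 * pi)) holomorphic_on ball a r"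
    by (intro holomorphic_on_divide holomorphic_on_const) auto
  show ?thesis
  proof (rule re_hol_Re[OF open_ball hol])
    fix z assume z: "z \<in> ball a r"
    define w where "w = (z - a) / of_real r"
    have w: "w \<in> ball 0 1" unfolding w_def using z by (rule scale_in_unit_ball)
    have "continuous_on {0..2*pi} (\<lambda>t. (cis t + w) / (cis t - w) * g t)"
      using cis_neq_in_ball[OF w] g by (intro continuous_intros) auto
    then have "(\<lambda>t. (cis t + w) / (cis t - w) * g t) integrable_on {0..2*pi}"
      by (rule integrable_continuous_real)
    from integral_linear[OF this bounded_linear_Re]
    have "Re (S w) = integral {0..2*pi} (\<lambda>t. Re ((cis t + w) / (cis t - w) * g t))"
      by (simp add: S_def o_def)
    also have "\<dots> = integral {0..2*pi} (\<lambda>t. poisson_kernel w t * v (a + rcis r t))"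
      unfolding poisson_kernel_eq_Re g_def
      by (intro integral_cong) (simp only: times_complex.sel Re_complex_of_real Im_complex_of_real
          mult_zero_right diff_zero)
    finally show "poisson_mod a r v z = Re (S ((z - a) / of_real r) / of_real (2 * pi))"
      unfolding poisson_mod_def using z by (simp only: Re_divide_of_real w_def if_True)
  qed
qed

lemma poisson_mod_mono:
  assumes "continuous_on (sphere a r) u" "continuous_on (sphere a r) v"
    and "\<And>z. z \<in> sphere a r \<Longrightarrow> u z \<le> v z" and "u z \<le> v z"
  shows "poisson_mod a r u z \<le> poisson_mod a r v z"
proof (cases "z \<in> ball a r")
  case True
  then have r: "r > 0" by (metis ball_eq_empty empty_iff not_le)
  show ?thesis unfolding poisson_mod_def
    using True assms(3)[OF circle_point_in_sphere[OF r]] poisson_kernel_nonneg[OF scale_in_unit_ball[OF True]]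
      poisson_integrand_integrable[OF assms(1) True] poisson_integrand_integrable[OF assms(2) True]
    by (auto intro!: divide_right_mono integral_le mult_left_mono)
next
  case False
  then show ?thesis using assms(4) by (simp add: poisson_mod_def)
qed

lemma poisson_mod_diff:
  assumes "continuous_on (sphere a r) u" "continuous_on (sphere a r) v"
  shows "poisson_mod a r (\<lambda>z. u z - v z) z = poisson_mod a r u z - poisson_mod a r v z"
proof (cases "z \<in> ball a r")
  case True
  then show ?thesis
    using integral_diff[OF poisson_integrand_integrable[OF assms(1) True]
        poisson_integrand_integrable[OF assms(2) True]]
    by (simp add: poisson_mod_def right_diff_distrib diff_divide_distrib)
qed (simp add: poisson_mod_def)

lemma poisson_mod_const: "poisson_mod a r (\<lambda>z. c) z = c"
proof (cases "z \<in> ball a r")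
  case True
  then show ?thesis
    using integral_unique[OF has_integral_poisson_kernel[OF scale_in_unit_ball[OF True]]]
    by (simp add: poisson_mod_def)
qed (simp add: poisson_mod_def)

lemma poisson_mod_abs_diff_le:
  assumes "continuous_on (sphere a r) u" "continuous_on (sphere a r) v"
    and "\<And>z. z \<in> sphere a r \<Longrightarrow> \<bar>u z - v z\<bar> \<le> c" "\<bar>u z - v z\<bar> \<le> c"
  shows "\<bar>poisson_mod a r u z - poisson_mod a r v z\<bar> \<le> c"
proof -
  have "poisson_mod a r (\<lambda>z. u z - v z) z \<le> poisson_mod a r (\<lambda>z. c) z"
    using assms by (intro poisson_mod_mono continuous_on_diff continuous_on_const) (auto simp: abs_le_iff)
  moreover have "poisson_mod a r (\<lambda>z. - c) z \<le> poisson_mod a r (\<lambda>z. u z - v z) z"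
    using assms by (intro poisson_mod_mono continuous_on_diff continuous_on_const) (force simp: abs_le_iff)+
  ultimately show ?thesis
    using poisson_mod_diff[OF assms(1,2)] by (simp add: poisson_mod_const abs_le_iff)
qed

lemma poisson_mod_centre:
  assumes "r > 0"
  shows "poisson_mod a r v a = integral {0..2*pi} (\<lambda>t. v (a + rcis r t)) / (2 * pi)"
  using assms by (simp add: poisson_mod_def poisson_kernel_def)

lemma harnack:
  assumes "continuous_on (sphere a r) v" "\<And>z. z \<in> sphere a r \<Longrightarrow> 0 \<le> v z" "z \<in> ball a r"
  shows "poisson_mod a r v z \<le> (r + dist a z) / (r - dist a z) * poisson_mod a r v a"
proof -
  have r: "r > 0" using assms(3) by (metis ball_eq_empty empty_iff not_le)
  define w where "w = (z - a) / of_real r"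
  have w: "w \<in> ball 0 1" unfolding w_def using assms(3) by (rule scale_in_unit_ball)
  have cw: "cmod w = dist a z / r"
    using r by (simp add: w_def norm_divide dist_norm norm_minus_commute)
  have *: "(1 + cmod w) / (1 - cmod w) = (r + dist a z) / (r - dist a z)"
    using r assms(3) unfolding cw by (simp add: field_simps)
  have int: "(\<lambda>t. v (a + rcis r t)) integrable_on {0..2*pi}"
    using continuous_on_circle[OF assms(1) r] by (rule integrable_continuous_real)
  have "integral {0..2*pi} (\<lambda>t. poisson_kernel w t * v (a + rcis r t))
      \<le> integral {0..2*pi} (\<lambda>t. (1 + cmod w) / (1 - cmod w) * v (a + rcis r t))"
    unfolding w_def
    by (rule integral_le[OF poisson_integrand_integrable[OF assms(1,3)] integrable_on_mult_right[OF int]])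
      (rule mult_right_mono[OF poisson_kernel_le[OF w, unfolded w_def]
          assms(2)[OF circle_point_in_sphere[OF r]]])
  also have "\<dots> = (1 + cmod w) / (1 - cmod w) * integral {0..2*pi} (\<lambda>t. v (a + rcis r t))"
    by (rule integral_mult_right)
  finally have "integral {0..2*pi} (\<lambda>t. poisson_kernel w t * v (a + rcis r t)) / (2 * pi)
      \<le> (r + dist a z) / (r - dist a z) * integral {0..2*pi} (\<lambda>t. v (a + rcis r t)) / (2 * pi)"
    unfolding * by (intro divide_right_mono) auto
  moreover have "poisson_mod a r v z
      = integral {0..2*pi} (\<lambda>t. poisson_kernel w t * v (a + rcis r t)) / (2 * pi)"
    using assms(3) by (simp add: poisson_mod_def w_def)
  ultimately show ?thesis unfolding poisson_mod_centre[OF r] by (simp only: times_divide_eq_right)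
qed

text \<open>The boundary values are attained because the kernel is positive with integral \<open>2 \<pi>\<close> and tends
  to \<open>0\<close> uniformly away from the boundary point that is approached.\<close>

lemma continuous_on_cball_poisson_mod:
  assumes v: "continuous_on (sphere a r) v" and r: "r > 0"
  shows "continuous_on (cball a r) (poisson_mod a r v)"
  unfolding continuous_on_eq_continuous_within
proof
  fix \<zeta> assume \<zeta>: "\<zeta> \<in> cball a r"
  show "continuous (at \<zeta> within cball a r) (poisson_mod a r v)"
  proof (cases "\<zeta> \<in> ball a r")
    case True
    have "continuous_on (ball a r) (poisson_mod a r v)"
      using re_hol_poisson_mod[OF v r] by (rule re_hol_imp_continuous_on)
    then have "isCont (poisson_mod a r v) \<zeta>"
      using True continuous_on_eq_continuous_at[OF open_ball] by blast
    then show ?thesis by (rule continuous_at_imp_continuous_at_within)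
  next
    case False
    then have \<zeta>s: "\<zeta> \<in> sphere a r" using \<zeta> by auto
    have P\<zeta>: "poisson_mod a r v \<zeta> = v \<zeta>" using False by (rule poisson_mod_outside)
    have "bounded (v ` sphere a r)"
      using compact_continuous_image[OF v compact_sphere] by (rule compact_imp_bounded)
    then obtain M where M: "M > 0" "\<And>x. x \<in> sphere a r \<Longrightarrow> \<bar>v x\<bar> \<le> M"
      unfolding bounded_pos by auto
    show ?thesis unfolding continuous_within_eps_delta
    proof (intro allI impI)
      fix e :: real assume e: "e > 0"
      then obtain \<delta> where \<delta>: "\<delta> > 0" "\<And>x. x \<in> sphere a r \<Longrightarrow> dist x \<zeta> < \<delta> \<Longrightarrow> \<bar>v x - v \<zeta>\<bar> < e / 2"
        using v \<zeta>s unfolding continuous_on_iff dist_real_def by (metis half_gt_zero)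
      define d where "d = min (\<delta> / 2) (e * \<delta>\<^sup>2 / (64 * M * r))"
      have d: "d > 0" using e \<delta>(1) M(1) r by (simp add: d_def)
      have "\<bar>poisson_mod a r v z - v \<zeta>\<bar> < e" if z: "z \<in> cball a r" "dist z \<zeta> < d" for z
      proof (cases "z \<in> ball a r")
        case False
        then have "z \<in> sphere a r" "dist z \<zeta> < \<delta>" using z \<delta>(1) by (auto simp: d_def)
        then show ?thesis using \<delta>(2)[of z] e poisson_mod_outside[OF False] by simp
      next
        case zb: True
        define w where "w = (z - a) / of_real r"
        define C where "C = 8 * M * r\<^sup>2 / \<delta>\<^sup>2 * (1 - (cmod w)\<^sup>2)"
        have w: "w \<in> ball 0 1" unfolding w_def using zb by (rule scale_in_unit_ball)
        have cw: "cmod w = dist a z / r"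
          using r by (simp add: w_def norm_divide dist_norm norm_minus_commute)
        have w1: "0 \<le> 1 - (cmod w)\<^sup>2" using w by (simp add: power_le_one)
        have pt: "\<bar>poisson_kernel w t * (v (a + rcis r t) - v \<zeta>)\<bar> \<le> poisson_kernel w t * (e / 2) + C" for t
        proof -
          define x where "x = a + rcis r t"
          have x: "x \<in> sphere a r" unfolding x_def using r by (rule circle_point_in_sphere)
          have pk: "0 \<le> poisson_kernel w t" using w by (rule poisson_kernel_nonneg)
          have C: "0 \<le> C" using w1 M(1) by (simp add: C_def)
          have abs: "\<bar>poisson_kernel w t * (v x - v \<zeta>)\<bar> = poisson_kernel w t * \<bar>v x - v \<zeta>\<bar>"
            using pk by (simp add: abs_mult)
          show ?thesis
          proof (cases "dist x \<zeta> < \<delta>")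
            case True
            then have "poisson_kernel w t * \<bar>v x - v \<zeta>\<bar> \<le> poisson_kernel w t * (e / 2)"
              using \<delta>(2)[OF x] pk by (intro mult_left_mono) auto
            then show ?thesis using abs C unfolding x_def by simp
          next
            case False
            have "dist z \<zeta> < \<delta> / 2" using z(2) by (simp add: d_def)
            then have "\<delta> / 2 \<le> dist x z" using False dist_triangle[of x \<zeta> z] by simp
            also have "dist x z = r * cmod (cis t - w)"
            proof -
              have "of_real r * w = z - a" using r by (simp add: w_def)
              then have "x - z = of_real r * (cis t - w)"
                by (simp add: x_def rcis_def right_diff_distrib)
              then show ?thesis using r by (simp add: dist_norm norm_mult)
            qed
            finally have "(\<delta> / 2)\<^sup>2 \<le> (r * cmod (cis t - w))\<^sup>2"
              using \<delta>(1) by (intro power_mono) auto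
            then have 1: "\<delta>\<^sup>2 / (4 * r\<^sup>2) \<le> (cmod (cis t - w))\<^sup>2"
              using r by (simp add: power_mult_distrib power_divide field_simps)
            have "poisson_kernel w t \<le> (1 - (cmod w)\<^sup>2) / (\<delta>\<^sup>2 / (4 * r\<^sup>2))"
              unfolding poisson_kernel_def using 1 w1 \<delta>(1) r cis_neq_in_ball[OF w, of t]
              by (intro divide_left_mono mult_pos_pos) auto
            moreover have "\<bar>v x - v \<zeta>\<bar> \<le> 2 * M" using M(2)[OF x] M(2)[OF \<zeta>s] by linarith
            ultimately have "poisson_kernel w t * \<bar>v x - v \<zeta>\<bar>
                \<le> (1 - (cmod w)\<^sup>2) / (\<delta>\<^sup>2 / (4 * r\<^sup>2)) * (2 * M)"
              using w1 pk by (intro mult_mono) auto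
            also have "\<dots> = C" by (simp add: C_def)
            finally have "\<bar>poisson_kernel w t * (v x - v \<zeta>)\<bar> \<le> C" using abs by simp
            moreover have "0 \<le> poisson_kernel w t * (e / 2)" using pk e by simp
            ultimately show ?thesis unfolding x_def by linarith
          qed
        qed
        have cd: "continuous_on (sphere a r) (\<lambda>x. v x - v \<zeta>)"
          by (intro continuous_on_diff v continuous_on_const)
        have I: "((\<lambda>t. poisson_kernel w t * (e / 2) + C) has_integral (2 * pi * (e / 2) + 2 * pi * C)) {0..2*pi}"
          using has_integral_add[OF has_integral_mult_left[OF has_integral_poisson_kernel[OF w], of "e / 2"]
              has_integral_const_real[of C 0 "2*pi"]] by simp
        have "\<bar>integral {0..2*pi} (\<lambda>t. poisson_kernel w t * (v (a + rcis r t) - v \<zeta>))\<bar>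
            \<le> 2 * pi * (e / 2) + 2 * pi * C"
          using integral_norm_bound_integral[OF poisson_integrand_integrable[OF cd zb]
              has_integral_integrable[OF I]] pt integral_unique[OF I] by (simp add: w_def)
        then have "\<bar>integral {0..2*pi} (\<lambda>t. poisson_kernel w t * (v (a + rcis r t) - v \<zeta>)) / (2 * pi)\<bar>
            \<le> (2 * pi * (e / 2) + 2 * pi * C) / (2 * pi)"
          by (simp add: abs_divide divide_right_mono)
        also have "\<dots> = e / 2 + C" by (simp add: add_divide_distrib)
        finally have "\<bar>poisson_mod a r (\<lambda>x. v x - v \<zeta>) z\<bar> \<le> e / 2 + C"
          using zb by (simp add: poisson_mod_def w_def)
        then have "\<bar>poisson_mod a r v z - v \<zeta>\<bar> \<le> e / 2 + C"
          using poisson_mod_diff[OF v continuous_on_const] by (simp add: poisson_mod_const)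
        moreover have "C < e / 2"
        proof -
          have zr: "dist a z < r" using zb by simp
          have "r = dist a \<zeta>" using \<zeta>s by simp
          also have "\<dots> \<le> dist a z + dist z \<zeta>" by (rule dist_triangle)
          finally have rz: "r - dist a z \<le> dist z \<zeta>" by simp
          have "r\<^sup>2 * (1 - (cmod w)\<^sup>2) = (r - dist a z) * (r + dist a z)"
            using r unfolding cw by (simp add: power2_eq_square field_simps)
          also have "\<dots> \<le> dist z \<zeta> * (2 * r)" using rz zr r zero_le_dist[of a z]
            by (intro mult_mono) linarith+
          finally have *: "r\<^sup>2 * (1 - (cmod w)\<^sup>2) \<le> dist z \<zeta> * (2 * r)" .
          have "C = 8 * M / \<delta>\<^sup>2 * (r\<^sup>2 * (1 - (cmod w)\<^sup>2))" by (simp add: C_def)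
          also have "\<dots> \<le> 8 * M / \<delta>\<^sup>2 * (dist z \<zeta> * (2 * r))"
            using M(1) by (intro mult_left_mono[OF *]) simp
          also have "\<dots> \<le> 8 * M / \<delta>\<^sup>2 * (e * \<delta>\<^sup>2 / (64 * M * r) * (2 * r))"
            using z(2) M(1) r unfolding d_def by (intro mult_left_mono mult_right_mono) auto
          also have "\<dots> = e / 4" using M(1) \<delta>(1) r by (simp add: field_simps)
          also have "\<dots> < e / 2" using e by simp
          finally show ?thesis .
        qed
        ultimately show ?thesis by linarith
      qed
      then show "\<exists>d>0. \<forall>x\<in>cball a r. dist x \<zeta> < d \<longrightarrow>
          dist (poisson_mod a r v x) (poisson_mod a r v \<zeta>) < e"
        using d unfolding P\<zeta> dist_real_def by blast
    qed
  qed
qed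

lemma continuous_on_UNIV_poisson_mod:
  assumes v: "continuous_on UNIV v" and r: "r > 0"
  shows "continuous_on UNIV (poisson_mod a r v)"
proof -
  have "continuous_on (- ball a r) v" "continuous_on (sphere a r) v"
    using v continuous_on_subset by blast+
  then have "continuous_on (- ball a r) (poisson_mod a r v)" "continuous_on (cball a r) (poisson_mod a r v)"
    using continuous_on_cball_poisson_mod[OF _ r] poisson_mod_outside
      continuous_on_cong[OF refl, of "- ball a r" "poisson_mod a r v" v] by auto
  then have "continuous_on (cball a r \<union> - ball a r) (poisson_mod a r v)"
    by (intro continuous_on_closed_Un closed_cball closed_Compl open_ball)
  moreover have "cball a r \<union> - ball a r = UNIV" by auto
  ultimately show ?thesis by simp
qed

text \<open>The difference of the two sides is harmonic with boundary values \<open>0\<close>.\<close>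

lemma poisson_mod_eq_of_re_hol_ball:
  assumes u: "re_hol u (ball a r)" "continuous_on (cball a r) u" and r: "r > 0"
  shows "poisson_mod a r u z = u z"
proof (cases "z \<in> ball a r")
  case True
  have us: "continuous_on (sphere a r) u" using u(2) sphere_cball by (rule continuous_on_subset)
  note P = re_hol_poisson_mod[OF us r] continuous_on_cball_poisson_mod[OF us r]
  have cl: "closure (ball a r) = cball a r" "frontier (ball a r) = sphere a r"
    using r by (simp_all add: frontier_ball)
  have eq: "poisson_mod a r u \<zeta> = u \<zeta>" if "\<zeta> \<in> sphere a r" for \<zeta>
    using that by (intro poisson_mod_outside) auto
  have z: "z \<in> closure (ball a r)" using True closure_subset by blast
  have "poisson_mod a r u z - u z \<le> 0"
    by (rule re_hol_le_on_closure[OF re_hol_diff[OF P(1) u(1)] bounded_ball _ _ z])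
      (auto simp: cl eq intro!: continuous_on_diff P(2) u(2))
  moreover have "u z - poisson_mod a r u z \<le> 0"
    by (rule re_hol_le_on_closure[OF re_hol_diff[OF u(1) P(1)] bounded_ball _ _ z])
      (auto simp: cl eq intro!: continuous_on_diff P(2) u(2))
  ultimately show ?thesis by simp
next
  case False
  then show ?thesis by (rule poisson_mod_outside)
qed

lemma poisson_mod_eq_of_re_hol:
  assumes "re_hol u S" "cball a r \<subseteq> S" "r > 0"
  shows "poisson_mod a r u z = u z"
proof (rule poisson_mod_eq_of_re_hol_ball[OF _ _ assms(3)])
  show "re_hol u (ball a r)" using assms(1) open_ball ball_subset_cball assms(2)
    by (meson re_hol_subset order_trans)
  show "continuous_on (cball a r) u"
    using re_hol_imp_continuous_on[OF assms(1)] assms(2) by (rule continuous_on_subset)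
qed

lemma re_hol_of_poisson_mod_eq:
  assumes "open S" "continuous_on S u"
    and "\<And>a r z. r > 0 \<Longrightarrow> cball a r \<subseteq> S \<Longrightarrow> z \<in> ball a r \<Longrightarrow> poisson_mod a r u z = u z"
  shows "re_hol u S"
proof (rule re_hol_local)
  fix a assume "a \<in> S"
  then obtain r where r: "r > 0" "cball a r \<subseteq> S" using assms(1) open_contains_cball by blast
  have "continuous_on (sphere a r) u" using assms(2) r(2) sphere_cball
    by (meson continuous_on_subset order_trans)
  then have "re_hol u (ball a r)"
    using re_hol_cong[OF re_hol_poisson_mod[OF _ r(1)]] assms(3)[OF r] by blast
  moreover have "ball a r \<subseteq> S" using r(2) ball_subset_cball by (rule order_trans[rotated])
  ultimately show "\<exists>T. a \<in> T \<and> T \<subseteq> S \<and> re_hol u T" using r(1) centre_in_ball by blast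
qed

text \<open>By Harnack's inequality an increasing sequence that converges at the centre of a disc
  converges uniformly on a smaller disc.\<close>

lemma re_hol_limit_of_increasing:
  assumes S: "open S" and u: "\<And>n. re_hol (u n) S"
    and mono: "\<And>m n z. z \<in> S \<Longrightarrow> m \<le> n \<Longrightarrow> u m z \<le> u n z"
    and lim: "\<And>z. z \<in> S \<Longrightarrow> (\<lambda>n. u n z) \<longlonglongrightarrow> H z"
  shows "re_hol H S"
proof (rule re_hol_local)
  fix a assume a: "a \<in> S"
  then obtain r where r: "r > 0" "cball a r \<subseteq> S" using S open_contains_cball by blast
  define s where "s = r / 2"
  have s: "s > 0" "cball a s \<subseteq> ball a r" using r(1) by (auto simp: s_def)
  have sS: "cball a s \<subseteq> S" using s(2) r(2) ball_subset_cball by (meson order_trans)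
  have uc: "continuous_on S (u n)" for n using u by (rule re_hol_imp_continuous_on)
  have us: "continuous_on (sphere a r) (u n)" for n
    using uc[of n] r(2) sphere_cball by (meson continuous_on_subset order_trans)
  have har: "u m z - u n z \<le> 3 * (u m a - u n a)" if z: "z \<in> cball a s" and mn: "n \<le> m" for m n z
  proof -
    have zb: "z \<in> ball a r" using z s(2) by blast
    have nn: "0 \<le> u m x - u n x" if "x \<in> cball a r" for x
      using mono[of x n m] r(2) that mn by auto
    have P: "poisson_mod a r (\<lambda>x. u m x - u n x) x = u m x - u n x" for x
      by (rule poisson_mod_eq_of_re_hol[OF re_hol_diff[OF u u] r(2,1)])
    have "poisson_mod a r (\<lambda>x. u m x - u n x) z
        \<le> (r + dist a z) / (r - dist a z) * poisson_mod a r (\<lambda>x. u m x - u n x) a"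
      by (rule harnack[OF continuous_on_diff[OF us us] nn zb]) auto
    also have "\<dots> \<le> 3 * poisson_mod a r (\<lambda>x. u m x - u n x) a"
    proof (rule mult_right_mono)
      have "dist a z \<le> r / 2" using z by (simp add: s_def)
      then show "(r + dist a z) / (r - dist a z) \<le> 3" using r(1) by (simp add: divide_le_eq)
      show "0 \<le> poisson_mod a r (\<lambda>x. u m x - u n x) a" unfolding P using nn r(1) by simp
    qed
    finally show ?thesis unfolding P .
  qed
  have bound: "\<bar>u n z - H z\<bar> \<le> 3 * (H a - u n a)" if z: "z \<in> cball a s" for n z
  proof -
    have zS: "z \<in> S" using z sS by blast
    have "H z - u n z \<le> 3 * (H a - u n a)"
    proof (rule LIMSEQ_le)
      show "(\<lambda>m. u m z - u n z) \<longlonglongrightarrow> H z - u n z" by (intro tendsto_intros lim zS)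
      show "(\<lambda>m. 3 * (u m a - u n a)) \<longlonglongrightarrow> 3 * (H a - u n a)" by (intro tendsto_intros lim a)
      show "\<exists>N. \<forall>m\<ge>N. u m z - u n z \<le> 3 * (u m a - u n a)" using har[OF z] by blast
    qed
    moreover have "u n z \<le> H z"
      by (rule LIMSEQ_le_const[OF lim[OF zS]]) (use mono[OF zS] in blast)
    ultimately show ?thesis by simp
  qed
  have l0: "(\<lambda>n. 3 * (H a - u n a)) \<longlonglongrightarrow> 0"
    using tendsto_mult[OF tendsto_const tendsto_diff[OF tendsto_const lim[OF a]], of 3 "H a"] by simp
  have "uniform_limit (cball a s) u H sequentially"
    unfolding uniform_limit_iff
  proof (intro allI impI)
    fix e :: real assume "e > 0"
    then have "\<forall>\<^sub>F n in sequentially. 3 * (H a - u n a) < e" using l0 by (intro order_tendstoD(2))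
    then show "\<forall>\<^sub>F n in sequentially. \<forall>x\<in>cball a s. dist (u n x) (H x) < e"
    proof eventually_elim
      case (elim n)
      then show ?case using bound[of _ n] unfolding dist_real_def by (meson le_less_trans)
    qed
  qed
  moreover have "continuous_on (cball a s) (u n)" for n using uc sS by (rule continuous_on_subset)
  ultimately have Hc: "continuous_on (cball a s) H"
    using uniform_limit_theorem[OF always_eventually _ sequentially_bot] by metis
  have Hs: "continuous_on (sphere a s) H" using Hc sphere_cball by (rule continuous_on_subset)
  have "poisson_mod a s H z = H z" if z: "z \<in> ball a s" for z
  proof (rule LIMSEQ_unique)
    have zc: "z \<in> cball a s" using z by simp
    show "(\<lambda>n. u n z) \<longlonglongrightarrow> H z" using zc sS by (intro lim) blast
    have uss: "continuous_on (sphere a s) (u n)" for n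
      using uc[of n] sS sphere_cball by (meson continuous_on_subset order_trans)
    have *: "\<bar>u n z - poisson_mod a s H z\<bar> \<le> 3 * (H a - u n a)" for n
    proof -
      have "\<bar>poisson_mod a s (u n) z - poisson_mod a s H z\<bar> \<le> 3 * (H a - u n a)"
        by (rule poisson_mod_abs_diff_le[OF uss Hs]) (use bound zc in auto)
      then show ?thesis unfolding poisson_mod_eq_of_re_hol[OF u sS s(1)] .
    qed
    have "(\<lambda>n. u n z - poisson_mod a s H z) \<longlonglongrightarrow> 0"
      by (rule Lim_null_comparison[OF _ l0]) (use * in simp)
    then show "(\<lambda>n. u n z) \<longlonglongrightarrow> poisson_mod a s H z" by (simp add: LIM_zero_iff)
  qed
  then have "re_hol H (ball a s)" using re_hol_cong[OF re_hol_poisson_mod[OF Hs s(1)]] by blast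
  moreover have "ball a s \<subseteq> S" using sS ball_subset_cball by (rule order_trans[rotated])
  ultimately show "\<exists>T. a \<in> T \<and> T \<subseteq> S \<and> re_hol H T" using s(1) centre_in_ball by blast
qed

section \<open>Solutions of Laplace's equation\<close>

lemma second_derivative_nonpos_at_max:
  fixes e :: "complex \<Rightarrow> real"
  assumes S: "open S" "z \<in> S" and max: "\<And>w. w \<in> S \<Longrightarrow> e w \<le> e z"
    and d1: "\<And>w. w \<in> S \<Longrightarrow> (e has_derivative e' w) (at w)"
    and d2: "((\<lambda>w. e' w v) has_derivative E) (at z)"
  shows "E v \<le> 0"
proof (rule ccontr)
  assume neg: "\<not> E v \<le> 0"
  have "((\<lambda>t::real. z + t *\<^sub>R v) \<longlongrightarrow> z + 0 *\<^sub>R v) (at 0)" by (intro tendsto_intros)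
  then have "\<forall>\<^sub>F t in at (0::real). z + t *\<^sub>R v \<in> S"
    using S by (intro topological_tendstoD) auto
  then obtain \<delta> where \<delta>: "\<delta> > 0" and \<delta>0: "\<And>t::real. t \<noteq> 0 \<Longrightarrow> \<bar>t\<bar> < \<delta> \<Longrightarrow> z + t *\<^sub>R v \<in> S"
    unfolding eventually_at by (auto simp: dist_real_def)
  have inS: "z + t *\<^sub>R v \<in> S" if "\<bar>t\<bar> < \<delta>" for t :: real
    using \<delta>0[of t] that S(2) by (cases "t = 0") auto
  define g where "g t = e (z + t *\<^sub>R v)" for t :: real
  define g' where "g' t = e' (z + t *\<^sub>R v) v" for t :: real
  have line: "((\<lambda>t::real. z + t *\<^sub>R v) has_vector_derivative v) (at t)" for t
    by (auto intro!: derivative_eq_intros)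
  have g1: "(g has_real_derivative g' t) (at t)" if "\<bar>t\<bar> < \<delta>" for t
  proof -
    have "bounded_linear (e' (z + t *\<^sub>R v))" using d1[OF inS[OF that]] by (rule has_derivative_bounded_linear)
    then have lin: "e' (z + t *\<^sub>R v) (x *\<^sub>R v) = x * e' (z + t *\<^sub>R v) v" for x
      using linear_simps(5) by fastforce
    have "(g has_derivative (\<lambda>x. e' (z + t *\<^sub>R v) (x *\<^sub>R v))) (at t)"
      unfolding g_def
      by (rule has_derivative_compose[OF line[unfolded has_vector_derivative_def] d1[OF inS[OF that]]])
    moreover have "(\<lambda>x. e' (z + t *\<^sub>R v) (x *\<^sub>R v)) = (*) (g' t)"
      by (simp add: lin g'_def fun_eq_iff)
    ultimately show ?thesis unfolding has_field_derivative_def by simp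
  qed
  have g2: "(g' has_real_derivative E v) (at 0)"
  proof -
    have "bounded_linear E" using d2 by (rule has_derivative_bounded_linear)
    then have lin: "E (x *\<^sub>R v) = x * E v" for x using linear_simps(5) by fastforce
    have "((\<lambda>w. e' w v) has_derivative E) (at (z + 0 *\<^sub>R v))" using d2 by simp
    from has_derivative_compose[OF line[unfolded has_vector_derivative_def] this]
    have "(g' has_derivative (\<lambda>x. E (x *\<^sub>R v))) (at 0)" unfolding g'_def .
    moreover have "(\<lambda>x. E (x *\<^sub>R v)) = (*) (E v)" by (simp add: lin fun_eq_iff)
    ultimately show ?thesis unfolding has_field_derivative_def by simp
  qed
  have "g' 0 = 0"
    by (rule DERIV_local_max[OF g1 \<delta>]) (use max inS \<delta> in \<open>auto simp: g_def\<close>)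
  moreover obtain d where d: "d > 0" "\<forall>h>0. h < d \<longrightarrow> g' 0 < g' (0 + h)"
    using DERIV_pos_inc_right[OF g2] neg by auto
  ultimately have pos: "0 < g' h" if "0 < h" "h < d" for h using that by simp
  define h where "h = min d \<delta> / 2"
  have h: "0 < h" "h < d" "h < \<delta>" using d(1) \<delta> by (auto simp: h_def)
  obtain \<xi> where \<xi>: "0 < \<xi>" "\<xi> < h" "g h - g 0 = (h - 0) * g' \<xi>"
    using MVT2[OF h(1), of g g'] g1 h(3) by force
  have "0 < h * g' \<xi>" using pos[of \<xi>] \<xi>(1,2) h by (intro mult_pos_pos) auto
  then have "g 0 < g h" using \<xi>(3) by simp
  moreover have "g h \<le> g 0" using max inS[of h] h by (simp add: g_def)
  ultimately show False by simp
qed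

text \<open>The function \<open>u - v + \<epsilon> |z - a|\<^sup>2\<close> has the Laplacian \<open>4 \<epsilon> > 0\<close> and hence no interior
  maximum.\<close>

lemma harmonic_on_le_of_boundary:
  assumes u: "harmonic_on u (ball a r)" and v: "harmonic_on v (ball a r)"
    and c: "continuous_on (cball a r) u" "continuous_on (cball a r) v"
    and bd: "\<And>\<zeta>. \<zeta> \<in> sphere a r \<Longrightarrow> u \<zeta> = v \<zeta>" and r: "r > 0" and z: "z \<in> ball a r"
  shows "u z \<le> v z"
proof (rule ccontr)
  assume "\<not> u z \<le> v z"
  \<comment> \<open>The correction stays below \<open>u z - v z\<close> on the whole disc.\<close>
  define \<epsilon> where "\<epsilon> = (u z - v z) / (2 * r\<^sup>2)"
  have \<epsilon>: "\<epsilon> > 0" "\<epsilon> * r\<^sup>2 < u z - v z"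
    using \<open>\<not> u z \<le> v z\<close> r by (simp_all add: \<epsilon>_def)
  define e where "e w = u w - v w + \<epsilon> * ((w - a) \<bullet> (w - a))" for w
  have zc: "z \<in> cball a r" using z by simp
  then have ne: "cball a r \<noteq> {}" by blast
  have ec: "continuous_on (cball a r) e" unfolding e_def by (intro continuous_intros c)
  have "\<exists>y\<in>cball a r. \<forall>w\<in>cball a r. e w \<le> e y"
    by (rule continuous_attains_sup[OF compact_cball ne ec])
  then obtain y where y: "y \<in> cball a r" "\<And>w. w \<in> cball a r \<Longrightarrow> e w \<le> e y" by blast
  have "0 \<le> \<epsilon> * ((z - a) \<bullet> (z - a))" using \<epsilon>(1) by simp
  then have "\<epsilon> * r\<^sup>2 < e z" using \<epsilon>(2) unfolding e_def by linarith
  also have "\<dots> \<le> e y" using y(2)[OF zc] .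
  finally have ey: "\<epsilon> * r\<^sup>2 < e y" .
  have yb: "y \<in> ball a r"
  proof (rule ccontr)
    assume "y \<notin> ball a r"
    then have ys: "y \<in> sphere a r" using y(1) by auto
    then have "(y - a) \<bullet> (y - a) = r\<^sup>2" by (simp add: dot_square_norm dist_norm norm_minus_commute)
    then have "e y = \<epsilon> * r\<^sup>2" using bd[OF ys] by (simp add: e_def)
    then show False using ey by simp
  qed
  have C2: "Ck_on (Suc (Suc 0)) u (ball a r)" "Ck_on (Suc (Suc 0)) v (ball a r)"
    using u v by (simp_all add: harmonic_on_def numeral_2_eq_2 del: Ck_on.simps)
  note d = Ck_on_SucD[OF C2(1) open_ball] Ck_on_SucD[OF C2(2) open_ball]
  let ?D = "\<lambda>f w. frechet_derivative f (at w)"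
  let ?E = "\<lambda>x t. ?D (\<lambda>w. ?D u w x) y t - ?D (\<lambda>w. ?D v w x) y t + 2 * \<epsilon> * (t \<bullet> x)"
  have "?E x x \<le> 0" for x
  proof (rule second_derivative_nonpos_at_max[OF open_ball yb, where e = e and v = x and E = "?E x"
        and e' = "\<lambda>w x. ?D u w x - ?D v w x + 2 * \<epsilon> * ((w - a) \<bullet> x)"])
    show "e w \<le> e y" if "w \<in> ball a r" for w using y(2) that by simp
    show "(e has_derivative (\<lambda>x. ?D u w x - ?D v w x + 2 * \<epsilon> * ((w - a) \<bullet> x))) (at w)"
      if w: "w \<in> ball a r" for w
      unfolding e_def
      by (rule has_derivative_eq_rhs, (rule derivative_intros d(1)[OF w] d(3)[OF w])+)
        (auto simp: fun_eq_iff inner_commute algebra_simps)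
    show "((\<lambda>w. ?D u w x - ?D v w x + 2 * \<epsilon> * ((w - a) \<bullet> x)) has_derivative ?E x) (at y)"
      by (rule has_derivative_eq_rhs, (rule derivative_intros
            Ck_on_SucD(1)[OF d(2) open_ball yb] Ck_on_SucD(1)[OF d(4) open_ball yb])+)
        (auto simp: fun_eq_iff algebra_simps)
  qed
  from this[of 1] this[of \<i>] have
    "pderiv_x (pderiv_x u) y + pderiv_y (pderiv_y u) y
      - (pderiv_x (pderiv_x v) y + pderiv_y (pderiv_y v) y) + 4 * \<epsilon> \<le> 0"
    unfolding pderiv_x_def[abs_def] pderiv_y_def[abs_def] by (simp add: inner_complex_def)
  then show False using u v yb \<epsilon>(1) by (simp add: harmonic_on_def)
qed

text \<open>A solution of Laplace's equation agrees on every small disc with its Poisson integral, by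
  comparison in both directions.\<close>

lemma harmonic_on_imp_re_hol:
  assumes u: "harmonic_on u S" and S: "open S"
  shows "re_hol u S"
proof (rule re_hol_local)
  fix a assume "a \<in> S"
  then obtain r where r: "r > 0" "cball a r \<subseteq> S" using S open_contains_cball by blast
  have b: "ball a r \<subseteq> S" using r(2) ball_subset_cball by (rule order_trans[rotated])
  have ub: "harmonic_on u (ball a r)"
    using u b Ck_on_subset[OF b] by (auto simp: harmonic_on_def)
  have uc: "continuous_on (cball a r) u"
    using Ck_on_imp_continuous_on u r(2) continuous_on_subset unfolding harmonic_on_def by blast
  have us: "continuous_on (sphere a r) u" using uc sphere_cball by (rule continuous_on_subset)
  note P = re_hol_poisson_mod[OF us r(1)]
  note P' = re_hol_imp_harmonic_on[OF P] continuous_on_cball_poisson_mod[OF us r(1)]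
  have eq: "poisson_mod a r u \<zeta> = u \<zeta>" if "\<zeta> \<in> sphere a r" for \<zeta>
    using that by (intro poisson_mod_outside) auto
  have "poisson_mod a r u z = u z" if "z \<in> ball a r" for z
    using harmonic_on_le_of_boundary[OF ub P'(1) uc P'(2) eq[symmetric] r(1) that]
      harmonic_on_le_of_boundary[OF P'(1) ub P'(2) uc eq r(1) that] by simp
  then have "re_hol u (ball a r)" using re_hol_cong[OF P] by blast
  then show "\<exists>T. a \<in> T \<and> T \<subseteq> S \<and> re_hol u T" using b r(1) centre_in_ball by blast
qed

section \<open>Least harmonic majorants by sweeping\<close>

text \<open>The inequality is required on the whole plane; outside the disc it is an equality.\<close>

definition subharm :: "(complex \<Rightarrow> real) \<Rightarrow> complex set \<Rightarrow> bool" where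
  "subharm v S \<longleftrightarrow> (\<forall>a r. r > 0 \<longrightarrow> cball a r \<subseteq> S \<longrightarrow> (\<forall>z. v z \<le> poisson_mod a r v z))"

lemma subharmD: "subharm v S \<Longrightarrow> r > 0 \<Longrightarrow> cball a r \<subseteq> S \<Longrightarrow> v z \<le> poisson_mod a r v z"
  unfolding subharm_def by blast

lemma continuous_on_UNIV_imp: "continuous_on UNIV f \<Longrightarrow> continuous_on A f"
  by (rule continuous_on_subset) auto

text \<open>Let \<open>w\<close> be the modification of \<open>v\<close> on one disc and \<open>w'\<close> that of \<open>w\<close> on another. Outside the first
  disc \<open>w = v \<le> w'\<close>, outside the second \<open>w = w'\<close>, and on the intersection both are harmonic, so the
  maximum principle extends \<open>w \<le> w'\<close> to it.\<close>

lemma subharm_poisson_mod: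
  assumes v: "continuous_on UNIV v" "subharm v S" and r: "r > 0" "cball a r \<subseteq> S"
  shows "subharm (poisson_mod a r v) S"
  unfolding subharm_def
proof (intro allI impI)
  fix b s z assume s: "s > 0" "cball b s \<subseteq> S"
  define w where "w = poisson_mod a r v"
  define w' where "w' = poisson_mod b s w"
  have w: "continuous_on UNIV w" unfolding w_def using v(1) r(1) by (rule continuous_on_UNIV_poisson_mod)
  have w': "continuous_on UNIV w'" unfolding w'_def using w s(1) by (rule continuous_on_UNIV_poisson_mod)
  have vw: "v x \<le> w x" for x unfolding w_def using v(2) r by (rule subharmD)
  have out: "w x \<le> w' x" if "x \<notin> ball a r \<inter> ball b s" for x
  proof (cases "x \<in> ball b s")
    case True
    then have "x \<notin> ball a r" using that by blast
    then have "w x = v x" unfolding w_def by (rule poisson_mod_outside)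
    also have "\<dots> \<le> poisson_mod b s v x" using v(2) s by (rule subharmD)
    also have "\<dots> \<le> w' x" unfolding w'_def
      using continuous_on_UNIV_imp[OF v(1)] continuous_on_UNIV_imp[OF w] vw vw
      by (rule poisson_mod_mono)
    finally show ?thesis .
  next
    case False
    then show ?thesis unfolding w'_def by (simp add: poisson_mod_outside)
  qed
  have op: "open (ball a r \<inter> ball b s)" by (intro open_Int open_ball)
  show "w z \<le> w' z"
  proof (cases "z \<in> ball a r \<inter> ball b s")
    case True
    have "re_hol w (ball a r)" "re_hol w' (ball b s)" unfolding w'_def w_def
      using continuous_on_UNIV_imp[OF v(1)] continuous_on_UNIV_imp[OF w[unfolded w_def]] r(1) s(1)
      by (simp_all add: re_hol_poisson_mod)
    then have "re_hol w (ball a r \<inter> ball b s)" "re_hol w' (ball a r \<inter> ball b s)"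
      using re_hol_subset[OF _ op] Int_lower1 Int_lower2 by blast+
    then have hd: "re_hol (\<lambda>z. w z - w' z) (ball a r \<inter> ball b s)" by (rule re_hol_diff)
    have "w z - w' z \<le> 0"
    proof (rule re_hol_le_on_closure[OF hd])
      show "bounded (ball a r \<inter> ball b s)"
        using bounded_ball[of a r] Int_lower1 by (rule bounded_subset)
      show "continuous_on (closure (ball a r \<inter> ball b s)) (\<lambda>z. w z - w' z)"
        by (intro continuous_on_diff continuous_on_UNIV_imp[OF w] continuous_on_UNIV_imp[OF w'])
      show "z \<in> closure (ball a r \<inter> ball b s)" using subsetD[OF closure_subset True] .
      fix \<zeta> assume "\<zeta> \<in> frontier (ball a r \<inter> ball b s)"
      then have "\<zeta> \<notin> interior (ball a r \<inter> ball b s)" unfolding frontier_def by (rule DiffE)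
      then have "w \<zeta> \<le> w' \<zeta>" unfolding interior_open[OF op] by (rule out)
      then show "w \<zeta> - w' \<zeta> \<le> 0" by simp
    qed
    then show ?thesis by simp
  qed (rule out)
qed

text \<open>The discs of a countable cover are swept in an order in which each of them occurs
  infinitely often. The sequence increases, and on each disc it has a subsequence of harmonic
  functions.\<close>

lemma least_harmonic_majorant:
  assumes D: "open D" and v: "continuous_on UNIV v" "subharm v D"
    and M: "\<And>z. z \<in> D \<Longrightarrow> v z \<le> M"
  obtains H where "re_hol H D" "\<And>z. z \<in> D \<Longrightarrow> v z \<le> H z"
    "\<And>W z. re_hol W D \<Longrightarrow> (\<forall>z\<in>D. v z \<le> W z) \<Longrightarrow> z \<in> D \<Longrightarrow> H z \<le> W z"
proof (cases "D = {}")
  case True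
  then show ?thesis using that[of v] by (auto simp: re_hol_def)
next
  case False
  define \<F> where "\<F> = {ball a r |a r. r > 0 \<and> cball a r \<subseteq> D}"
  have "open T" if "T \<in> \<F>" for T using that by (auto simp: \<F>_def)
  then obtain \<F>' where F': "\<F>' \<subseteq> \<F>" "countable \<F>'" "\<Union>\<F>' = \<Union>\<F>"
    using Lindelof by metis
  have cover: "D \<subseteq> \<Union>\<F>'"
  proof
    fix z assume "z \<in> D"
    then obtain r where "r > 0" "cball z r \<subseteq> D" using D open_contains_cball by blast
    then have "ball z r \<in> \<F>" "z \<in> ball z r" unfolding \<F>_def by auto
    then show "z \<in> \<Union>\<F>'" unfolding F'(3) by blast
  qed
  then have ne: "\<F>' \<noteq> {}" using False by blast
  have "\<exists>a r. from_nat_into \<F>' k = ball a r \<and> r > 0 \<and> cball a r \<subseteq> D" for k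
    using from_nat_into[OF ne, of k] F'(1) unfolding \<F>_def by blast
  then obtain a r where ar: "\<And>k. from_nat_into \<F>' k = ball (a k) (r k)"
    "\<And>k. r k > 0" "\<And>k. cball (a k) (r k) \<subseteq> D" by metis
  define e where "e n = fst (prod_decode n)" for n
  define u where "u = rec_nat v (\<lambda>n. poisson_mod (a (e n)) (r (e n)))"
  have u0: "u 0 = v" and uS: "u (Suc n) = poisson_mod (a (e n)) (r (e n)) (u n)" for n
    by (simp_all add: u_def)
  have uc: "continuous_on UNIV (u n)" for n
    by (induction n) (auto simp: u0 uS v(1) ar intro: continuous_on_UNIV_poisson_mod)
  have us: "subharm (u n) D" for n
    by (induction n) (auto simp: u0 uS v(2) intro!: subharm_poisson_mod uc ar)
  have step: "u n z \<le> u (Suc n) z" for n z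
    unfolding uS using us ar(2,3) by (rule subharmD)
  have inc: "m \<le> n \<Longrightarrow> u m z \<le> u n z" for m n z
    by (rule lift_Suc_mono_le[of "\<lambda>n. u n z"]) (use step in auto)
  have upper: "u n z \<le> W z" if W: "re_hol W D" "\<forall>z\<in>D. v z \<le> W z" and z: "z \<in> D" for W n z
    using z
  proof (induction n arbitrary: z)
    case 0
    then show ?case using W(2) by (simp add: u0)
  next
    case (Suc n)
    let ?a = "a (e n)" and ?r = "r (e n)"
    have sph: "sphere ?a ?r \<subseteq> D" using ar(3) sphere_cball by (rule order_trans[rotated])
    have "u (Suc n) z \<le> poisson_mod ?a ?r W z" unfolding uS
    proof (rule poisson_mod_mono)
      show "continuous_on (sphere ?a ?r) W"
        using re_hol_imp_continuous_on[OF W(1)] sph by (rule continuous_on_subset)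
      show "u n x \<le> W x" if "x \<in> sphere ?a ?r" for x using Suc.IH that sph by blast
    qed (use Suc continuous_on_UNIV_imp[OF uc] in auto)
    then show ?case unfolding poisson_mod_eq_of_re_hol[OF W(1) ar(3,2)] .
  qed
  have bdd: "u n z \<le> M" if "z \<in> D" for n z
    using upper[OF re_hol_const[OF D]] M that by blast
  define H where "H z = (SUP n. u n z)" for z
  have lim: "(\<lambda>n. u n z) \<longlonglongrightarrow> H z" if z: "z \<in> D" for z
    unfolding H_def
  proof (rule LIMSEQ_incseq_SUP)
    show "bdd_above (range (\<lambda>n. u n z))" using bdd[OF z] by (intro bdd_aboveI2)
    show "incseq (\<lambda>n. u n z)" using inc by (simp add: incseq_def)
  qed
  have "re_hol H D"
  proof (rule re_hol_local)
    fix z assume "z \<in> D"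
    then obtain T where "T \<in> \<F>'" "z \<in> T" using cover by blast
    then obtain k where k: "z \<in> ball (a k) (r k)" using from_nat_into_surj[OF F'(2)] ar(1) by metis
    \<comment> \<open>the steps right after the disc with index \<open>k\<close> has been swept\<close>
    define h where "h j = Suc (prod_encode (k, j))" for j
    have bD: "ball (a k) (r k) \<subseteq> D" using ar(3) ball_subset_cball by (rule order_trans[rotated])
    have "re_hol H (ball (a k) (r k))"
    proof (rule re_hol_limit_of_increasing[OF open_ball])
      show "re_hol (u (h j)) (ball (a k) (r k))" for j
        unfolding h_def uS e_def prod_encode_inverse fst_conv
        by (rule re_hol_poisson_mod[OF continuous_on_UNIV_imp[OF uc] ar(2)])
      show "u (h i) x \<le> u (h j) x" if "i \<le> j" for i j x
      proof (rule inc)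
        have "triangle (k + i) \<le> triangle (k + j)"
          unfolding triangle_def using that by (intro div_le_mono mult_le_mono) auto
        then show "h i \<le> h j" by (simp add: h_def prod_encode_def)
      qed
      have "j \<le> h j" for j unfolding h_def using le_prod_encode_2[of j k] by simp
      then have "filterlim h at_top sequentially"
        by (intro filterlim_at_top_mono[OF filterlim_ident] always_eventually) auto
      then show "(\<lambda>j. u (h j) x) \<longlonglongrightarrow> H x" if "x \<in> ball (a k) (r k)" for x
        by (rule filterlim_compose[OF lim[OF subsetD[OF bD that]]])
    qed
    then show "\<exists>T. z \<in> T \<and> T \<subseteq> D \<and> re_hol H T" using k bD by blast
  qed
  moreover have "v z \<le> H z" if "z \<in> D" for z
    by (rule LIMSEQ_le_const[OF lim[OF that]]) (use inc[of 0 _ z] u0 in auto)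
  moreover have "H z \<le> W z" if "re_hol W D" "\<forall>z\<in>D. v z \<le> W z" "z \<in> D" for W z
    by (rule LIMSEQ_le_const2[OF lim[OF that(3)]]) (use upper[OF that] in auto)
  ultimately show ?thesis using that by blast
qed

section \<open>The Dirichlet problem with exterior discs\<close>

definition exterior_disc :: "complex set \<Rightarrow> complex \<Rightarrow> complex \<Rightarrow> real \<Rightarrow> bool" where
  "exterior_disc D \<zeta> c R \<longleftrightarrow> R > 0 \<and> dist c \<zeta> = R \<and> D \<inter> ball c R = {}"

text \<open>The disc with half the radius touches \<open>closure D\<close> at \<open>\<zeta>\<close> only, and the logarithm of
  the distance from its centre is a barrier.\<close>

lemma exterior_disc_barrier:
  assumes D: "open D" and ext: "exterior_disc D \<zeta> c R"
  obtains b where "re_hol b D" "continuous_on (closure D) b" "b \<zeta> = 0" "\<And>z. z \<in> closure D \<Longrightarrow> 0 \<le> b z"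
    "\<And>z. z \<in> closure D \<Longrightarrow> z \<noteq> \<zeta> \<Longrightarrow> 0 < b z"
proof -
  have R: "R > 0" "dist c \<zeta> = R" "D \<inter> ball c R = {}" using ext by (auto simp: exterior_disc_def)
  define m where "m = midpoint c \<zeta>"
  have mc: "dist m c = R / 2" "dist m \<zeta> = R / 2"
    unfolding m_def using R(2) by (simp_all add: dist_midpoint dist_commute)
  have cl: "closure D \<inter> ball c R = {}"
    using R(3) open_Int_closure_eq_empty[OF open_ball, of c R D] by blast
  have far: "R / 2 < dist z m" if z: "z \<in> closure D" "z \<noteq> \<zeta>" for z
  proof (rule ccontr)
    assume "\<not> R / 2 < dist z m"
    then have zm: "dist z m \<le> R / 2" by simp
    have "R \<le> dist c z" using cl z(1) by fastforce
    moreover have tri: "dist c z \<le> dist c m + dist m z" by (rule dist_triangle)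
    ultimately have eq: "dist m z = R / 2" "dist c z = dist c m + dist m z"
      using zm mc(1) by (simp_all add: dist_commute)
    have "norm (m - c) *\<^sub>R (z - m) = norm (z - m) *\<^sub>R (m - c)"
      using eq(2) norm_triangle_eq[of "m - c" "z - m"]
      by (simp add: dist_norm norm_minus_commute)
    moreover have "norm (m - c) = R / 2" "norm (z - m) = R / 2"
      using eq(1) mc(1) by (simp_all add: dist_norm norm_minus_commute)
    ultimately have "z - m = m - c" using R(1) by simp
    then have "z = \<zeta>" by (simp add: m_def midpoint_def scaleR_conv_of_real field_simps)
    then show False using z(2) by simp
  qed
  have ge: "R / 2 \<le> cmod (z - m)" if "z \<in> closure D" for z
    using far[OF that] mc(2) by (cases "z = \<zeta>") (auto simp: dist_norm norm_minus_commute)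
  define b where "b z = ln (cmod (z - m)) - ln (R / 2)" for z
  have "re_hol b D" unfolding b_def
  proof (intro re_hol_diff re_hol_const re_hol_ln_cmod D)
    show "(\<lambda>z. z - m) holomorphic_on D" by (intro holomorphic_intros)
    show "z - m \<noteq> 0" if "z \<in> D" for z using ge[of z] that closure_subset[of D] R(1) by auto
  qed
  moreover have "continuous_on (closure D) b" unfolding b_def
    by (intro continuous_intros) (use ge R(1) in force)
  moreover have "b \<zeta> = 0"
  proof -
    have "cmod (\<zeta> - m) = R / 2" using mc(2) by (simp add: dist_norm norm_minus_commute)
    then show ?thesis by (simp only: b_def diff_self)
  qed
  moreover have "0 \<le> b z" if "z \<in> closure D" for z
    using ln_mono[OF ge[OF that]] R(1) by (simp add: b_def)
  moreover have "0 < b z" if "z \<in> closure D" "z \<noteq> \<zeta>" for z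
  proof -
    have "R / 2 < cmod (z - m)" using far[OF that] by (simp add: dist_norm)
    then have "ln (R / 2) < ln (cmod (z - m))" using R(1) by (subst ln_less_cancel_iff) auto
    then show ?thesis by (simp add: b_def)
  qed
  ultimately show ?thesis by (rule that)
qed

text \<open>The least harmonic majorant \<open>H\<close> of \<open>v\<close> lies above \<open>v\<close> and below every harmonic majorant of
  the form \<open>v \<zeta> + \<epsilon> / 2 + N b\<close> with a barrier \<open>b\<close> at \<open>\<zeta>\<close>; both bounds are close to \<open>v \<zeta>\<close>
  near \<open>\<zeta>\<close>.\<close>

lemma dirichlet_for_subharm_data:
  assumes D: "open D" "bounded D" and v: "continuous_on UNIV v" "subharm v D"
    and ext: "\<And>\<zeta>. \<zeta> \<in> frontier D \<Longrightarrow> \<exists>c R. exterior_disc D \<zeta> c R"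
  obtains H where "re_hol H D" "\<And>\<zeta>. \<zeta> \<in> frontier D \<Longrightarrow> (H \<longlongrightarrow> v \<zeta>) (at \<zeta> within D)"
proof -
  have cD: "compact (closure D)" using D(2) by (simp add: compact_closure)
  then have "bounded (v ` closure D)"
    using compact_continuous_image continuous_on_UNIV_imp[OF v(1)] compact_imp_bounded by blast
  then obtain M where M: "\<And>z. z \<in> closure D \<Longrightarrow> v z \<le> M"
    unfolding bounded_real by (metis abs_le_iff imageI)
  have M': "v z \<le> M" if "z \<in> D" for z by (rule M[OF subsetD[OF closure_subset that]])
  obtain H where H: "re_hol H D" "\<And>z. z \<in> D \<Longrightarrow> v z \<le> H z"
    "\<And>W z. re_hol W D \<Longrightarrow> (\<forall>z\<in>D. v z \<le> W z) \<Longrightarrow> z \<in> D \<Longrightarrow> H z \<le> W z"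
    using least_harmonic_majorant[OF D(1) v M'] by metis
  have "(H \<longlongrightarrow> v \<zeta>) (at \<zeta> within D)" if \<zeta>: "\<zeta> \<in> frontier D" for \<zeta>
  proof (rule tendstoI)
    fix \<epsilon> :: real assume e: "\<epsilon> > 0"
    obtain c R where "exterior_disc D \<zeta> c R" using ext[OF \<zeta>] by blast
    then obtain b where b: "re_hol b D" "continuous_on (closure D) b" "b \<zeta> = 0"
      "\<And>z. z \<in> closure D \<Longrightarrow> 0 \<le> b z" "\<And>z. z \<in> closure D \<Longrightarrow> z \<noteq> \<zeta> \<Longrightarrow> 0 < b z"
      using exterior_disc_barrier[OF D(1)] by metis
    have \<zeta>c: "\<zeta> \<in> closure D" using \<zeta> by (simp add: frontier_def)
    have "isCont v \<zeta>" using v(1) by (simp add: continuous_on_eq_continuous_at)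
    then obtain \<delta> where \<delta>: "\<delta> > 0" "\<And>z. dist z \<zeta> < \<delta> \<Longrightarrow> \<bar>v z - v \<zeta>\<bar> < \<epsilon> / 2"
      using e unfolding continuous_at_eps_delta dist_real_def by (metis half_gt_zero)
    define K where "K = closure D - ball \<zeta> \<delta>"
    have K: "compact K" unfolding K_def by (intro compact_diff cD open_ball)
    have "\<exists>m>0. \<forall>z\<in>K. m \<le> b z"
    proof (cases "K = {}")
      case True
      then show ?thesis by (intro exI[of _ 1]) auto
    next
      case False
      have "continuous_on K b" using b(2) by (rule continuous_on_subset) (auto simp: K_def)
      then obtain x where x: "x \<in> K" "\<forall>z\<in>K. b x \<le> b z"
        using continuous_attains_inf[OF K False] by blast
      moreover have "0 < b x" using x(1) \<delta>(1) by (intro b(5)) (auto simp: K_def)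
      ultimately show ?thesis by blast
    qed
    then obtain m where m: "m > 0" "\<And>z. z \<in> K \<Longrightarrow> m \<le> b z" by blast
    define N where "N = \<bar>M - v \<zeta>\<bar> / m"
    have N: "N \<ge> 0" using m(1) by (simp add: N_def)
    define W where "W z = (v \<zeta> + \<epsilon> / 2) + N * b z" for z
    have "re_hol W D" unfolding W_def by (intro re_hol_add re_hol_const re_hol_cmult D(1) b(1))
    moreover have "\<forall>z\<in>D. v z \<le> W z"
    proof
      fix z assume zD: "z \<in> D"
      have zc: "z \<in> closure D" using subsetD[OF closure_subset zD] .
      show "v z \<le> W z"
      proof (cases "dist z \<zeta> < \<delta>")
        case True
        then have "v z \<le> v \<zeta> + \<epsilon> / 2" using \<delta>(2)[of z] by linarith
        moreover have "0 \<le> N * b z" using N b(4)[OF zc] by simp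
        ultimately show ?thesis by (simp add: W_def)
      next
        case False
        then have "z \<in> K" using zc by (simp add: K_def dist_commute)
        have "v z - v \<zeta> \<le> \<bar>M - v \<zeta>\<bar>" using M[OF zc] by linarith
        also have "\<dots> = N * m" using m(1) by (simp add: N_def)
        also have "\<dots> \<le> N * b z" using m(2)[OF \<open>z \<in> K\<close>] N by (rule mult_left_mono)
        finally show ?thesis using e by (simp add: W_def)
      qed
    qed
    ultimately have HW: "\<And>z. z \<in> D \<Longrightarrow> H z \<le> W z" using H(3) by blast
    have "(b \<longlongrightarrow> 0) (at \<zeta> within closure D)"
      using b(2,3) \<zeta>c unfolding continuous_on_def by metis
    then have "(b \<longlongrightarrow> 0) (at \<zeta> within D)" using closure_subset by (rule tendsto_within_subset)
    then have "(W \<longlongrightarrow> (v \<zeta> + \<epsilon> / 2) + N * 0) (at \<zeta> within D)"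
      unfolding W_def by (intro tendsto_intros)
    then have "\<forall>\<^sub>F z in at \<zeta> within D. W z < v \<zeta> + \<epsilon>"
      using e by (intro order_tendstoD(2)) auto
    moreover have "\<forall>\<^sub>F z in at \<zeta> within D. dist z \<zeta> < \<delta>"
      using \<delta>(1) by (auto simp: eventually_at)
    moreover have "\<forall>\<^sub>F z in at \<zeta> within D. z \<in> D" by (simp add: eventually_at_filter)
    ultimately show "\<forall>\<^sub>F z in at \<zeta> within D. dist (H z) (v \<zeta>) < \<epsilon>"
    proof eventually_elim
      case (elim z)
      have "H z < v \<zeta> + \<epsilon>" using HW[OF elim(3)] elim(1) by linarith
      moreover have "v \<zeta> - \<epsilon> < H z" using H(2)[OF elim(3)] \<delta>(2)[OF elim(2)] e by linarith
      ultimately show ?case by (simp add: dist_real_def abs_less_iff)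
    qed
  qed
  then show ?thesis using H(1) that by blast
qed

text \<open>The Poisson modification is at least \<open>ln \<rho>\<close> because constants reproduce themselves, and it is
  at least \<open>ln |z - p|\<close> outside \<open>cball p \<rho>\<close> by the maximum principle.\<close>

lemma subharm_ln_max:
  assumes \<rho>: "\<rho> > 0"
  shows "subharm (\<lambda>z. ln (max (cmod (z - p)) \<rho>)) S"
  unfolding subharm_def
proof (intro allI impI)
  fix a r z assume r: "(r::real) > 0"
  define v where "v = (\<lambda>z. ln (max (cmod (z - p)) \<rho>))"
  define w where "w = poisson_mod a r v"
  have v: "continuous_on UNIV v" unfolding v_def
    by (intro continuous_intros) (use \<rho> in auto)
  have w: "continuous_on UNIV w" unfolding w_def using v r by (rule continuous_on_UNIV_poisson_mod)
  have ge\<rho>: "ln \<rho> \<le> v x" for x unfolding v_def using \<rho> by simp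
  have geln: "ln (cmod (x - p)) \<le> v x" if "x \<noteq> p" for x unfolding v_def using \<rho> that by simp
  have w\<rho>: "ln \<rho> \<le> w x" for x
    using poisson_mod_mono[OF continuous_on_const continuous_on_UNIV_imp[OF v], of a r "ln \<rho>" x] ge\<rho>
    unfolding w_def poisson_mod_const by blast
  show "v z \<le> w z"
  proof (cases "z \<in> ball a r \<and> \<rho> < cmod (z - p)")
    case True
    define T where "T = ball a r - cball p \<rho>"
    have T: "open T" "bounded T" unfolding T_def by (auto intro: bounded_subset[OF bounded_ball])
    have clT: "\<rho> \<le> cmod (x - p)" if "x \<in> closure T" for x
    proof -
      have "closure T \<subseteq> - ball p \<rho>"
        unfolding T_def by (intro closure_minimal closed_Compl open_ball) auto
      then have "x \<in> - ball p \<rho>" using that by blast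
      then show ?thesis by (simp add: dist_norm norm_minus_commute)
    qed
    have "re_hol (\<lambda>x. ln (cmod (x - p)) - w x) T"
    proof (rule re_hol_diff)
      show "re_hol (\<lambda>x. ln (cmod (x - p))) T"
        by (rule re_hol_ln_cmod[OF T(1)]) (use \<rho> in \<open>auto simp: T_def intro!: holomorphic_intros\<close>)
      show "re_hol w T" unfolding w_def
        by (rule re_hol_subset[OF re_hol_poisson_mod[OF continuous_on_UNIV_imp[OF v] r] T(1)])
          (auto simp: T_def)
    qed
    moreover have "continuous_on (closure T) (\<lambda>x. ln (cmod (x - p)) - w x)"
      by (intro continuous_intros continuous_on_UNIV_imp[OF w]) (use clT \<rho> in force)
    moreover have "ln (cmod (x - p)) - w x \<le> 0" if x: "x \<in> frontier T" for x
    proof -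
      have xc: "x \<in> closure T" "x \<notin> T" using x T(1) by (auto simp: frontier_def interior_open)
      show ?thesis
      proof (cases "x \<in> ball a r")
        case True
        then have "cmod (x - p) \<le> \<rho>" using xc(2) by (simp add: T_def dist_norm norm_minus_commute)
        then have "cmod (x - p) = \<rho>" using clT[OF xc(1)] by simp
        then show ?thesis using w\<rho>[of x] by simp
      next
        case False
        then have "w x = v x" unfolding w_def by (rule poisson_mod_outside)
        moreover have "x \<noteq> p" using clT[OF xc(1)] \<rho> by auto
        ultimately show ?thesis using geln[of x] by simp
      qed
    qed
    moreover have "z \<in> closure T"
      using True closure_subset[of T] by (auto simp: T_def dist_norm norm_minus_commute)
    ultimately have "ln (cmod (z - p)) - w z \<le> 0"
      using re_hol_le_on_closure[OF _ T(2)] by blast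
    then show ?thesis using True by (simp add: v_def)
  next
    case False
    show ?thesis
    proof (cases "z \<in> ball a r")
      case True
      then show ?thesis using False w\<rho>[of z] by (simp add: v_def)
    next
      case False
      then show ?thesis unfolding w_def by (simp add: poisson_mod_outside)
    qed
  qed
qed

text \<open>Truncating the logarithm in a disc about \<open>p\<close> inside \<open>D\<close> makes it continuous and leaves the
  boundary values unchanged.\<close>

lemma log_dirichlet:
  assumes D: "open D" "bounded D" and p: "p \<in> D"
    and ext: "\<And>\<zeta>. \<zeta> \<in> frontier D \<Longrightarrow> \<exists>c R. exterior_disc D \<zeta> c R"
  obtains H where "re_hol H D"
    "\<And>\<zeta>. \<zeta> \<in> frontier D \<Longrightarrow> (H \<longlongrightarrow> ln (cmod (\<zeta> - p))) (at \<zeta> within D)"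
proof -
  obtain \<rho> where \<rho>: "\<rho> > 0" "ball p \<rho> \<subseteq> D" using D(1) p openE by blast
  define v where "v = (\<lambda>z. ln (max (cmod (z - p)) \<rho>))"
  have v: "continuous_on UNIV v" unfolding v_def
    by (intro continuous_intros) (use \<rho> in auto)
  obtain H where H: "re_hol H D" "\<And>\<zeta>. \<zeta> \<in> frontier D \<Longrightarrow> (H \<longlongrightarrow> v \<zeta>) (at \<zeta> within D)"
    using dirichlet_for_subharm_data[OF D v _ ext] subharm_ln_max[OF \<rho>(1)] unfolding v_def by metis
  have "v \<zeta> = ln (cmod (\<zeta> - p))" if "\<zeta> \<in> frontier D" for \<zeta>
  proof -
    have "\<zeta> \<notin> D" using that D(1) by (simp add: frontier_def interior_open)
    then have "\<rho> \<le> cmod (\<zeta> - p)" using \<rho>(2) by (force simp: dist_norm norm_minus_commute)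
    then show ?thesis by (simp add: v_def)
  qed
  then show ?thesis using H that by metis
qed

section \<open>Green's function and the Robin constant\<close>

text \<open>All that the construction of Green's function takes from the smoothness of the boundary.\<close>

locale regular_domain =
  fixes D :: "complex set"
  assumes open_D: "open D" and bounded_D: "bounded D"
    and ext: "\<And>\<zeta>. \<zeta> \<in> frontier D \<Longrightarrow> \<exists>c R. exterior_disc D \<zeta> c R"
begin

definition log_solution :: "complex \<Rightarrow> (complex \<Rightarrow> real) \<Rightarrow> bool" where
  "log_solution p H \<longleftrightarrow> re_hol H D \<and>
     (\<forall>\<zeta>\<in>frontier D. (H \<longlongrightarrow> ln (cmod (\<zeta> - p))) (at \<zeta> within D))"

text \<open>The regular part \<open>G + ln |z - p|\<close> of Green's function \<open>G\<close> with pole \<open>p\<close>.\<close>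

definition regular_part :: "complex \<Rightarrow> complex \<Rightarrow> real" where
  "regular_part p = (SOME H. log_solution p H)"

lemma log_solution_regular_part:
  assumes "p \<in> D"
  shows "log_solution p (regular_part p)"
proof -
  obtain H where "re_hol H D"
    "\<And>\<zeta>. \<zeta> \<in> frontier D \<Longrightarrow> (H \<longlongrightarrow> ln (cmod (\<zeta> - p))) (at \<zeta> within D)"
    using log_dirichlet[OF open_D bounded_D assms ext] by blast
  then have "log_solution p H" by (simp add: log_solution_def)
  then show ?thesis unfolding regular_part_def by (rule someI[of "log_solution p"])
qed

lemma re_hol_regular_part: "p \<in> D \<Longrightarrow> re_hol (regular_part p) D"
  using log_solution_regular_part by (simp add: log_solution_def)

lemma regular_part_boundary:
  "p \<in> D \<Longrightarrow> \<zeta> \<in> frontier D \<Longrightarrow> (regular_part p \<longlongrightarrow> ln (cmod (\<zeta> - p))) (at \<zeta> within D)"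
  using log_solution_regular_part by (simp add: log_solution_def)

lemma frontier_not_in_D: "\<zeta> \<in> frontier D \<Longrightarrow> \<zeta> \<notin> D"
  using open_D by (simp add: frontier_def interior_open)

lemma log_solution_unique:
  assumes "log_solution p u" "log_solution p v" "z \<in> D"
  shows "u z = v z"
proof -
  have le: "u z \<le> v z" if uv: "log_solution p u" "log_solution p v" for u v
  proof -
    have "u z - v z \<le> 0"
    proof (rule re_hol_le_boundary[OF _ bounded_D assms(3)])
      show "re_hol (\<lambda>z. u z - v z) D" using uv by (intro re_hol_diff) (auto simp: log_solution_def)
      show "((\<lambda>z. u z - v z) \<longlongrightarrow> ln (cmod (\<zeta> - p)) - ln (cmod (\<zeta> - p))) (at \<zeta> within D)"
        if "\<zeta> \<in> frontier D" for \<zeta>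
        using uv that by (intro tendsto_diff) (auto simp: log_solution_def)
    qed simp
    then show ?thesis by simp
  qed
  show ?thesis using le[OF assms(1,2)] le[OF assms(2,1)] by simp
qed

lemma re_hol_ln_dist: "open S \<Longrightarrow> p \<notin> S \<Longrightarrow> re_hol (\<lambda>z. ln (cmod (z - p))) S"
  by (rule re_hol_ln_cmod) (auto intro!: holomorphic_intros)

text \<open>Adding \<open>ln |z - p|\<close> removes the singularity and leaves a function with the boundary values
  that determine the regular part.\<close>

lemma green_function_eq:
  assumes p: "p \<in> D" and g: "is_green_function D p g" and z: "z \<in> D - {p}"
  shows "g z = regular_part p z - ln (cmod (z - p))"
proof -
  have op: "open (D - {p})" using open_D by (rule open_delete)
  obtain r h where rh: "r > 0" "ball p r \<subseteq> D" "harmonic_on h (ball p r)"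
    "\<forall>z\<in>ball p r - {p}. g z + ln (cmod (z - p)) = h z"
    using g unfolding is_green_function_def by blast
  define k where "k z = (if z = p then h p else g z + ln (cmod (z - p)))" for z
  have "re_hol k (D - {p})"
  proof (rule re_hol_cong)
    show "re_hol (\<lambda>z. g z + ln (cmod (z - p))) (D - {p})"
      using g by (intro re_hol_add harmonic_on_imp_re_hol op re_hol_ln_dist) (auto simp: is_green_function_def)
  qed (simp add: k_def)
  moreover have "re_hol k (ball p r)"
    by (rule re_hol_cong[OF harmonic_on_imp_re_hol[OF rh(3) open_ball]]) (use rh(4) in \<open>auto simp: k_def\<close>)
  ultimately have "re_hol k D"
    using rh(1,2) by (intro re_hol_local) (metis DiffI Diff_subset centre_in_ball singletonD)
  moreover have "(k \<longlongrightarrow> ln (cmod (\<zeta> - p))) (at \<zeta> within D)" if \<zeta>: "\<zeta> \<in> frontier D" for \<zeta>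
  proof -
    have ne: "\<zeta> \<noteq> p" using frontier_not_in_D[OF \<zeta>] p by blast
    have "(g \<longlongrightarrow> 0) (at \<zeta> within D)" using g \<zeta> by (simp add: is_green_function_def)
    then have "((\<lambda>z. g z + ln (cmod (z - p))) \<longlongrightarrow> 0 + ln (cmod (\<zeta> - p))) (at \<zeta> within D)"
      using ne by (intro tendsto_intros) auto
    moreover have "\<forall>\<^sub>F z in at \<zeta> within D. g z + ln (cmod (z - p)) = k z"
    proof -
      have "\<forall>\<^sub>F z in at \<zeta> within D. z \<noteq> p"
        using ne tendsto_ident_at by (rule tendsto_imp_eventually_ne[rotated])
      then show ?thesis by eventually_elim (simp add: k_def)
    qed
    ultimately show ?thesis by (simp add: filterlim_cong[OF refl refl])
  qed
  ultimately have "log_solution p k" by (simp add: log_solution_def)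
  then have "k z = regular_part p z"
    using log_solution_unique log_solution_regular_part[OF p] z by blast
  then show ?thesis using z by (simp add: k_def)
qed

lemma is_green_function_log:
  assumes p: "p \<in> D" and g: "\<And>z. z \<in> D - {p} \<Longrightarrow> g z = regular_part p z - ln (cmod (z - p))"
  shows "is_green_function D p g"
  unfolding is_green_function_def
proof (intro conjI ballI)
  have op: "open (D - {p})" using open_D by (rule open_delete)
  have "re_hol (\<lambda>z. regular_part p z - ln (cmod (z - p))) (D - {p})"
    by (intro re_hol_diff re_hol_ln_dist op re_hol_subset[OF re_hol_regular_part[OF p] op]) auto
  then have "re_hol g (D - {p})" by (rule re_hol_cong) (simp add: g)
  then show "harmonic_on g (D - {p})" by (rule re_hol_imp_harmonic_on)
next
  fix \<zeta> assume \<zeta>: "\<zeta> \<in> frontier D"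
  have ne: "\<zeta> \<noteq> p" using frontier_not_in_D[OF \<zeta>] p by blast
  have "((\<lambda>z. regular_part p z - ln (cmod (z - p))) \<longlongrightarrow> ln (cmod (\<zeta> - p)) - ln (cmod (\<zeta> - p)))
      (at \<zeta> within D)"
    using ne by (intro tendsto_intros regular_part_boundary[OF p \<zeta>]) auto
  moreover have "\<forall>\<^sub>F z in at \<zeta> within D. regular_part p z - ln (cmod (z - p)) = g z"
  proof -
    have "\<forall>\<^sub>F z in at \<zeta> within D. z \<noteq> p"
      using ne tendsto_ident_at by (rule tendsto_imp_eventually_ne[rotated])
    moreover have "\<forall>\<^sub>F z in at \<zeta> within D. z \<in> D" by (simp add: eventually_at_filter)
    ultimately show ?thesis by eventually_elim (simp add: g)
  qed
  ultimately show "(g \<longlongrightarrow> 0) (at \<zeta> within D)" by (simp add: filterlim_cong[OF refl refl])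
next
  obtain r where r: "r > 0" "ball p r \<subseteq> D" using open_D p openE by blast
  have "harmonic_on (regular_part p) (ball p r)"
    by (intro re_hol_imp_harmonic_on re_hol_subset[OF re_hol_regular_part[OF p] open_ball r(2)])
  moreover have "\<forall>z\<in>ball p r - {p}. g z + ln (cmod (z - p)) = regular_part p z"
  proof
    fix z assume "z \<in> ball p r - {p}"
    then have "z \<in> D - {p}" using r(2) by blast
    then show "g z + ln (cmod (z - p)) = regular_part p z" by (simp add: g)
  qed
  ultimately show "\<exists>r>0. ball p r \<subseteq> D \<and> (\<exists>h. harmonic_on h (ball p r) \<and>
      (\<forall>z\<in>ball p r - {p}. g z + ln (cmod (z - p)) = h z))"
    using r by blast
qed

lemma green_eq:
  assumes p: "p \<in> D" and z: "z \<in> D - {p}"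
  shows "green D z p = regular_part p z - ln (cmod (z - p))"
proof -
  define g0 where "g0 z = (if z \<in> D - {p} then regular_part p z - ln (cmod (z - p)) else 0)" for z
  have "(THE g. is_green_function D p g \<and> (\<forall>w. w \<notin> D - {p} \<longrightarrow> g w = 0)) = g0"
  proof (rule the_equality)
    show "is_green_function D p g0 \<and> (\<forall>w. w \<notin> D - {p} \<longrightarrow> g0 w = 0)"
      using is_green_function_log[OF p, of g0] by (simp add: g0_def)
    show "g = g0" if g: "is_green_function D p g \<and> (\<forall>w. w \<notin> D - {p} \<longrightarrow> g w = 0)" for g
    proof
      fix w show "g w = g0 w"
      proof (cases "w \<in> D - {p}")
        case True
        then show ?thesis using green_function_eq[OF p conjunct1[OF g] True] unfolding g0_def by simp
      next
        case False
        then have "g0 w = 0" unfolding g0_def by (rule if_not_P)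
        then show ?thesis using g False by simp
      qed
    qed
  qed
  then show ?thesis using z by (simp add: green_def g0_def)
qed

lemma robin_eq:
  assumes p: "p \<in> D"
  shows "robin D p = regular_part p p"
  unfolding robin_def
proof (rule tendsto_Lim)
  show "at p \<noteq> bot" by simp
  have "continuous_on D (regular_part p)" using re_hol_regular_part[OF p] by (rule re_hol_imp_continuous_on)
  then have "isCont (regular_part p) p" using open_D p by (simp add: continuous_on_eq_continuous_at)
  then have "(regular_part p \<longlongrightarrow> regular_part p p) (at p)" by (simp add: isCont_def)
  moreover have "\<forall>\<^sub>F z in at p. regular_part p z = green D z p + ln (cmod (z - p))"
  proof -
    have "\<forall>\<^sub>F z in at p. z \<in> D" using open_D p by (rule eventually_at_in_open')
    moreover have "\<forall>\<^sub>F z in at p. z \<noteq> p" by (simp add: eventually_at_filter)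
    ultimately show ?thesis by eventually_elim (simp add: green_eq[OF p])
  qed
  ultimately show "((\<lambda>z. green D z p + ln (cmod (z - p))) \<longlongrightarrow> regular_part p p) (at p)"
    by (simp add: filterlim_cong[OF refl refl])
qed

section \<open>Smoothness of the Robin constant\<close>

lemma dist_frontier_ge:
  assumes "ball p \<delta> \<subseteq> D" "\<zeta> \<notin> D"
  shows "\<delta> \<le> cmod (\<zeta> - p)"
  using assms by (force simp: dist_norm norm_minus_commute)

lemma ln_dist_diff_le:
  assumes "\<delta> > 0" "ball p \<delta> \<subseteq> D" "ball p' \<delta> \<subseteq> D" "\<zeta> \<notin> D"
  shows "\<bar>ln (cmod (\<zeta> - p)) - ln (cmod (\<zeta> - p'))\<bar> \<le> dist p p' / \<delta>"
proof -
  have le: "ln (cmod (\<zeta> - p)) - ln (cmod (\<zeta> - p')) \<le> dist p p' / \<delta>"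
    if b: "ball p \<delta> \<subseteq> D" "ball p' \<delta> \<subseteq> D" for p p'
  proof -
    define x y where "x = cmod (\<zeta> - p)" and "y = cmod (\<zeta> - p')"
    have xy: "\<delta> \<le> x" "\<delta> \<le> y" using dist_frontier_ge assms(4) b by (auto simp: x_def y_def)
    have "x \<le> y + dist p p'"
      using norm_triangle_ineq[of "\<zeta> - p'" "p' - p"] by (simp add: x_def y_def dist_norm norm_minus_commute)
    have "ln x - ln y = ln (x / y)" using xy assms(1) by (simp add: ln_div)
    also have "\<dots> \<le> x / y - 1" using xy assms(1) by (intro ln_le_minus_one) simp
    also have "\<dots> = (x - y) / y" using xy assms(1) by (simp add: field_simps)
    also have "\<dots> \<le> dist p p' / \<delta>"
      using \<open>x \<le> y + dist p p'\<close> xy assms(1) by (intro frac_le) auto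
    finally show ?thesis by (simp add: x_def y_def)
  qed
  show ?thesis using le[OF assms(2,3)] le[OF assms(3,2)] by (simp add: abs_le_iff dist_commute)
qed

text \<open>By the maximum principle it suffices to compare the boundary values.\<close>

lemma regular_part_lipschitz:
  assumes \<delta>: "\<delta> > 0" "ball p \<delta> \<subseteq> D" "ball p' \<delta> \<subseteq> D" and z: "z \<in> D"
  shows "\<bar>regular_part p z - regular_part p' z\<bar> \<le> dist p p' / \<delta>"
proof -
  have le: "regular_part p z - regular_part p' z \<le> dist p p' / \<delta>"
    if b: "ball p \<delta> \<subseteq> D" "ball p' \<delta> \<subseteq> D" for p p'
  proof -
    have p: "p \<in> D" "p' \<in> D" using \<delta>(1) b by auto
    show ?thesis
    proof (rule re_hol_le_boundary[OF re_hol_diff[OF re_hol_regular_part[OF p(1)] re_hol_regular_part[OF p(2)]] bounded_D z])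
      fix \<zeta> assume \<zeta>: "\<zeta> \<in> frontier D"
      show "((\<lambda>z. regular_part p z - regular_part p' z) \<longlongrightarrow>
          ln (cmod (\<zeta> - p)) - ln (cmod (\<zeta> - p'))) (at \<zeta> within D)"
        by (intro tendsto_diff regular_part_boundary p \<zeta>)
      show "ln (cmod (\<zeta> - p)) - ln (cmod (\<zeta> - p')) \<le> dist p p' / \<delta>"
        using ln_dist_diff_le[OF \<delta>(1) b frontier_not_in_D[OF \<zeta>]] by simp
    qed
  qed
  show ?thesis using le[OF \<delta>(2,3)] le[OF \<delta>(3,2)] by (simp add: abs_le_iff dist_commute)
qed

lemma continuous_on_regular_part: "continuous_on (D \<times> D) (\<lambda>(z, p). regular_part p z)"
  unfolding continuous_on_def
proof
  fix x assume "x \<in> D \<times> D"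
  then obtain z0 p0 where x: "x = (z0, p0)" "z0 \<in> D" "p0 \<in> D" by blast
  obtain e where e: "e > 0" "ball p0 e \<subseteq> D" using open_D x(3) openE by blast
  define \<delta> where "\<delta> = e / 2"
  have \<delta>: "\<delta> > 0" "ball p0 \<delta> \<subseteq> D" using e by (auto simp: \<delta>_def)
  have near: "ball p \<delta> \<subseteq> D" if "dist p p0 < \<delta>" for p
  proof
    fix q assume "q \<in> ball p \<delta>"
    then have "dist p0 q < e" using that dist_triangle[of p0 q p] by (simp add: \<delta>_def dist_commute)
    then show "q \<in> D" using e(2) by auto
  qed
  let ?F = "at x within D \<times> D"
  have zl: "((\<lambda>y. fst y) \<longlongrightarrow> z0) ?F" and pl: "((\<lambda>y. snd y) \<longlongrightarrow> p0) ?F"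
    using tendsto_fst[OF tendsto_ident_at[of x "D \<times> D"]] tendsto_snd[OF tendsto_ident_at[of x "D \<times> D"]]
    by (simp_all add: x(1))
  have "continuous_on D (regular_part p0)" using re_hol_regular_part[OF x(3)] by (rule re_hol_imp_continuous_on)
  then have "isCont (regular_part p0) z0" using open_D x(2) by (simp add: continuous_on_eq_continuous_at)
  then have 1: "((\<lambda>y. regular_part p0 (fst y)) \<longlongrightarrow> regular_part p0 z0) ?F"
    using zl by (rule isCont_tendsto_compose)
  have "((\<lambda>y. dist (snd y) p0 / \<delta>) \<longlongrightarrow> dist p0 p0 / \<delta>) ?F"
    using \<delta>(1) by (intro tendsto_intros pl) auto
  then have l0: "((\<lambda>y. dist (snd y) p0 / \<delta>) \<longlongrightarrow> 0) ?F" by simp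
  have "((\<lambda>y. regular_part (snd y) (fst y) - regular_part p0 (fst y)) \<longlongrightarrow> 0) ?F"
  proof (rule Lim_null_comparison[OF _ l0])
    have "\<forall>\<^sub>F y in ?F. dist (snd y) p0 < \<delta>" using pl \<delta>(1) by (rule tendstoD)
    moreover have "\<forall>\<^sub>F y in ?F. y \<in> D \<times> D" by (simp add: eventually_at_filter)
    ultimately show "\<forall>\<^sub>F y in ?F. norm (regular_part (snd y) (fst y) - regular_part p0 (fst y))
        \<le> dist (snd y) p0 / \<delta>"
    proof eventually_elim
      case (elim y)
      then show ?case using regular_part_lipschitz[OF \<delta>(1) near[OF elim(1)] \<delta>(2), of "fst y"] by auto
    qed
  qed
  from tendsto_add[OF this 1]
  show "((\<lambda>(z, p). regular_part p z) \<longlongrightarrow> (case x of (z, p) \<Rightarrow> regular_part p z)) ?F"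
    by (simp add: x(1) case_prod_unfold)
qed

lemma continuous_on_regular_part_compose:
  assumes "continuous_on A f" "continuous_on A g" "f ` A \<subseteq> D" "g ` A \<subseteq> D"
  shows "continuous_on A (\<lambda>x. regular_part (g x) (f x))"
  using continuous_on_compose2[OF continuous_on_regular_part continuous_on_Pair[OF assms(1,2)]] assms(3,4)
  by auto

lemma circle_subset: "r > 0 \<Longrightarrow> cball a r \<subseteq> D \<Longrightarrow> a + rcis r t \<in> D"
  using circle_point_in_sphere[of r a t] sphere_cball by blast

lemma continuous_on_rcis: "continuous_on A (\<lambda>x. a + rcis r (f x))" if "continuous_on A f"
  unfolding rcis_def by (intro continuous_intros that)

lemma continuous_on_regular_part_pole:
  assumes "z \<in> D"
  shows "continuous_on D (\<lambda>q. regular_part q z)"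
  by (rule continuous_on_regular_part_compose) (use assms in \<open>auto intro!: continuous_intros\<close>)

text \<open>As a function of \<open>z\<close>, the Poisson integral of \<open>q \<mapsto> regular_part q z\<close> at \<open>p\<close> is harmonic with
  boundary values the Poisson integral of \<open>q \<mapsto> ln \<bar>\<zeta> - q\<bar>\<close> at \<open>p\<close>, which is \<open>ln \<bar>\<zeta> - p\<bar>\<close>. By
  uniqueness it is \<open>regular_part p z\<close>: the regular part is harmonic in the pole as well.\<close>

lemma poisson_mod_regular_part_pole:
  assumes r: "r > 0" "cball a r \<subseteq> D" and p: "p \<in> ball a r" and z: "z \<in> D"
  shows "poisson_mod a r (\<lambda>q. regular_part q z) p = regular_part p z"
proof -
  have pD: "p \<in> D" using p r(2) by auto
  define w where "w = (p - a) / of_real r"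
  have w: "w \<in> ball 0 1" unfolding w_def using p by (rule scale_in_unit_ball)
  define N where "N z = poisson_mod a r (\<lambda>q. regular_part q z) p" for z
  have N: "N z = integral {0..2*pi} (\<lambda>t. poisson_kernel w t * regular_part (a + rcis r t) z) / (2 * pi)" for z
    using p by (simp add: N_def poisson_mod_def w_def)
  have sphD: "sphere a r \<subseteq> D" using r(2) sphere_cball by (rule order_trans[rotated])
  have pk2: "continuous_on A (\<lambda>x. poisson_kernel v (f x))" if "continuous_on A f" "v \<in> ball 0 1"
    for A :: "'x::topological_space set" and f v
    by (rule continuous_on_compose2[OF continuous_on_poisson_kernel_snd[OF that(2), of UNIV] that(1)]) auto
  have Nc: "continuous_on D N"
  proof -
    have "continuous_on D (\<lambda>z. integral (cbox 0 (2*pi)) (\<lambda>t. poisson_kernel w t * regular_part (a + rcis r t) z))"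
    proof (rule integral_continuous_on_param)
      show "continuous_on (D \<times> cbox 0 (2*pi)) (\<lambda>(z, t). poisson_kernel w t * regular_part (a + rcis r t) z)"
        unfolding split_beta
        by (intro continuous_on_mult pk2 w continuous_on_regular_part_compose continuous_on_rcis
            continuous_intros) (use circle_subset[OF r] in auto)
    qed
    then show ?thesis unfolding N[abs_def] by (intro continuous_intros) simp_all
  qed
  have "re_hol N D"
  proof (rule re_hol_of_poisson_mod_eq[OF open_D Nc])
    fix b s z assume s: "s > 0" "cball b s \<subseteq> D" and zb: "z \<in> ball b s"
    define y where "y = (z - b) / of_real s"
    have y: "y \<in> ball 0 1" unfolding y_def using zb by (rule scale_in_unit_ball)
    let ?R = "\<lambda>t x. regular_part (a + rcis r t) (b + rcis s x)"
    have cont: "continuous_on (cbox (0, 0) (2*pi, 2*pi))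
        (\<lambda>(x, t). poisson_kernel y x * (poisson_kernel w t * ?R t x))"
      unfolding split_beta
      by (intro continuous_on_mult pk2 w y continuous_on_regular_part_compose continuous_on_rcis
          continuous_intros) (use circle_subset[OF r] circle_subset[OF s] in auto)
    have "poisson_mod b s N z = integral {0..2*pi} (\<lambda>x. poisson_kernel y x * N (b + rcis s x)) / (2 * pi)"
      using zb by (simp add: poisson_mod_def y_def)
    also have "(\<lambda>x. poisson_kernel y x * N (b + rcis s x)) =
        (\<lambda>x. integral {0..2*pi} (\<lambda>t. poisson_kernel y x * (poisson_kernel w t * ?R t x)) / (2 * pi))"
      by (simp add: N fun_eq_iff)
    also have "integral {0..2*pi} (\<lambda>x. integral {0..2*pi} (\<lambda>t. poisson_kernel y x * (poisson_kernel w t * ?R t x)) / (2 * pi))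
        = integral {0..2*pi} (\<lambda>x. integral {0..2*pi} (\<lambda>t. poisson_kernel y x * (poisson_kernel w t * ?R t x))) / (2 * pi)"
      by simp
    also have "integral {0..2*pi} (\<lambda>x. integral {0..2*pi} (\<lambda>t. poisson_kernel y x * (poisson_kernel w t * ?R t x)))
        = integral {0..2*pi} (\<lambda>t. integral {0..2*pi} (\<lambda>x. poisson_kernel y x * (poisson_kernel w t * ?R t x)))"
      using integral_swap_continuous[OF cont] by simp
    also have "\<dots> = integral {0..2*pi} (\<lambda>t. poisson_kernel w t * (2 * pi * regular_part (a + rcis r t) z))"
    proof (rule integral_cong)
      fix t :: real
      have hr: "re_hol (regular_part (a + rcis r t)) D" using circle_subset[OF r] by (rule re_hol_regular_part)
      have "poisson_mod b s (regular_part (a + rcis r t)) z = regular_part (a + rcis r t) z"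
        by (rule poisson_mod_eq_of_re_hol[OF hr s(2,1)])
      then have "integral {0..2*pi} (\<lambda>x. poisson_kernel y x * ?R t x) = 2 * pi * regular_part (a + rcis r t) z"
        using zb by (simp add: poisson_mod_def y_def field_simps)
      moreover have "integral {0..2*pi} (\<lambda>x. poisson_kernel y x * (poisson_kernel w t * ?R t x))
          = poisson_kernel w t * integral {0..2*pi} (\<lambda>x. poisson_kernel y x * ?R t x)"
        unfolding mult.left_commute[of "poisson_kernel y _"] by (rule integral_mult_right)
      ultimately show "integral {0..2*pi} (\<lambda>x. poisson_kernel y x * (poisson_kernel w t * ?R t x))
          = poisson_kernel w t * (2 * pi * regular_part (a + rcis r t) z)" by simp
    qed
    also have "\<dots> / (2 * pi) / (2 * pi) = N z"
    proof -
      have "(\<lambda>t. poisson_kernel w t * (2 * pi * regular_part (a + rcis r t) z))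
          = (\<lambda>t. 2 * pi * (poisson_kernel w t * regular_part (a + rcis r t) z))"
        by (simp add: fun_eq_iff)
      then show ?thesis by (simp add: N)
    qed
    finally show "poisson_mod b s N z = N z" .
  qed
  moreover have "(N \<longlongrightarrow> ln (cmod (\<zeta> - p))) (at \<zeta> within D)" if \<zeta>: "\<zeta> \<in> frontier D" for \<zeta>
  proof (rule tendstoI)
    fix \<epsilon> :: real assume \<epsilon>: "\<epsilon> > 0"
    have \<zeta>D: "\<zeta> \<notin> D" using \<zeta> by (rule frontier_not_in_D)
    obtain \<delta> where \<delta>: "\<delta> > 0" "(\<Union>x\<in>cball a r. ball x \<delta>) \<subseteq> D"
      using compact_subset_open_imp_ball_epsilon_subset[OF compact_cball open_D r(2)] by blast
    have \<delta>b: "ball q \<delta> \<subseteq> D" if "q \<in> cball a r" for q using \<delta>(2) that by blast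
    \<comment> \<open>A finite net of poles makes the limit at \<open>\<zeta>\<close> uniform in \<open>q\<close>; between the points of the
      net the Lipschitz bounds apply.\<close>
    define \<eta> where "\<eta> = \<delta> * \<epsilon> / 4"
    have \<eta>: "\<eta> > 0" using \<delta>(1) \<epsilon> by (simp add: \<eta>_def)
    obtain C where C: "C \<subseteq> cball a r" "finite C" "cball a r \<subseteq> (\<Union>q\<in>C. ball q \<eta>)"
      by (rule compactE_image[OF compact_cball[of a r], where C = "cball a r" and f = "\<lambda>q. ball q \<eta>"])
        (use \<eta> in auto)
    have "\<forall>\<^sub>F z in at \<zeta> within D. \<forall>q\<in>C. \<bar>regular_part q z - ln (cmod (\<zeta> - q))\<bar> < \<epsilon> / 4"
    proof (rule eventually_ball_finite[OF C(2)], rule ballI)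
      fix q assume "q \<in> C"
      then have "q \<in> D" using C(1) r(2) by blast
      from tendstoD[OF regular_part_boundary[OF this \<zeta>], of "\<epsilon> / 4"]
      show "\<forall>\<^sub>F z in at \<zeta> within D. \<bar>regular_part q z - ln (cmod (\<zeta> - q))\<bar> < \<epsilon> / 4"
        using \<epsilon> by (simp add: dist_real_def)
    qed
    moreover have "\<forall>\<^sub>F z in at \<zeta> within D. z \<in> D" by (simp add: eventually_at_filter)
    ultimately show "\<forall>\<^sub>F z in at \<zeta> within D. dist (N z) (ln (cmod (\<zeta> - p))) < \<epsilon>"
    proof eventually_elim
      case (elim z)
      have close: "\<bar>regular_part q z - ln (cmod (\<zeta> - q))\<bar> \<le> 3 * \<epsilon> / 4" if q: "q \<in> cball a r" for q
      proof -
        obtain q' where q': "q' \<in> C" "dist q' q < \<eta>" using C(3) q by auto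
        have qs: "q \<in> cball a r" "q' \<in> cball a r" using q q'(1) C(1) by blast+
        have "dist q q' / \<delta> \<le> \<epsilon> / 4"
          using q'(2) \<delta>(1) by (simp add: \<eta>_def dist_commute divide_le_eq mult.commute)
        then have "\<bar>regular_part q z - regular_part q' z\<bar> \<le> \<epsilon> / 4"
          "\<bar>ln (cmod (\<zeta> - q)) - ln (cmod (\<zeta> - q'))\<bar> \<le> \<epsilon> / 4"
          using regular_part_lipschitz[OF \<delta>(1) \<delta>b[OF qs(1)] \<delta>b[OF qs(2)] elim(2)]
            ln_dist_diff_le[OF \<delta>(1) \<delta>b[OF qs(1)] \<delta>b[OF qs(2)] \<zeta>D] by linarith+
        moreover have "\<bar>regular_part q' z - ln (cmod (\<zeta> - q'))\<bar> < \<epsilon> / 4" using elim(1) q'(1) by blast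
        ultimately show ?thesis by linarith
      qed
      have hl: "re_hol (\<lambda>q. ln (cmod (\<zeta> - q))) D"
        using re_hol_ln_dist[OF open_D \<zeta>D] by (simp add: norm_minus_commute)
      have "continuous_on (sphere a r) (\<lambda>q. regular_part q z)"
        using continuous_on_regular_part_pole[OF elim(2)] sphD by (rule continuous_on_subset)
      moreover have "continuous_on (sphere a r) (\<lambda>q. ln (cmod (\<zeta> - q)))"
        using re_hol_imp_continuous_on[OF hl] sphD by (rule continuous_on_subset)
      ultimately have "\<bar>poisson_mod a r (\<lambda>q. regular_part q z) p
          - poisson_mod a r (\<lambda>q. ln (cmod (\<zeta> - q))) p\<bar> \<le> 3 * \<epsilon> / 4"
        by (rule poisson_mod_abs_diff_le) (use close p in auto)
      then have "\<bar>N z - ln (cmod (\<zeta> - p))\<bar> \<le> 3 * \<epsilon> / 4"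
        unfolding N_def poisson_mod_eq_of_re_hol[OF hl r(2,1)] .
      then show ?case using \<epsilon> by (simp add: dist_real_def)
    qed
  qed
  ultimately have "log_solution p N" by (simp add: log_solution_def)
  then have "N z = regular_part p z"
    using log_solution_unique log_solution_regular_part[OF pD] z by blast
  then show ?thesis by (simp add: N_def)
qed

end

text \<open>A function of \<open>w\<close> with a parameter \<open>t\<close>, whose derivatives in \<open>w\<close> up to order \<open>k\<close> are
  jointly continuous. The derivative is split into its complex linear and its complex antilinear
  part, so that it is described by two functions of the same kind.\<close>

primrec param_Ck ::
  "nat \<Rightarrow> (complex \<Rightarrow> 'b::euclidean_space \<Rightarrow> complex) \<Rightarrow> complex set \<Rightarrow> 'b set \<Rightarrow> bool"
where
  "param_Ck 0 f U T \<longleftrightarrow> continuous_on (U \<times> T) (\<lambda>(w, t). f w t)"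
| "param_Ck (Suc k) f U T \<longleftrightarrow> continuous_on (U \<times> T) (\<lambda>(w, t). f w t) \<and>
     (\<exists>P Q. param_Ck k P U T \<and> param_Ck k Q U T \<and>
       (\<forall>w\<in>U. \<forall>t\<in>T. ((\<lambda>w. f w t) has_derivative (\<lambda>v. P w t * v + Q w t * cnj v)) (at w)))"

lemma param_Ck_continuous: "param_Ck k f U T \<Longrightarrow> continuous_on (U \<times> T) (\<lambda>(w, t). f w t)"
  by (cases k) auto

lemma param_Ck_SucE:
  assumes "param_Ck (Suc k) f U T"
  obtains P Q where "param_Ck k P U T" "param_Ck k Q U T"
    "\<forall>w\<in>U. \<forall>t\<in>T. ((\<lambda>w. f w t) has_derivative (\<lambda>v. P w t * v + Q w t * cnj v)) (at w)"
proof -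
  have "\<exists>P Q. param_Ck k P U T \<and> param_Ck k Q U T \<and>
       (\<forall>w\<in>U. \<forall>t\<in>T. ((\<lambda>w. f w t) has_derivative (\<lambda>v. P w t * v + Q w t * cnj v)) (at w))"
    using assms by simp
  then show ?thesis using that by blast
qed

lemma param_Ck_SucI:
  assumes "continuous_on (U \<times> T) (\<lambda>(w, t). f w t)" "param_Ck k P U T" "param_Ck k Q U T"
    "\<And>w t. w \<in> U \<Longrightarrow> t \<in> T \<Longrightarrow> ((\<lambda>w. f w t) has_derivative (\<lambda>v. P w t * v + Q w t * cnj v)) (at w)"
  shows "param_Ck (Suc k) f U T"
proof -
  have "\<exists>P Q. param_Ck k P U T \<and> param_Ck k Q U T \<and>
       (\<forall>w\<in>U. \<forall>t\<in>T. ((\<lambda>w. f w t) has_derivative (\<lambda>v. P w t * v + Q w t * cnj v)) (at w))"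
    by (rule exI[of _ P], rule exI[of _ Q]) (use assms(2-4) in simp)
  then show ?thesis using assms(1) unfolding param_Ck.simps by blast
qed

lemma param_Ck_Suc_lower: "param_Ck (Suc k) f U T \<Longrightarrow> param_Ck k f U T"
proof (induction k arbitrary: f)
  case 0
  then show ?case using param_Ck_continuous by simp
next
  case (Suc k)
  obtain P Q where "param_Ck (Suc k) P U T" "param_Ck (Suc k) Q U T"
    "\<forall>w\<in>U. \<forall>t\<in>T. ((\<lambda>w. f w t) has_derivative (\<lambda>v. P w t * v + Q w t * cnj v)) (at w)"
    by (rule param_Ck_SucE[OF Suc.prems])
  then show ?case
    by (intro param_Ck_SucI[of _ _ f _ P Q] param_Ck_continuous[OF Suc.prems] Suc.IH) auto
qed

lemma param_Ck_const:
  assumes "continuous_on T h"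
  shows "param_Ck k (\<lambda>w. h) U T"
  using assms
proof (induction k arbitrary: h)
  case 0
  then have "continuous_on (U \<times> T) (\<lambda>x. h (snd x))"
    by (intro continuous_on_compose2[OF 0]) (auto intro!: continuous_intros)
  then show ?case by (simp add: case_prod_unfold)
next
  case (Suc k)
  have "continuous_on (U \<times> T) (\<lambda>x. h (snd x))"
    by (intro continuous_on_compose2[OF Suc.prems]) (auto intro!: continuous_intros)
  then show ?case
    by (intro param_Ck_SucI[where P = "\<lambda>w t. 0" and Q = "\<lambda>w t. 0"] Suc.IH)
      (auto simp: case_prod_unfold)
qed

lemma param_Ck_add:
  assumes "param_Ck k f U T" "param_Ck k g U T"
  shows "param_Ck k (\<lambda>w t. f w t + g w t) U T"
  using assms
proof (induction k arbitrary: f g)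
  case 0
  then show ?case by (auto simp: case_prod_unfold intro!: continuous_intros)
next
  case (Suc k)
  obtain P Q where f: "param_Ck k P U T" "param_Ck k Q U T"
    "\<forall>w\<in>U. \<forall>t\<in>T. ((\<lambda>w. f w t) has_derivative (\<lambda>v. P w t * v + Q w t * cnj v)) (at w)"
    by (rule param_Ck_SucE[OF Suc.prems(1)])
  obtain P' Q' where g: "param_Ck k P' U T" "param_Ck k Q' U T"
    "\<forall>w\<in>U. \<forall>t\<in>T. ((\<lambda>w. g w t) has_derivative (\<lambda>v. P' w t * v + Q' w t * cnj v)) (at w)"
    by (rule param_Ck_SucE[OF Suc.prems(2)])
  show ?case
  proof (rule param_Ck_SucI[OF _ Suc.IH[OF f(1) g(1)] Suc.IH[OF f(2) g(2)]])
    show "continuous_on (U \<times> T) (\<lambda>(w, t). f w t + g w t)"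
      using param_Ck_continuous[OF Suc.prems(1)] param_Ck_continuous[OF Suc.prems(2)]
      by (auto simp: case_prod_unfold intro!: continuous_intros)
    show "((\<lambda>w. f w t + g w t) has_derivative
        (\<lambda>v. (P w t + P' w t) * v + (Q w t + Q' w t) * cnj v)) (at w)" if "w \<in> U" "t \<in> T" for w t
      by (rule has_derivative_eq_rhs[OF has_derivative_add[OF f(3)[rule_format, OF that] g(3)[rule_format, OF that]]])
        (simp add: fun_eq_iff algebra_simps)
  qed
qed

lemma param_Ck_mult:
  assumes "param_Ck k f U T" "param_Ck k g U T"
  shows "param_Ck k (\<lambda>w t. f w t * g w t) U T"
  using assms
proof (induction k arbitrary: f g)
  case 0
  then show ?case by (auto simp: case_prod_unfold intro!: continuous_intros)
next
  case (Suc k)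
  obtain P Q where f: "param_Ck k P U T" "param_Ck k Q U T"
    "\<forall>w\<in>U. \<forall>t\<in>T. ((\<lambda>w. f w t) has_derivative (\<lambda>v. P w t * v + Q w t * cnj v)) (at w)"
    by (rule param_Ck_SucE[OF Suc.prems(1)])
  obtain P' Q' where g: "param_Ck k P' U T" "param_Ck k Q' U T"
    "\<forall>w\<in>U. \<forall>t\<in>T. ((\<lambda>w. g w t) has_derivative (\<lambda>v. P' w t * v + Q' w t * cnj v)) (at w)"
    by (rule param_Ck_SucE[OF Suc.prems(2)])
  note lower = param_Ck_Suc_lower[OF Suc.prems(1)] param_Ck_Suc_lower[OF Suc.prems(2)]
  show ?case
  proof (rule param_Ck_SucI[OF _ param_Ck_add[OF Suc.IH[OF lower(1) g(1)] Suc.IH[OF f(1) lower(2)]]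
        param_Ck_add[OF Suc.IH[OF lower(1) g(2)] Suc.IH[OF f(2) lower(2)]]])
    show "continuous_on (U \<times> T) (\<lambda>(w, t). f w t * g w t)"
      using param_Ck_continuous[OF Suc.prems(1)] param_Ck_continuous[OF Suc.prems(2)]
      by (auto simp: case_prod_unfold intro!: continuous_intros)
    show "((\<lambda>w. f w t * g w t) has_derivative
        (\<lambda>v. (f w t * P' w t + P w t * g w t) * v + (f w t * Q' w t + Q w t * g w t) * cnj v)) (at w)"
      if "w \<in> U" "t \<in> T" for w t
      by (rule has_derivative_eq_rhs[OF has_derivative_mult[OF f(3)[rule_format, OF that] g(3)[rule_format, OF that]]])
        (simp add: fun_eq_iff algebra_simps)
  qed
qed

lemma param_Ck_cnj:
  assumes "param_Ck k f U T"
  shows "param_Ck k (\<lambda>w t. cnj (f w t)) U T"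
  using assms
proof (induction k arbitrary: f)
  case 0
  then show ?case by (auto simp: case_prod_unfold intro!: continuous_intros)
next
  case (Suc k)
  obtain P Q where f: "param_Ck k P U T" "param_Ck k Q U T"
    "\<forall>w\<in>U. \<forall>t\<in>T. ((\<lambda>w. f w t) has_derivative (\<lambda>v. P w t * v + Q w t * cnj v)) (at w)"
    by (rule param_Ck_SucE[OF Suc.prems])
  show ?case
  proof (rule param_Ck_SucI[OF _ Suc.IH[OF f(2)] Suc.IH[OF f(1)]])
    show "continuous_on (U \<times> T) (\<lambda>(w, t). cnj (f w t))"
      using param_Ck_continuous[OF Suc.prems] by (auto simp: case_prod_unfold intro!: continuous_intros)
    show "((\<lambda>w. cnj (f w t)) has_derivative (\<lambda>v. cnj (Q w t) * v + cnj (P w t) * cnj v)) (at w)"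
      if "w \<in> U" "t \<in> T" for w t
      by (rule has_derivative_eq_rhs[OF has_derivative_cnj[OF f(3)[rule_format, OF that]]])
        (simp add: fun_eq_iff algebra_simps)
  qed
qed

lemma param_Ck_affine:
  shows "param_Ck k (\<lambda>w t. (w - a) / c) U T"
proof (cases k)
  case 0
  then show ?thesis unfolding divide_inverse by (auto simp: case_prod_unfold intro!: continuous_intros)
next
  case (Suc j)
  have 1: "continuous_on (U \<times> T) (\<lambda>(w, t). (w - a) / c)"
    unfolding divide_inverse by (auto simp: case_prod_unfold intro!: continuous_intros)
  have 2: "((\<lambda>w. (w - a) / c) has_derivative (\<lambda>v. 1 / c * v + 0 * cnj v)) (at w)" for w
    unfolding divide_inverse
    by (rule has_derivative_eq_rhs, (rule derivative_intros)+) (simp add: fun_eq_iff mult.commute)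
  have c: "param_Ck j (\<lambda>w t. x) U T" for x :: complex
    by (rule param_Ck_const) (rule continuous_on_const)
  show ?thesis unfolding Suc by (rule param_Ck_SucI[OF 1 c c 2])
qed

lemma param_Ck_inverse:
  assumes "continuous_on T h" "c \<noteq> 0" "\<And>w t. w \<in> U \<Longrightarrow> t \<in> T \<Longrightarrow> h t - (w - a) / c \<noteq> 0"
  shows "param_Ck k (\<lambda>w t. inverse (h t - (w - a) / c)) U T"
proof -
  have c: "continuous_on (U \<times> T) (\<lambda>(w, t). inverse (h t - (w - a) / c))"
  proof -
    have "continuous_on (U \<times> T) (\<lambda>x. h (snd x))"
      by (intro continuous_on_compose2[OF assms(1)]) (auto intro!: continuous_intros)
    then show ?thesis unfolding case_prod_unfold
      using assms(2,3) by (intro continuous_intros) auto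
  qed
  show ?thesis
  proof (induction k)
    case 0
    then show ?case using c by simp
  next
    case (Suc k)
    let ?A = "\<lambda>w t. inverse (h t - (w - a) / c)"
    have cc: "param_Ck k (\<lambda>w t. x) U T" for x :: complex
      by (rule param_Ck_const) (rule continuous_on_const)
    show ?case
    proof (rule param_Ck_SucI[OF c param_Ck_mult[OF param_Ck_mult[OF Suc Suc] cc[of "1 / c"]] cc[of 0]])
      fix w t assume wt: "w \<in> U" "t \<in> T"
      have "((\<lambda>w. inverse (h t - (w - a) / c)) has_field_derivative
          - ((0 - 1 / c) * inverse ((h t - (w - a) / c)\<^sup>2))) (at w)"
        using assms(2) assms(3)[OF wt]
        by (auto intro!: derivative_eq_intros simp: divide_inverse power2_eq_square)
      then show "((\<lambda>w. ?A w t) has_derivative (\<lambda>v. ?A w t * ?A w t * (1 / c) * v + 0 * cnj v)) (at w)"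
        unfolding has_field_derivative_def
        by (rule has_derivative_eq_rhs) (simp add: fun_eq_iff power2_eq_square)
    qed
  qed
qed

lemma continuous_on_fix_fst:
  assumes "continuous_on (U \<times> T) (\<lambda>(w, t). g w t)" "w \<in> U"
  shows "continuous_on T (g w)"
proof -
  have "continuous_on T (Pair w)" by (intro continuous_intros)
  moreover have "Pair w ` T \<subseteq> U \<times> T" using assms(2) by blast
  ultimately have "continuous_on T (\<lambda>t. case (w, t) of (w, t) \<Rightarrow> g w t)"
    by (rule continuous_on_compose2[OF assms(1)])
  then show ?thesis by simp
qed

lemma Ck_on_integral_param:
  assumes U: "open U" "convex U"
  shows "param_Ck k f U (cbox a b) \<Longrightarrow> Ck_on k (\<lambda>w. integral (cbox a b) (f w)) U"
proof (induction k arbitrary: f)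
  case 0
  then show ?case using integral_continuous_on_param[of U a b f] by simp
next
  case (Suc k)
  obtain P Q where f: "param_Ck k P U (cbox a b)" "param_Ck k Q U (cbox a b)"
    "\<forall>w\<in>U. \<forall>t\<in>cbox a b. ((\<lambda>w. f w t) has_derivative (\<lambda>v. P w t * v + Q w t * cnj v)) (at w)"
    by (rule param_Ck_SucE[OF Suc.prems])
  note c = param_Ck_continuous[OF Suc.prems] param_Ck_continuous[OF f(1)] param_Ck_continuous[OF f(2)]
  define cn where "cn = Blinfun cnj"
  have cn: "blinfun_apply cn = cnj" unfolding cn_def
    by (rule bounded_linear_Blinfun_apply[OF bounded_linear_cnj])
  define fx where "fx w t = blinfun_mult_right (P w t) + (blinfun_mult_right (Q w t) o\<^sub>L cn)" for w t
  have fx: "blinfun_apply (fx w t) v = P w t * v + Q w t * cnj v" for w t v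
    by (simp add: fx_def cn blinfun.bilinear_simps)
  have cfx: "continuous_on (U \<times> cbox a b) (\<lambda>(w, t). fx w t)"
    unfolding fx_def case_prod_unfold
    using c(2,3) unfolding case_prod_unfold by (intro continuous_intros)
  have D: "((\<lambda>w. integral (cbox a b) (f w)) has_derivative
      (\<lambda>v. integral (cbox a b) (P w) * v + integral (cbox a b) (Q w) * cnj v)) (at w)" if w: "w \<in> U" for w
  proof -
    have "((\<lambda>w. integral (cbox a b) (f w)) has_derivative blinfun_apply (integral (cbox a b) (fx w)))
        (at w within U)"
    proof (rule leibniz_rule[OF _ _ cfx w U(2)])
      show "((\<lambda>x. f x t) has_derivative blinfun_apply (fx x t)) (at x within U)"
        if "x \<in> U" "t \<in> cbox a b" for x t
      proof -
        have "blinfun_apply (fx x t) = (\<lambda>v. P x t * v + Q x t * cnj v)" by (simp add: fx fun_eq_iff)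
        then show ?thesis using f(3) that by (simp add: has_derivative_at_withinI)
      qed
      show "f x integrable_on cbox a b" if "x \<in> U" for x
        using continuous_on_fix_fst[OF c(1) that] by (rule integrable_continuous)
    qed
    moreover have "blinfun_apply (integral (cbox a b) (fx w)) v
        = integral (cbox a b) (P w) * v + integral (cbox a b) (Q w) * cnj v" for v
    proof -
      have "continuous_on (cbox a b) (fx w)" using cfx w by (rule continuous_on_fix_fst)
      then have "fx w integrable_on cbox a b" by (rule integrable_continuous)
      from integral_linear[OF this blinfun.bounded_linear_left[of v]]
      have "blinfun_apply (integral (cbox a b) (fx w)) v
          = integral (cbox a b) (\<lambda>t. P w t * v + Q w t * cnj v)"
        by (simp add: o_def fx)
      also have "\<dots> = integral (cbox a b) (\<lambda>t. P w t * v) + integral (cbox a b) (\<lambda>t. Q w t * cnj v)"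
        using continuous_on_fix_fst[OF c(2) w] continuous_on_fix_fst[OF c(3) w]
        by (intro integral_add integrable_continuous continuous_intros)
      finally show ?thesis by simp
    qed
    ultimately have "blinfun_apply (integral (cbox a b) (fx w))
        = (\<lambda>v. integral (cbox a b) (P w) * v + integral (cbox a b) (Q w) * cnj v)"
      "((\<lambda>w. integral (cbox a b) (f w)) has_derivative blinfun_apply (integral (cbox a b) (fx w))) (at w)"
      by (simp_all add: at_within_open[OF w U(1)] fun_eq_iff)
    then show ?thesis by simp
  qed
  have ck: "Ck_on k (\<lambda>w. integral (cbox a b) (P w) * v + integral (cbox a b) (Q w) * cnj v) U" for v
    using Ck_on_add[OF U(1) Ck_on_mult[OF U(1) Suc.IH[OF f(1)] Ck_on_const[OF U(1)]]
        Ck_on_mult[OF U(1) Suc.IH[OF f(2)] Ck_on_const[OF U(1)]]] .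
  show ?case by (rule Ck_on_SucI[OF U(1) D]) (assumption, rule ck)
qed

lemma param_Ck_poisson_kernel:
  assumes r: "r > 0" and s: "continuous_on T s"
  shows "param_Ck k (\<lambda>p t. of_real (poisson_kernel ((p - a) / of_real r) (s t))) (ball a r) T"
proof -
  let ?w = "\<lambda>p. (p - a) / of_real r"
  let ?A = "\<lambda>p t. inverse (cis (s t) - ?w p)"
  have "complex_of_real (poisson_kernel w t) =
      (1 + (- 1) * (w * cnj w)) * (inverse (cis t - w) * cnj (inverse (cis t - w)))" for w t
    unfolding poisson_kernel_def of_real_divide of_real_diff complex_norm_square of_real_1
    by (simp add: divide_inverse)
  then have eq: "complex_of_real (poisson_kernel (?w p) (s t)) =
      (1 + (- 1) * (?w p * cnj (?w p))) * (?A p t * cnj (?A p t))" for p t .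
  have A: "param_Ck k ?A (ball a r) T"
    using r cis_neq_in_ball[OF scale_in_unit_ball]
    by (intro param_Ck_inverse continuous_on_compose2[OF continuous_on_cis[OF continuous_on_id] s]) auto
  have c: "param_Ck k (\<lambda>p t. x) (ball a r) T" for x :: complex
    by (rule param_Ck_const) (rule continuous_on_const)
  note w = param_Ck_affine[of k a "of_real r" "ball a r" T]
  show ?thesis unfolding eq
    using param_Ck_mult[OF param_Ck_add[OF c[of 1] param_Ck_mult[OF c[of "- 1"] param_Ck_mult[OF w param_Ck_cnj[OF w]]]]
        param_Ck_mult[OF A param_Ck_cnj[OF A]]] .
qed

text \<open>On a disc the Robin constant is a double Poisson integral of the continuous function
  \<open>regular_part\<close>, in which the point occurs in the kernels only.\<close>

lemma (in regular_domain) Ck_on_robin: "Ck_on k (robin D) D"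
proof (rule Ck_on_local, rule ballI)
  fix a assume "a \<in> D"
  then obtain r where r: "r > 0" "cball a r \<subseteq> D" using open_D open_contains_cball by blast
  have b: "ball a r \<subseteq> D" using r(2) ball_subset_cball by (rule order_trans[rotated])
  let ?h = "\<lambda>s t. regular_part (a + rcis r t) (a + rcis r s)"
  let ?k = "\<lambda>p. poisson_kernel ((p - a) / of_real r)"
  let ?I = "\<lambda>p x. complex_of_real (?k p (fst x)) * (complex_of_real (?k p (snd x)) * of_real (?h (fst x) (snd x)))"
  have hc: "continuous_on A (\<lambda>x. ?h (fst x) (snd x))" for A :: "(real \<times> real) set"
    by (intro continuous_on_regular_part_compose continuous_on_rcis continuous_intros)
      (use circle_subset[OF r] in auto)
  have "param_Ck k ?I (ball a r) (cbox (0, 0) (2*pi, 2*pi))"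
    by (intro param_Ck_mult param_Ck_poisson_kernel r(1) param_Ck_const continuous_intros hc)
  then have C: "Ck_on k (\<lambda>p. integral (cbox (0, 0) (2*pi, 2*pi)) (?I p)) (ball a r)"
    by (rule Ck_on_integral_param[OF open_ball convex_ball])
  let ?G = "\<lambda>p. Re (integral (cbox (0, 0) (2*pi, 2*pi)) (?I p) * of_real (1 / (2*pi)\<^sup>2))"
  have eq: "robin D p = ?G p"
    if p: "p \<in> ball a r" for p
  proof -
    have pD: "p \<in> D" using p b by blast
    have w: "(p - a) / of_real r \<in> ball 0 1" using p by (rule scale_in_unit_ball)
    have pk2: "continuous_on A (\<lambda>x. ?k p (f x))" if "continuous_on A f"
      for A :: "(real \<times> real) set" and f
      by (rule continuous_on_compose2[OF continuous_on_poisson_kernel_snd[OF w, of UNIV] that]) auto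
    let ?g = "\<lambda>x. ?k p (fst x) * (?k p (snd x) * ?h (fst x) (snd x))"
    have gc: "continuous_on (cbox (0, 0) (2*pi, 2*pi)) ?g"
      by (intro continuous_on_mult pk2 hc continuous_intros)
    have "integral (cbox (0, 0) (2*pi, 2*pi)) (?I p) = integral (cbox (0, 0) (2*pi, 2*pi)) (\<lambda>x. of_real (?g x))"
      by simp
    also have "\<dots> = of_real (integral (cbox (0, 0) (2*pi, 2*pi)) ?g)"
      using integral_linear[OF integrable_continuous[OF gc] bounded_linear_of_real[where 'a = complex]]
      by (simp add: o_def)
    finally have 1: "Re (integral (cbox (0, 0) (2*pi, 2*pi)) (?I p) * of_real (1 / (2*pi)\<^sup>2))
        = integral (cbox (0, 0) (2*pi, 2*pi)) ?g / (2*pi)\<^sup>2"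
      by simp
    have "integral (cbox (0, 0) (2*pi, 2*pi)) ?g
        = integral {0..2*pi} (\<lambda>s. integral {0..2*pi} (\<lambda>t. ?k p s * (?k p t * ?h s t)))"
      using integral_prod_continuous[OF gc] by simp
    also have "\<dots> = integral {0..2*pi} (\<lambda>s. 2 * pi * (?k p s * regular_part p (a + rcis r s)))"
    proof (rule integral_cong)
      fix s :: real
      have "integral {0..2*pi} (\<lambda>t. ?k p t * ?h s t) / (2*pi) = regular_part p (a + rcis r s)"
        using poisson_mod_regular_part_pole[OF r p circle_subset[OF r, of s]] p
        by (simp add: poisson_mod_def)
      then have "integral {0..2*pi} (\<lambda>t. ?k p t * ?h s t) = 2 * pi * regular_part p (a + rcis r s)"
        by (simp add: field_simps)
      then show "integral {0..2*pi} (\<lambda>t. ?k p s * (?k p t * ?h s t)) = 2 * pi * (?k p s * regular_part p (a + rcis r s))"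
        unfolding integral_mult_right by (simp only: mult.left_commute)
    qed
    also have "\<dots> = 2 * pi * integral {0..2*pi} (\<lambda>s. ?k p s * regular_part p (a + rcis r s))"
      by (rule integral_mult_right)
    also have "integral {0..2*pi} (\<lambda>s. ?k p s * regular_part p (a + rcis r s)) = 2 * pi * regular_part p p"
      using poisson_mod_eq_of_re_hol[OF re_hol_regular_part[OF pD] r(2,1), of p] p
      by (simp add: poisson_mod_def field_simps)
    finally show ?thesis unfolding 1 robin_eq[OF pD] by (simp add: power2_eq_square)
  qed
  have "Ck_on k (robin D) (ball a r) \<longleftrightarrow> Ck_on k ?G (ball a r)"
    by (rule Ck_on_cong[OF open_ball]) (rule eq)
  moreover have "Ck_on k ?G (ball a r)"
    by (rule Ck_on_bounded_linear[OF open_ball bounded_linear_Re Ck_on_mult[OF open_ball C Ck_on_const[OF open_ball]]])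
  ultimately have "Ck_on k (robin D) (ball a r)" by (rule iffD2)
  then show "\<exists>T. open T \<and> a \<in> T \<and> T \<subseteq> D \<and> Ck_on k (robin D) T"
    using b r(1) open_ball centre_in_ball by blast
qed

section \<open>Exterior discs of a smoothly bounded domain\<close>

lemma onorm_complex_le:
  fixes f :: "complex \<Rightarrow> real"
  assumes "bounded_linear f"
  shows "onorm f \<le> \<bar>f 1\<bar> + \<bar>f \<i>\<bar>"
proof (rule onorm_le)
  fix v :: complex
  interpret bounded_linear f by (rule assms)
  have v: "v = Re v *\<^sub>R 1 + Im v *\<^sub>R \<i>" by (simp add: complex_eq_iff)
  have "f v = Re v * f 1 + Im v * f \<i>"
    by (subst v) (simp add: add scaleR)
  also have "\<bar>\<dots>\<bar> \<le> \<bar>Re v\<bar> * \<bar>f 1\<bar> + \<bar>Im v\<bar> * \<bar>f \<i>\<bar>"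
    by (metis abs_mult abs_triangle_ineq)
  also have "\<dots> \<le> cmod v * \<bar>f 1\<bar> + cmod v * \<bar>f \<i>\<bar>"
    by (intro add_mono mult_right_mono abs_Re_le_cmod abs_Im_le_cmod) auto
  finally show "norm (f v) \<le> (\<bar>f 1\<bar> + \<bar>f \<i>\<bar>) * norm v" by (simp add: algebra_simps)
qed

lemma C1_lipschitz_on_disc:
  fixes f :: "complex \<Rightarrow> real"
  assumes U: "open U" "Ck_on (Suc 0) f U" "cball a s \<subseteq> U"
  obtains L where "L \<ge> 0" "\<And>x y. x \<in> cball a s \<Longrightarrow> y \<in> cball a s \<Longrightarrow> \<bar>f x - f y\<bar> \<le> L * cmod (x - y)"
proof -
  let ?D = "\<lambda>v z. frechet_derivative f (at z) v"
  note d = Ck_on_SucD[OF U(2,1)]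
  have "bounded (?D v ` cball a s)" for v
  proof -
    have "continuous_on U (?D v)" using d(2)[of v] by simp
    then have "continuous_on (cball a s) (?D v)" using U(3) by (rule continuous_on_subset)
    then show ?thesis using compact_continuous_image[OF _ compact_cball] compact_imp_bounded by blast
  qed
  then have "\<exists>B. \<forall>z\<in>cball a s. \<bar>?D v z\<bar> \<le> B" for v
    unfolding bounded_iff by (metis imageI real_norm_def)
  then obtain B where B: "\<And>v z. z \<in> cball a s \<Longrightarrow> \<bar>?D v z\<bar> \<le> B v" by metis
  define L where "L = \<bar>B 1\<bar> + \<bar>B \<i>\<bar>"
  have "\<bar>f x - f y\<bar> \<le> L * cmod (x - y)" if xy: "x \<in> cball a s" "y \<in> cball a s" for x y
  proof -
    have "norm (f x - f y) \<le> L * norm (x - y)"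
    proof (rule differentiable_bound[OF convex_cball _ _ xy])
      fix z assume z: "z \<in> cball a s"
      have dz: "(f has_derivative frechet_derivative f (at z)) (at z)"
        using z U(3) by (intro d(1)) blast
      show "(f has_derivative frechet_derivative f (at z)) (at z within cball a s)"
        using dz by (rule has_derivative_at_withinI)
      show "onorm (frechet_derivative f (at z)) \<le> L"
        using onorm_complex_le[OF has_derivative_bounded_linear[OF dz]] B[OF z, of 1] B[OF z, of \<i>]
        unfolding L_def by linarith
    qed
    then show ?thesis by simp
  qed
  moreover have "L \<ge> 0" by (simp add: L_def)
  ultimately show ?thesis using that by blast
qed

text \<open>With a defining function \<open>\<rho>\<close>, gradient \<open>g\<close> at \<open>\<zeta>\<close> and \<open>n = g / \<bar>g\<bar>\<close>, the points of
  the disc of radius \<open>R\<close> centred at \<open>\<zeta> + R n\<close> satisfy \<open>\<bar>z - \<zeta>\<bar>\<^sup>2 < 2 R n \<bullet> (z - \<zeta>)\<close>. There the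
  linear term of \<open>\<rho>\<close> at \<open>\<zeta>\<close> dominates the quadratic error as soon as \<open>R\<close> is small, and this
  choice of \<open>R\<close> is locally uniform in \<open>\<zeta>\<close>.\<close>

lemma exterior_discs_near:
  assumes D: "smoothly_bounded_domain D" and \<zeta>0: "\<zeta>0 \<in> frontier D"
  obtains \<delta> R where "\<delta> > 0" "R > 0"
    "\<And>\<zeta>. \<zeta> \<in> frontier D \<Longrightarrow> dist \<zeta> \<zeta>0 < \<delta> \<Longrightarrow> \<exists>c. exterior_disc D \<zeta> c R"
proof -
  have oD: "open D" using D by (simp add: smoothly_bounded_domain_def)
  obtain U and \<rho> :: "complex \<Rightarrow> real" where U: "open U" "\<zeta>0 \<in> U" "smooth_on \<rho> U"
    "\<forall>z\<in>U. frechet_derivative \<rho> (at z) \<noteq> (\<lambda>v. 0)" "D \<inter> U = {z \<in> U. \<rho> z < 0}"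
    using D \<zeta>0 unfolding smoothly_bounded_domain_def by blast
  obtain s where s: "s > 0" "cball \<zeta>0 s \<subseteq> U" using U(1,2) open_contains_cball by blast
  let ?D = "\<lambda>v z. frechet_derivative \<rho> (at z) v"
  have C2: "Ck_on (Suc (Suc 0)) \<rho> U" using U(3) by (rule smooth_on_imp_Ck_on)
  note d = Ck_on_SucD[OF C2 U(1)]
  obtain L1 where L1: "L1 \<ge> 0"
    "\<And>x y. x \<in> cball \<zeta>0 s \<Longrightarrow> y \<in> cball \<zeta>0 s \<Longrightarrow> \<bar>?D 1 x - ?D 1 y\<bar> \<le> L1 * cmod (x - y)"
    by (rule C1_lipschitz_on_disc[OF U(1) d(2) s(2)]) (rule that)
  obtain L2 where L2: "L2 \<ge> 0"
    "\<And>x y. x \<in> cball \<zeta>0 s \<Longrightarrow> y \<in> cball \<zeta>0 s \<Longrightarrow> \<bar>?D \<i> x - ?D \<i> y\<bar> \<le> L2 * cmod (x - y)"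
    by (rule C1_lipschitz_on_disc[OF U(1) d(2) s(2)]) (rule that)
  define L where "L = L1 + L2"
  have L: "L \<ge> 0" using L1(1) L2(1) by (simp add: L_def)
  have inU: "z \<in> U" if "z \<in> cball \<zeta>0 s" for z using s(2) that by blast
  have lin: "bounded_linear (frechet_derivative \<rho> (at z))" if "z \<in> U" for z
    using d(1)[OF that] by (rule has_derivative_bounded_linear)
  have taylor: "\<bar>\<rho> z - \<rho> \<zeta> - ?D (z - \<zeta>) \<zeta>\<bar> \<le> L * (cmod (z - \<zeta>))\<^sup>2"
    if z: "z \<in> cball \<zeta>0 s" and \<zeta>: "\<zeta> \<in> cball \<zeta>0 s" for z \<zeta>
  proof -
    have seg: "closed_segment \<zeta> z \<subseteq> cball \<zeta>0 s" using \<zeta> z by (intro closed_segment_subset convex_cball)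
    define \<phi> where "\<phi> w = \<rho> w - ?D w \<zeta>" for w
    have "norm (\<phi> z - \<phi> \<zeta>) \<le> (L * cmod (z - \<zeta>)) * norm (z - \<zeta>)"
    proof (rule differentiable_bound[OF convex_closed_segment, of \<zeta> z])
      fix w assume w: "w \<in> closed_segment \<zeta> z"
      have wc: "w \<in> cball \<zeta>0 s" using seg w by blast
      show "(\<phi> has_derivative (\<lambda>v. ?D v w - ?D v \<zeta>)) (at w within closed_segment \<zeta> z)"
        unfolding \<phi>_def
        by (intro has_derivative_diff has_derivative_at_withinI[OF d(1)[OF inU[OF wc]]]
            bounded_linear_imp_has_derivative lin inU \<zeta>)
      have "onorm (\<lambda>v. ?D v w - ?D v \<zeta>) \<le> \<bar>?D 1 w - ?D 1 \<zeta>\<bar> + \<bar>?D \<i> w - ?D \<i> \<zeta>\<bar>"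
        using onorm_complex_le[OF bounded_linear_sub[OF lin[OF inU[OF wc]] lin[OF inU[OF \<zeta>]]]] .
      also have "\<dots> \<le> L * cmod (w - \<zeta>)"
        using L1(2)[OF wc \<zeta>] L2(2)[OF wc \<zeta>] by (simp add: L_def algebra_simps)
      also have "\<dots> \<le> L * cmod (z - \<zeta>)"
        using segment_bound(1)[OF w] L by (intro mult_left_mono) (auto simp: norm_minus_commute)
      finally show "onorm (\<lambda>v. ?D v w - ?D v \<zeta>) \<le> L * cmod (z - \<zeta>)" .
    qed auto
    moreover have "\<phi> z - \<phi> \<zeta> = \<rho> z - \<rho> \<zeta> - ?D (z - \<zeta>) \<zeta>"
      using linear_diff[OF bounded_linear.linear[OF lin[OF inU[OF \<zeta>]]], of z \<zeta>] by (simp add: \<phi>_def)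
    ultimately show ?thesis by (simp add: power2_eq_square mult.assoc)
  qed
  define g where "g z = Complex (?D 1 z) (?D \<i> z)" for z
  have gD: "?D v z = g z \<bullet> v" if "z \<in> U" for v z
  proof -
    interpret bounded_linear "frechet_derivative \<rho> (at z)" using that by (rule lin)
    have v: "v = Re v *\<^sub>R 1 + Im v *\<^sub>R \<i>" by (simp add: complex_eq_iff)
    have "?D v z = Re v * ?D 1 z + Im v * ?D \<i> z" by (subst v) (simp add: add scaleR)
    then show ?thesis by (simp add: g_def inner_complex_def mult.commute)
  qed
  have g0: "g z \<noteq> 0" if "z \<in> U" for z
  proof
    assume "g z = 0"
    then have "frechet_derivative \<rho> (at z) = (\<lambda>v. 0)" using gD[OF that] by (simp add: fun_eq_iff)
    then show False using U(4) that by blast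
  qed
  have gc: "continuous_on (cball \<zeta>0 s) (\<lambda>z. cmod (g z))"
  proof -
    have "continuous_on U (?D 1)" "continuous_on U (?D \<i>)"
      using Ck_on_imp_continuous_on[OF d(2)] by blast+
    then have "continuous_on (cball \<zeta>0 s) (?D 1)" "continuous_on (cball \<zeta>0 s) (?D \<i>)"
      using s(2) continuous_on_subset by blast+
    then show ?thesis unfolding g_def complex_norm complex.sel by (intro continuous_intros)
  qed
  have "\<zeta>0 \<in> cball \<zeta>0 s" using s(1) by simp
  then have "\<exists>x\<in>cball \<zeta>0 s. \<forall>y\<in>cball \<zeta>0 s. cmod (g x) \<le> cmod (g y)"
    by (intro continuous_attains_inf compact_cball gc) blast
  then obtain x0 where x0: "x0 \<in> cball \<zeta>0 s" "\<forall>y\<in>cball \<zeta>0 s. cmod (g x0) \<le> cmod (g y)" by blast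
  define m where "m = cmod (g x0)"
  have m: "m > 0" "\<And>y. y \<in> cball \<zeta>0 s \<Longrightarrow> m \<le> cmod (g y)"
    using g0[OF inU[OF x0(1)]] x0(2) by (auto simp: m_def)
  define R where "R = min (s / 4) (m / (2 * L + 1))"
  have R: "R > 0" "R \<le> s / 4" "2 * L * R \<le> m"
  proof -
    show "R > 0" using s(1) m(1) L by (simp add: R_def)
    show "R \<le> s / 4" unfolding R_def by (rule min.cobounded1)
    have "2 * L * R \<le> (2 * L + 1) * R" using \<open>R > 0\<close> by (simp add: algebra_simps)
    also have "\<dots> \<le> (2 * L + 1) * (m / (2 * L + 1))" using L by (intro mult_left_mono) (auto simp: R_def)
    also have "\<dots> = m" using L by simp
    finally show "2 * L * R \<le> m" .
  qed
  have "\<exists>c. exterior_disc D \<zeta> c R" if \<zeta>: "\<zeta> \<in> frontier D" "dist \<zeta> \<zeta>0 < s / 2" for \<zeta>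
  proof -
    have \<zeta>c: "\<zeta> \<in> cball \<zeta>0 s" using \<zeta>(2) s(1) by (simp add: dist_commute)
    have \<zeta>U: "\<zeta> \<in> U" using \<zeta>c by (rule inU)
    have "\<zeta> \<notin> D" using \<zeta>(1) oD by (simp add: frontier_def interior_open)
    then have \<rho>0: "0 \<le> \<rho> \<zeta>" using U(5) \<zeta>U by force
    define n where "n = g \<zeta> /\<^sub>R cmod (g \<zeta>)"
    define c where "c = \<zeta> + R *\<^sub>R n"
    have nn: "norm n = 1" using g0[OF \<zeta>U] by (simp add: n_def)
    have dc: "dist c \<zeta> = R" using nn R(1) by (simp add: c_def dist_norm)
    have "z \<notin> D" if z: "z \<in> ball c R" for z
    proof -
      let ?h = "z - \<zeta>"
      have "dist z \<zeta>0 \<le> dist z c + dist c \<zeta> + dist \<zeta> \<zeta>0"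
        using dist_triangle[of z \<zeta>0 \<zeta>] dist_triangle[of z \<zeta> c] by linarith
      then have zc: "z \<in> cball \<zeta>0 s" using z \<zeta>(2) dc R(2) by (simp add: dist_commute)
      have "norm (?h - R *\<^sub>R n) < R" using z by (simp add: c_def dist_norm norm_minus_commute algebra_simps)
      then have "(norm (?h - R *\<^sub>R n))\<^sup>2 < R\<^sup>2" by (intro power_strict_mono) auto
      moreover have "(norm (h - R *\<^sub>R n))\<^sup>2 = (norm h)\<^sup>2 - 2 * R * (n \<bullet> h) + R\<^sup>2" for h
        using nn unfolding power2_norm_eq_inner norm_eq_1
        by (simp add: inner_diff inner_commute power2_eq_square[of R] algebra_simps)
      ultimately have "(cmod ?h)\<^sup>2 \<le> 2 * R * (n \<bullet> ?h)" by simp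
      then have "m * (cmod ?h)\<^sup>2 \<le> m * (2 * R * (n \<bullet> ?h))" using m(1) by (intro mult_left_mono) auto
      also have "\<dots> = 2 * R * (m * (n \<bullet> ?h))" by simp
      also have "\<dots> \<le> 2 * R * (cmod (g \<zeta>) * (n \<bullet> ?h))"
      proof -
        have "0 \<le> 2 * R * (n \<bullet> ?h)" using \<open>(cmod ?h)\<^sup>2 \<le> 2 * R * (n \<bullet> ?h)\<close> by (meson order_trans zero_le_power2)
        then have "0 \<le> n \<bullet> ?h" using R(1) by (simp add: zero_le_mult_iff)
        then show ?thesis using m(2)[OF \<zeta>c] R(1) by (intro mult_left_mono mult_right_mono) auto
      qed
      also have "cmod (g \<zeta>) * (n \<bullet> ?h) = ?D ?h \<zeta>"
        using g0[OF \<zeta>U] gD[OF \<zeta>U] by (simp add: n_def)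
      finally have 1: "m * (cmod ?h)\<^sup>2 \<le> 2 * R * ?D ?h \<zeta>" .
      have "2 * R * (L * (cmod ?h)\<^sup>2) = 2 * L * R * (cmod ?h)\<^sup>2" by simp
      also have "\<dots> \<le> m * (cmod ?h)\<^sup>2" using R(3) by (intro mult_right_mono) auto
      also note 1
      finally have "L * (cmod ?h)\<^sup>2 \<le> ?D ?h \<zeta>" using R(1) by simp
      then have "0 \<le> \<rho> z" using taylor[OF zc \<zeta>c] \<rho>0 by linarith
      then show "z \<notin> D" using U(5) inU[OF zc] by force
    qed
    then have "exterior_disc D \<zeta> c R" using R(1) dc by (auto simp: exterior_disc_def)
    then show ?thesis by blast
  qed
  then show ?thesis using that[of "s / 2" R] s(1) R(1) by simp
qed

lemma regular_domain_of_smoothly_bounded: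
  assumes "smoothly_bounded_domain D"
  shows "regular_domain D"
proof
  show "open D" "bounded D" using assms by (auto simp: smoothly_bounded_domain_def)
  fix \<zeta> assume \<zeta>: "\<zeta> \<in> frontier D"
  obtain \<delta> R where "\<delta> > 0" "R > 0"
    "\<And>\<zeta>'. \<zeta>' \<in> frontier D \<Longrightarrow> dist \<zeta>' \<zeta> < \<delta> \<Longrightarrow> \<exists>c. exterior_disc D \<zeta>' c R"
    by (rule exterior_discs_near[OF assms \<zeta>]) (rule that)
  then show "\<exists>c R. exterior_disc D \<zeta> c R" using \<zeta> by (metis dist_self)
qed

section \<open>Growth of the capacity density at the boundary\<close>

text \<open>Comparison with the domain outside the disc: its Green's function with pole \<open>p\<close> is
  \<open>ln \<bar>(R\<^sup>2 - cnj (p - c) (z - c)) / (R (z - p))\<bar>\<close>.\<close>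

lemma (in regular_domain) robin_le:
  assumes e: "exterior_disc D \<zeta> c R" and p: "p \<in> D"
  shows "robin D p \<le> ln (dist p \<zeta> * (2 * R + dist p \<zeta>) / R)"
proof -
  have R: "R > 0" "dist c \<zeta> = R" "D \<inter> ball c R = {}" using e by (auto simp: exterior_disc_def)
  have clD: "closure D \<inter> ball c R = {}"
    using R(3) open_Int_closure_eq_empty[OF open_ball, of c R D] by blast
  have cl: "R \<le> cmod (z - c)" if "z \<in> closure D" for z
    using clD that by (force simp: dist_norm norm_minus_commute)
  \<comment> \<open>As \<open>D\<close> is open, a point of \<open>D\<close> on the circle would have points of \<open>D\<close> inside the disc nearby.\<close>
  have gt: "R < cmod (p - c)"
  proof (rule ccontr)
    assume "\<not> R < cmod (p - c)"
    obtain r where r: "r > 0" "cball p r \<subseteq> D" using open_D p open_contains_cball by blast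
    define q where "q = p - (min r (R / 2) / cmod (p - c)) *\<^sub>R (p - c)"
    have eqR: "cmod (p - c) = R" using \<open>\<not> R < cmod (p - c)\<close> cl[of p] p closure_subset[of D] by auto
    have "q - c = (1 - min r (R / 2) / R) *\<^sub>R (p - c)" by (simp add: q_def eqR algebra_simps)
    then have "cmod (q - c) = \<bar>1 - min r (R / 2) / R\<bar> * R" by (simp add: eqR)
    also have "\<dots> < R" using R(1) r(1) by (auto simp: min_def field_simps abs_less_iff)
    finally have qR: "cmod (q - c) < R" .
    have "dist p q \<le> r" using R(1) r(1) by (simp add: q_def eqR dist_norm)
    then have "q \<in> D" using r(2) by auto
    then have "R \<le> cmod (q - c)" by (intro cl subsetD[OF closure_subset])
    then show False using qR by simp
  qed
  define f where "f z = of_real (R\<^sup>2) - cnj (p - c) * (z - c)" for z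
  have nz: "f z \<noteq> 0" if "z \<in> closure D" for z
  proof
    assume "f z = 0"
    then have "cmod (cnj (p - c) * (z - c)) = cmod (of_real (R\<^sup>2))" by (simp add: f_def)
    then have "cmod (p - c) * cmod (z - c) = R\<^sup>2"
      unfolding norm_mult complex_mod_cnj norm_of_real by simp
    moreover have "R * R < cmod (p - c) * cmod (z - c)"
      using gt cl[OF that] R(1) by (intro mult_less_le_imp_less) auto
    ultimately show False by (simp add: power2_eq_square)
  qed
  have D_cl: "z \<in> closure D" if "z \<in> D" for z using subsetD[OF closure_subset that] .
  define W where "W z = ln (cmod (f z)) - ln R" for z
  have fh: "f holomorphic_on D" unfolding f_def by (intro holomorphic_intros)
  have W: "re_hol W D" unfolding W_def
    by (intro re_hol_diff re_hol_const open_D re_hol_ln_cmod fh nz D_cl)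
  have bd: "ln (cmod (z - p)) \<le> W z" if z: "z \<in> frontier D" for z
  proof -
    have zc: "z \<in> closure D" using z by (simp add: frontier_def)
    have zp: "z \<noteq> p" using frontier_not_in_D[OF z] p by blast
    have id: "(cmod (f z))\<^sup>2 - (R * cmod (z - p))\<^sup>2 = ((cmod (p - c))\<^sup>2 - R\<^sup>2) * ((cmod (z - c))\<^sup>2 - R\<^sup>2)"
      unfolding f_def power_mult_distrib cmod_power2 by (simp add: algebra_simps power2_eq_square)
    have "R\<^sup>2 \<le> (cmod (p - c))\<^sup>2" "R\<^sup>2 \<le> (cmod (z - c))\<^sup>2"
      using gt cl[OF zc] R(1) by (auto intro!: power_mono)
    then have "0 \<le> ((cmod (p - c))\<^sup>2 - R\<^sup>2) * ((cmod (z - c))\<^sup>2 - R\<^sup>2)" by simp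
    then have "(R * cmod (z - p))\<^sup>2 \<le> (cmod (f z))\<^sup>2" using id by linarith
    then have "R * cmod (z - p) \<le> cmod (f z)" by (rule power2_le_imp_le) simp
    then have "ln (R * cmod (z - p)) \<le> ln (cmod (f z))" using R(1) zp by (intro ln_mono) auto
    then show ?thesis using R(1) zp by (simp add: W_def ln_mult)
  qed
  have "regular_part p p - W p \<le> 0"
  proof (rule re_hol_le_boundary[OF re_hol_diff[OF re_hol_regular_part[OF p] W] bounded_D p])
    fix z assume z: "z \<in> frontier D"
    have zc: "z \<in> closure D" using z by (simp add: frontier_def)
    have "(W \<longlongrightarrow> W z) (at z within D)" unfolding W_def f_def
      using nz[OF zc] unfolding f_def by (intro tendsto_intros) auto
    then show "((\<lambda>z. regular_part p z - W z) \<longlongrightarrow> ln (cmod (z - p)) - W z) (at z within D)"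
      by (intro tendsto_diff regular_part_boundary p z)
    show "ln (cmod (z - p)) - W z \<le> 0" using bd[OF z] by simp
  qed
  then have "robin D p \<le> W p" by (simp add: robin_eq[OF p])
  also have "W p = ln (((cmod (p - c))\<^sup>2 - R\<^sup>2) / R)"
  proof -
    have "f p = of_real (R\<^sup>2 - (cmod (p - c))\<^sup>2)"
      unfolding f_def of_real_diff complex_norm_square by (simp add: mult.commute)
    then have "cmod (f p) = \<bar>R\<^sup>2 - (cmod (p - c))\<^sup>2\<bar>" by (simp only: norm_of_real)
    moreover have "R\<^sup>2 < (cmod (p - c))\<^sup>2" using gt R(1) by (intro power_strict_mono) auto
    ultimately have eq: "(cmod (p - c))\<^sup>2 - R\<^sup>2 = cmod (f p)" and "cmod (f p) \<noteq> 0" by simp_all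
    then show ?thesis unfolding W_def eq using R(1) by (simp add: ln_div)
  qed
  also have "\<dots> \<le> ln (dist p \<zeta> * (2 * R + dist p \<zeta>) / R)"
  proof (rule ln_mono)
    have sq: "(cmod (p - c))\<^sup>2 - R\<^sup>2 = (cmod (p - c) - R) * (cmod (p - c) + R)"
      by (simp add: power2_eq_square algebra_simps)
    show "0 < ((cmod (p - c))\<^sup>2 - R\<^sup>2) / R" unfolding sq using gt R(1) by simp
    have "cmod (p - c) \<le> dist p \<zeta> + R"
      using dist_triangle[of p c \<zeta>] R(2) by (simp add: dist_norm norm_minus_commute)
    then have "(cmod (p - c) - R) * (cmod (p - c) + R) \<le> dist p \<zeta> * (2 * R + dist p \<zeta>)"
      using gt R(1) by (intro mult_mono) auto
    then show "((cmod (p - c))\<^sup>2 - R\<^sup>2) / R \<le> dist p \<zeta> * (2 * R + dist p \<zeta>) / R"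
      unfolding sq using R(1) by (simp add: divide_right_mono)
  qed
  finally show ?thesis .
qed

lemma capacity_density_pos: "0 < capacity_density D z"
  by (simp add: capacity_density_def)

lemma nearest_boundary_point:
  fixes D :: "complex set"
  assumes D: "open D" "bounded D" and w: "w \<in> D"
  obtains \<zeta> where "\<zeta> \<in> frontier D" "dist w \<zeta> = infdist w (- D)" "0 < infdist w (- D)"
    "ball w (infdist w (- D)) \<subseteq> D"
proof -
  have cl: "closed (- D)" using D(1) by (rule closed_Compl)
  have ne: "- D \<noteq> {}"
  proof
    assume "- D = {}"
    then have "D = UNIV" by auto
    then show False using D(2) not_bounded_UNIV by metis
  qed
  obtain \<zeta> where \<zeta>: "\<zeta> \<in> - D" "infdist w (- D) = dist w \<zeta>"
    using infdist_attains_inf[OF cl ne] by blast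
  have pos: "0 < infdist w (- D)" using \<zeta> w by auto
  have sub: "ball w (infdist w (- D)) \<subseteq> D"
  proof
    fix x assume x: "x \<in> ball w (infdist w (- D))"
    show "x \<in> D"
    proof (rule ccontr)
      assume "x \<notin> D"
      then have "infdist w (- D) \<le> dist w x" by (intro infdist_le) simp
      then show False using x by simp
    qed
  qed
  have "closure (ball w (infdist w (- D))) \<subseteq> closure D" using sub by (rule closure_mono)
  moreover have "\<zeta> \<in> closure (ball w (infdist w (- D)))" using pos \<zeta>(2) by simp
  ultimately have "\<zeta> \<in> frontier D" using \<zeta>(1) D(1) by (auto simp: frontier_def interior_open)
  then show ?thesis using that \<zeta>(2) pos sub by simp
qed

text \<open>The bound on the Robin constant is applied at the nearest boundary point.\<close>

lemma capacity_density_lower_bound: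
  assumes D: "smoothly_bounded_domain D" and \<zeta>0: "\<zeta>0 \<in> frontier D"
  obtains \<delta> \<kappa> where "\<delta> > 0" "\<kappa> > 0"
    "\<And>w. w \<in> D \<Longrightarrow> dist w \<zeta>0 < \<delta> \<Longrightarrow> \<kappa> \<le> capacity_density D w * infdist w (- D)"
proof -
  interpret regular_domain D using D by (rule regular_domain_of_smoothly_bounded)
  obtain \<delta> R where \<delta>: "\<delta> > 0" "R > 0"
    "\<And>\<zeta>. \<zeta> \<in> frontier D \<Longrightarrow> dist \<zeta> \<zeta>0 < \<delta> \<Longrightarrow> \<exists>c. exterior_disc D \<zeta> c R"
    by (rule exterior_discs_near[OF D \<zeta>0]) (rule that)
  have "R / (2 * R + \<delta>) \<le> capacity_density D w * infdist w (- D)"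
    if w: "w \<in> D" "dist w \<zeta>0 < \<delta> / 2" for w
  proof -
    obtain \<zeta> where \<zeta>: "\<zeta> \<in> frontier D" "dist w \<zeta> = infdist w (- D)" "0 < infdist w (- D)"
      by (rule nearest_boundary_point[OF open_D bounded_D w(1)]) (rule that)
    have "infdist w (- D) \<le> dist w \<zeta>0" using frontier_not_in_D[OF \<zeta>0] by (intro infdist_le) simp
    then have d: "dist w \<zeta> < \<delta> / 2" using w(2) \<zeta>(2) by simp
    then have "dist \<zeta> \<zeta>0 < \<delta>" using dist_triangle[of \<zeta> \<zeta>0 w] w(2) by (simp add: dist_commute)
    then obtain c where "exterior_disc D \<zeta> c R" using \<delta>(3)[OF \<zeta>(1)] by blast
    from robin_le[OF this w(1)]
    have le: "robin D w \<le> ln (dist w \<zeta> * (2 * R + dist w \<zeta>) / R)" .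
    have pos: "0 < dist w \<zeta>" using \<zeta> by simp
    then have arg: "0 < dist w \<zeta> * (2 * R + dist w \<zeta>) / R"
      using \<delta>(2) by (intro divide_pos_pos mult_pos_pos add_pos_pos) auto
    have "R / (2 * R + \<delta>) \<le> R / (2 * R + dist w \<zeta>)"
      by (intro divide_left_mono mult_pos_pos) (use d \<delta>(1,2) pos in linarith)+
    also have "\<dots> = inverse (dist w \<zeta> * (2 * R + dist w \<zeta>) / R) * dist w \<zeta>"
    proof -
      have "R / y = inverse (x * y / R) * x" if "x > 0" "y > 0" for x y
        using that \<delta>(2) by (simp add: field_simps)
      then show ?thesis using pos \<delta>(2) by (simp add: add_pos_pos)
    qed
    also have "inverse (dist w \<zeta> * (2 * R + dist w \<zeta>) / R)
        = exp (- ln (dist w \<zeta> * (2 * R + dist w \<zeta>) / R))"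
      using arg by (simp add: exp_minus)
    also have "\<dots> * dist w \<zeta> \<le> capacity_density D w * dist w \<zeta>"
      unfolding capacity_density_def using le by (intro mult_right_mono) auto
    finally show ?thesis by (simp add: \<zeta>(2))
  qed
  moreover have "R / (2 * R + \<delta>) > 0" "\<delta> / 2 > 0" using \<delta>(1,2) by auto
  ultimately show ?thesis using that by blast
qed

section \<open>Square integrable harmonic functions vanish\<close>

text \<open>A substitute for the area mean value inequality. At a maximum point \<open>y\<close> of
  \<open>(r - dist z w) * \<bar>u w\<bar>\<close> the value \<open>U = \<bar>u y\<bar>\<close> bounds \<open>\<bar>u\<bar>\<close> by \<open>2 U\<close> on a disc around \<open>y\<close> whose
  radius is half the distance of \<open>y\<close> to the boundary of the large disc, and Harnack's inequality
  for \<open>2 U - u\<close> or \<open>2 U + u\<close> gives \<open>\<bar>u\<bar> \<ge> U / 2\<close> on a fifth of it.\<close>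

lemma re_hol_large_on_disc:
  assumes u: "re_hol u S" and r: "r > 0" "cball z r \<subseteq> S"
  obtains y s where "s > 0" "cball y s \<subseteq> cball z r"
    "\<And>w. w \<in> cball y s \<Longrightarrow> r * \<bar>u z\<bar> \<le> 20 * s * \<bar>u w\<bar>"
proof (cases "u z = 0")
  case True
  then show ?thesis using that[of r z] r by simp
next
  case False
  define \<phi> where "\<phi> w = (r - dist z w) * \<bar>u w\<bar>" for w
  have uc: "continuous_on (cball z r) u"
    using re_hol_imp_continuous_on[OF u] r(2) by (rule continuous_on_subset)
  have zc: "z \<in> cball z r" using r(1) by simp
  then have ne: "cball z r \<noteq> {}" by blast
  have "continuous_on (cball z r) \<phi>" unfolding \<phi>_def by (intro continuous_intros uc)
  then have "\<exists>y\<in>cball z r. \<forall>w\<in>cball z r. \<phi> w \<le> \<phi> y"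
    by (rule continuous_attains_sup[OF compact_cball ne])
  then obtain y where y: "y \<in> cball z r" "\<And>w. w \<in> cball z r \<Longrightarrow> \<phi> w \<le> \<phi> y" by blast
  define U where "U = \<bar>u y\<bar>"
  define t where "t = (r - dist z y) / 2"
  have "2 * t = r - dist z y" by (simp add: t_def)
  then have z_le: "r * \<bar>u z\<bar> \<le> 2 * t * U" using y(2)[OF zc] by (simp add: \<phi>_def U_def)
  moreover have "0 < r * \<bar>u z\<bar>" using r(1) False by simp
  ultimately have "0 < t * U" by simp
  moreover have "0 \<le> U" "0 \<le> t" using y(1) by (simp_all add: U_def t_def)
  ultimately have U: "0 < U" and t: "0 < t" by (simp_all add: zero_less_mult_iff)
  have sub: "cball y t \<subseteq> cball z r"
  proof
    fix w assume "w \<in> cball y t"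
    then have "dist z w \<le> dist z y + t" using dist_triangle[of z w y] by simp
    also have "\<dots> \<le> r" using t by (simp add: t_def field_simps)
    finally show "w \<in> cball z r" by simp
  qed
  have tS: "cball y t \<subseteq> S" using sub r(2) by (rule order_trans)
  have bound: "\<bar>u w\<bar> \<le> 2 * U" if w: "w \<in> cball y t" for w
  proof -
    have "t \<le> r - dist z w" using w dist_triangle[of z w y] by (simp add: t_def)
    then have "t * \<bar>u w\<bar> \<le> \<phi> w" unfolding \<phi>_def by (rule mult_right_mono) simp
    also have "\<dots> \<le> \<phi> y" using w sub by (intro y(2)) blast
    also have "\<dots> = t * (2 * U)" by (simp add: \<phi>_def t_def U_def)
    finally show ?thesis using t by simp
  qed
  define \<sigma> where "\<sigma> = sgn (u y)"
  have \<sigma>: "\<bar>\<sigma>\<bar> = 1" "\<sigma> * u y = U" using U by (auto simp: \<sigma>_def U_def abs_sgn sgn_real_def)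
  define h where "h w = 2 * U - \<sigma> * u w" for w
  have h: "re_hol h S" unfolding h_def
    by (intro re_hol_diff re_hol_cmult u re_hol_const re_hol_open[OF u])
  have hc: "continuous_on (sphere y t) h"
    using re_hol_imp_continuous_on[OF h] order_trans[OF sphere_cball tS] by (rule continuous_on_subset)
  have su: "\<bar>\<sigma> * u w\<bar> = \<bar>u w\<bar>" for w using \<sigma>(1) by (simp add: abs_mult)
  have h0: "0 \<le> h w" if "w \<in> sphere y t" for w
  proof -
    have "\<bar>u w\<bar> \<le> 2 * U" using that by (intro bound) auto
    then show ?thesis using su[of w] unfolding h_def by linarith
  qed
  have "r * \<bar>u z\<bar> \<le> 20 * (t / 5) * \<bar>u w\<bar>" if w: "w \<in> cball y (t / 5)" for w
  proof -
    have wb: "w \<in> ball y t" using w t by simp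
    have d: "(t + dist y w) / (t - dist y w) \<le> 3 / 2"
    proof -
      have "dist y w \<le> t / 5" using w by simp
      then show ?thesis using t by (simp add: divide_le_eq)
    qed
    have "h w \<le> (t + dist y w) / (t - dist y w) * h y"
      using harnack[OF hc h0 wb] unfolding poisson_mod_eq_of_re_hol[OF h tS t] .
    also have "h y = U" using \<sigma>(2) by (simp add: h_def)
    also have "(t + dist y w) / (t - dist y w) * U \<le> 3 / 2 * U" using d U by (intro mult_right_mono) auto
    finally have "U / 2 \<le> \<sigma> * u w" by (simp add: h_def)
    then have "U / 2 \<le> \<bar>u w\<bar>" using su[of w] by linarith
    then have "4 * t * (U / 2) \<le> 4 * t * \<bar>u w\<bar>" using t by (intro mult_left_mono) auto
    moreover have "4 * t * (U / 2) = 2 * t * U" "20 * (t / 5) * \<bar>u w\<bar> = 4 * t * \<bar>u w\<bar>" by simp_all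
    ultimately show ?thesis using z_le by linarith
  qed
  moreover have "cball y (t / 5) \<subseteq> cball z r"
  proof -
    have "cball y (t / 5) \<subseteq> cball y t" using t by (intro subset_cball) simp
    then show ?thesis using sub by (rule order_trans)
  qed
  moreover have "t / 5 > 0" using t by simp
  ultimately show ?thesis using that by blast
qed

text \<open>Let \<open>d\<close> be the distance of \<open>z\<close> to the boundary. Near a boundary point the density is at
  least a multiple of \<open>1 / d\<close> on the disc of radius \<open>d / 2\<close> about \<open>z\<close>. This disc contains one of some
  radius \<open>s\<close> on which \<open>\<bar>u\<bar>\<close> is at least a multiple of \<open>\<bar>u z\<bar> d / s\<close>, so \<open>u\<^sup>2 c\<^sup>2\<close> is at least a
  multiple of \<open>(u z)\<^sup>2 / s\<^sup>2\<close> there and its integral at least one of \<open>(u z)\<^sup>2\<close>. The integral tends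
  to \<open>0\<close> because the discs shrink to the boundary point.\<close>

lemma re_hol_square_integrable_tendsto_0:
  assumes D: "smoothly_bounded_domain D" and u: "re_hol u D"
    and F: "set_integrable lborel D F" "\<And>z. z \<in> D \<Longrightarrow> (u z)\<^sup>2 * (capacity_density D z)\<^sup>2 \<le> F z"
    and \<zeta>: "\<zeta> \<in> frontier D"
  shows "(u \<longlongrightarrow> 0) (at \<zeta> within D)"
proof -
  have oD: "open D" "bounded D" using D by (auto simp: smoothly_bounded_domain_def)
  have \<zeta>D: "\<zeta> \<notin> D" using \<zeta> oD(1) by (simp add: frontier_def interior_open)
  obtain \<delta> \<kappa> where \<delta>: "\<delta> > 0" "\<kappa> > 0"
    "\<And>w. w \<in> D \<Longrightarrow> dist w \<zeta> < \<delta> \<Longrightarrow> \<kappa> \<le> capacity_density D w * infdist w (- D)"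
    by (rule capacity_density_lower_bound[OF D \<zeta>]) (rule that)
  define G where "G w = indicator D w * F w" for w
  have G: "integrable lborel G" using F(1) unfolding set_integrable_def G_def by simp
  have G0: "0 \<le> G w" for w
  proof (cases "w \<in> D")
    case True
    have "0 \<le> (u w)\<^sup>2 * (capacity_density D w)\<^sup>2" by simp
    also have "\<dots> \<le> F w" using True by (rule F(2))
    finally show ?thesis by (simp add: G_def)
  qed (simp add: G_def)
  define I where "I z = (\<integral>w. G w * indicator (cball \<zeta> (2 * dist z \<zeta>)) w \<partial>lborel)" for z
  \<comment> \<open>\<open>6400 = 80\<^sup>2\<close>, where the factor \<open>80\<close> consists of the \<open>20\<close> of \<open>re_hol_large_on_disc\<close>, a factor \<open>2\<close>
    for the radius \<open>d / 2\<close>, and a factor \<open>2\<close> for the distance of \<open>w\<close> to the boundary, which is at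
    most \<open>2 d\<close>.\<close>
  define K where "K = \<kappa>\<^sup>2 * unit_ball_vol (real DIM(complex)) / 6400"
  have K: "K > 0" using \<delta>(2) by (simp add: K_def)
  have le: "K * (u z)\<^sup>2 \<le> I z" if z: "z \<in> D" "dist z \<zeta> < \<delta> / 2" for z
  proof -
    define d where "d = infdist z (- D)"
    have d: "d > 0" "ball z d \<subseteq> D"
      unfolding d_def by (rule nearest_boundary_point[OF oD z(1)], simp)+
    have d\<zeta>: "d \<le> dist z \<zeta>" unfolding d_def using \<zeta>D by (intro infdist_le) simp
    have cb: "cball z (d / 2) \<subseteq> D"
      using d by (intro order_trans[OF _ d(2)]) auto
    have d2: "d / 2 > 0" using d(1) by simp
    obtain y s where s: "s > 0" "cball y s \<subseteq> cball z (d / 2)"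
      "\<And>w. w \<in> cball y s \<Longrightarrow> d / 2 * \<bar>u z\<bar> \<le> 20 * s * \<bar>u w\<bar>"
      by (rule re_hol_large_on_disc[OF u d2 cb]) (rule that)
    have near: "dist w \<zeta> \<le> 2 * dist z \<zeta>" if "w \<in> cball y s" for w
    proof -
      have "w \<in> cball z (d / 2)" using s(2) that by blast
      then have "dist z w \<le> d / 2" by simp
      then show ?thesis using dist_triangle[of w \<zeta> z] d\<zeta> d(1) by (simp add: dist_commute)
    qed
    have Gw: "\<kappa>\<^sup>2 * (u z)\<^sup>2 / (6400 * s\<^sup>2) \<le> G w" if w: "w \<in> cball y s" for w
    proof -
      have "w \<in> cball z (d / 2)" using s(2) w by blast
      then have wz: "dist w z \<le> d / 2" by (simp add: dist_commute)
      have wD: "w \<in> D" using s(2) w cb by blast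
      have c0: "0 < capacity_density D w" by (rule capacity_density_pos)
      have "infdist w (- D) \<le> d + dist w z" unfolding d_def by (rule infdist_triangle)
      then have dw: "infdist w (- D) \<le> 2 * d" using wz d(1) by simp
      have "dist w \<zeta> < \<delta>" using near[OF w] z(2) by simp
      then have "\<kappa> \<le> capacity_density D w * infdist w (- D)" by (rule \<delta>(3)[OF wD])
      also have "\<dots> \<le> capacity_density D w * (2 * d)" using dw c0 by (intro mult_left_mono) auto
      finally have k: "\<kappa> \<le> capacity_density D w * (2 * d)" .
      have "d * \<bar>u z\<bar> \<le> 40 * s * \<bar>u w\<bar>" using s(3)[OF w] by simp
      from mult_mono[OF k this]
      have "\<kappa> * (d * \<bar>u z\<bar>) \<le> (capacity_density D w * (2 * d)) * (40 * s * \<bar>u w\<bar>)"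
        using d(1) c0 by simp
      then have "d * (\<kappa> * \<bar>u z\<bar>) \<le> d * (80 * s * (\<bar>u w\<bar> * capacity_density D w))"
        by (simp add: mult_ac)
      then have "\<kappa> * \<bar>u z\<bar> \<le> 80 * s * (\<bar>u w\<bar> * capacity_density D w)"
        using d(1) by simp
      then have "(\<kappa> * \<bar>u z\<bar>)\<^sup>2 \<le> (80 * s * (\<bar>u w\<bar> * capacity_density D w))\<^sup>2"
        using \<delta>(2) by (intro power_mono) auto
      then have "\<kappa>\<^sup>2 * (u z)\<^sup>2 \<le> 6400 * s\<^sup>2 * ((u w)\<^sup>2 * (capacity_density D w)\<^sup>2)"
        by (simp add: power_mult_distrib)
      also have "\<dots> \<le> 6400 * s\<^sup>2 * G w"
        using F(2)[OF wD] wD by (intro mult_left_mono) (auto simp: G_def)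
      finally show ?thesis using s(1) by (simp add: divide_le_eq mult.commute)
    qed
    define C where "C = \<kappa>\<^sup>2 * (u z)\<^sup>2 / (6400 * s\<^sup>2)"
    have m: "measure lborel (cball y s) = unit_ball_vol (real DIM(complex)) * s\<^sup>2"
      using content_cball[of s y] s(1) by simp
    have "C * measure lborel (cball y s) = (\<integral>w. C * indicator (cball y s) w \<partial>lborel)"
      by simp
    also have "\<dots> \<le> I z" unfolding I_def
    proof (rule integral_mono)
      have "emeasure lborel (cball y s) < \<infinity>"
        using emeasure_compact_finite[OF compact_cball, of y s] by simp
      then show "integrable lborel (\<lambda>w. C * indicator (cball y s) w)"
        by (intro integrable_mult_right integrable_real_indicator) auto
      show "integrable lborel (\<lambda>w. G w * indicator (cball \<zeta> (2 * dist z \<zeta>)) w)"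
        by (rule integrable_real_mult_indicator[OF _ G]) simp
      show "C * indicator (cball y s) w \<le> G w * indicator (cball \<zeta> (2 * dist z \<zeta>)) w" for w
      proof (cases "w \<in> cball y s")
        case True
        then have "w \<in> cball \<zeta> (2 * dist z \<zeta>)" using near[OF True] by (simp add: dist_commute)
        then show ?thesis using Gw[OF True] True by (simp add: C_def)
      qed (simp add: G0)
    qed
    finally show ?thesis unfolding m C_def K_def using s(1) by (simp add: mult_ac)
  qed
  have "(I \<longlongrightarrow> 0) (at \<zeta> within D)"
    unfolding tendsto_at_iff_sequentially o_def
  proof (intro allI impI)
    fix X assume X: "\<forall>i. X i \<in> D - {\<zeta>}" "X \<longlonglongrightarrow> \<zeta>"
    have "(\<lambda>i. I (X i)) \<longlonglongrightarrow> (\<integral>w. 0 \<partial>(lborel :: complex measure))" unfolding I_def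
    proof (rule integral_dominated_convergence[where w = G])
      show "(\<lambda>w. G w * indicator (cball \<zeta> (2 * dist (X i) \<zeta>)) w) \<in> borel_measurable lborel" for i
        using integrable_real_mult_indicator[OF _ G, of "cball \<zeta> (2 * dist (X i) \<zeta>)"]
        by (intro borel_measurable_integrable) simp
      show "AE w in lborel. norm (G w * indicator (cball \<zeta> (2 * dist (X i) \<zeta>)) w) \<le> G w" for i
        using G0 by (intro AE_I2) (auto simp: indicator_def)
      show "AE w in lborel. (\<lambda>i. G w * indicator (cball \<zeta> (2 * dist (X i) \<zeta>)) w) \<longlonglongrightarrow> 0"
      proof (intro AE_I2)
        fix w
        show "(\<lambda>i. G w * indicator (cball \<zeta> (2 * dist (X i) \<zeta>)) w) \<longlonglongrightarrow> 0"
        proof (cases "w = \<zeta>")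
          case True
          then show ?thesis using \<zeta>D by (simp add: G_def)
        next
          case False
          have "(\<lambda>i. 2 * dist (X i) \<zeta>) \<longlonglongrightarrow> 2 * dist \<zeta> \<zeta>" by (intro tendsto_intros X(2))
          then have "\<forall>\<^sub>F i in sequentially. 2 * dist (X i) \<zeta> < dist \<zeta> w"
            by (rule order_tendstoD(2)) (use False in simp)
          then have "\<forall>\<^sub>F i in sequentially. G w * indicator (cball \<zeta> (2 * dist (X i) \<zeta>)) w = 0"
            by eventually_elim simp
          then show ?thesis by (rule tendsto_eventually)
        qed
      qed
    qed (simp_all add: G)
    then show "(\<lambda>i. I (X i)) \<longlonglongrightarrow> 0" by simp
  qed
  then have "((\<lambda>z. I z / K) \<longlongrightarrow> 0 / K) (at \<zeta> within D)"
    using K by (intro tendsto_divide tendsto_const) auto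
  then have IK: "((\<lambda>z. I z / K) \<longlongrightarrow> 0) (at \<zeta> within D)" by simp
  have "((\<lambda>z. (u z)\<^sup>2) \<longlongrightarrow> 0) (at \<zeta> within D)"
  proof (rule Lim_null_comparison[OF _ IK])
    have "\<forall>\<^sub>F z in at \<zeta> within D. dist z \<zeta> < \<delta> / 2"
      using \<delta>(1) by (auto simp: eventually_at intro!: exI[of _ "\<delta> / 2"])
    moreover have "\<forall>\<^sub>F z in at \<zeta> within D. z \<in> D" by (simp add: eventually_at_filter)
    ultimately show "\<forall>\<^sub>F z in at \<zeta> within D. norm ((u z)\<^sup>2) \<le> I z / K"
    proof eventually_elim
      case (elim z)
      then show ?case using le[OF elim(2,1)] K by (simp add: pos_le_divide_eq mult.commute)
    qed
  qed
  from tendsto_real_sqrt[OF this] show ?thesis by (simp add: tendsto_rabs_zero_iff)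
qed

lemma re_hol_square_integrable_eq_0:
  assumes D: "smoothly_bounded_domain D" and u: "re_hol u D"
    and F: "set_integrable lborel D F" "\<And>z. z \<in> D \<Longrightarrow> (u z)\<^sup>2 * (capacity_density D z)\<^sup>2 \<le> F z"
    and z: "z \<in> D"
  shows "u z = 0"
proof -
  have bD: "bounded D" using D by (simp add: smoothly_bounded_domain_def)
  have lim: "(u \<longlongrightarrow> 0) (at \<zeta> within D)" if "\<zeta> \<in> frontier D" for \<zeta>
    using F that by (intro re_hol_square_integrable_tendsto_0[OF D u])
  have "u z \<le> 0" by (rule re_hol_le_boundary[OF u bD z lim]) auto
  moreover have "- u z \<le> 0"
  proof (rule re_hol_le_boundary[OF _ bD z])
    show "re_hol (\<lambda>z. - u z) D" using re_hol_cmult[OF u, of "-1"] by simp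
    show "((\<lambda>z. - u z) \<longlongrightarrow> - 0) (at \<zeta> within D)" if "\<zeta> \<in> frontier D" for \<zeta>
      using lim[OF that] by (rule tendsto_minus)
  qed simp
  ultimately show ?thesis by simp
qed

section \<open>Harmonic functions and the form Laplacian\<close>

lemma pderiv_has_derivative:
  assumes "(f has_derivative f') (at z)"
  shows "pderiv_x f z = f' 1" "pderiv_y f z = f' \<i>"
  using frechet_derivative_at[OF assms] by (simp_all add: pderiv_x_def pderiv_y_def)

lemma pderiv_cong_open:
  assumes "open S" "z \<in> S" "\<And>w. w \<in> S \<Longrightarrow> f w = g w"
  shows "pderiv_x f z = pderiv_x g z" "pderiv_y f z = pderiv_y g z"
  using frechet_derivative_cong_open[OF assms] by (simp_all add: pderiv_x_def pderiv_y_def)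

lemma pderiv_linear:
  assumes "bounded_linear T" "f differentiable at z"
  shows "pderiv_x (\<lambda>w. T (f w)) z = T (pderiv_x f z)" "pderiv_y (\<lambda>w. T (f w)) z = T (pderiv_y f z)"
  using pderiv_has_derivative[OF bounded_linear.has_derivative[OF assms(1)
        iffD1[OF frechet_derivative_works assms(2)]]]
  by (simp_all add: pderiv_x_def pderiv_y_def)

lemma Ck_on_2_pderiv:
  assumes "Ck_on 2 f S" "open S" "z \<in> S"
  shows "f differentiable at z" "pderiv_x f differentiable at z" "pderiv_y f differentiable at z"
proof -
  have C: "Ck_on (Suc (Suc 0)) f S" using assms(1) by (simp add: numeral_2_eq_2 del: Ck_on.simps)
  show "f differentiable at z" using Ck_on_SucD(1)[OF C assms(2,3)] by (rule differentiableI)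
  show "pderiv_x f differentiable at z" "pderiv_y f differentiable at z"
    unfolding pderiv_x_def[abs_def] pderiv_y_def[abs_def]
    using Ck_on_SucD(1)[OF Ck_on_SucD(2)[OF C assms(2)] assms(2,3)] differentiableI by blast+
qed

lemma re_hol_linear_of_laplace:
  fixes f :: "complex \<Rightarrow> complex" and T :: "complex \<Rightarrow> real"
  assumes D: "open D" and f: "Ck_on 2 f D" and T: "bounded_linear T"
    and lap: "\<And>z. z \<in> D \<Longrightarrow> pderiv_x (pderiv_x f) z + pderiv_y (pderiv_y f) z = 0"
  shows "re_hol (\<lambda>z. T (f z)) D"
proof (rule harmonic_on_imp_re_hol[OF _ D], unfold harmonic_on_def, intro conjI ballI)
  show "Ck_on 2 (\<lambda>z. T (f z)) D" by (rule Ck_on_bounded_linear[OF D T f])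
  fix z assume z: "z \<in> D"
  note d = Ck_on_2_pderiv[OF f D]
  have "pderiv_x (pderiv_x (\<lambda>z. T (f z))) z = pderiv_x (\<lambda>z. T (pderiv_x f z)) z"
    "pderiv_y (pderiv_y (\<lambda>z. T (f z))) z = pderiv_y (\<lambda>z. T (pderiv_y f z)) z"
    by (rule pderiv_cong_open[OF D z], rule pderiv_linear[OF T d(1)], assumption)+
  then show "pderiv_x (pderiv_x (\<lambda>z. T (f z))) z + pderiv_y (pderiv_y (\<lambda>z. T (f z))) z = 0"
    using pderiv_linear(1)[OF T d(2)[OF z]] pderiv_linear(2)[OF T d(3)[OF z]] lap[OF z]
      linear_add[OF bounded_linear.linear[OF T]] linear_0[OF bounded_linear.linear[OF T]]
    by metis
qed

text \<open>The mixed second derivatives occur with the same coefficients in both terms and cancel.\<close>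

lemma wirtinger_laplacian:
  assumes f: "pderiv_x f differentiable at z" "pderiv_y f differentiable at z"
  shows "wirt_z (\<lambda>z. k * wirt_zbar f z) z - wirt_zbar (\<lambda>z. - k * wirt_z f z) z
    = k / 2 * (pderiv_x (pderiv_x f) z + pderiv_y (pderiv_y f) z)"
proof -
  let ?a = "frechet_derivative (pderiv_x f) (at z)" and ?b = "frechet_derivative (pderiv_y f) (at z)"
  have d: "(pderiv_x f has_derivative ?a) (at z)" "(pderiv_y f has_derivative ?b) (at z)"
    using f by (simp_all flip: frechet_derivative_works)
  have 1: "((\<lambda>z. k * wirt_zbar f z) has_derivative (\<lambda>v. k * ((?a v + \<i> * ?b v) / 2))) (at z)"
    unfolding wirt_zbar_def
    by (intro bounded_linear.has_derivative[OF bounded_linear_mult_right]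
        bounded_linear.has_derivative[OF bounded_linear_divide] has_derivative_add d)
  have 2: "((\<lambda>z. - k * wirt_z f z) has_derivative (\<lambda>v. - k * ((?a v - \<i> * ?b v) / 2))) (at z)"
    unfolding wirt_z_def
    by (intro bounded_linear.has_derivative[OF bounded_linear_mult_right]
        bounded_linear.has_derivative[OF bounded_linear_divide] has_derivative_diff d)
  show ?thesis
    unfolding wirt_z_def[of "\<lambda>z. k * wirt_zbar f z"] wirt_zbar_def[of "\<lambda>z. - k * wirt_z f z"]
      pderiv_has_derivative[OF 1] pderiv_has_derivative[OF 2]
    unfolding pderiv_x_def[of "pderiv_x f"] pderiv_y_def[of "pderiv_y f"]
    by (simp add: field_simps)
qed

lemma ext_d_components:
  "ext_d \<omega> 0 0 = (\<lambda>z. 0)"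
  "ext_d \<omega> 1 0 = wirt_z (\<omega> 0 0)"
  "ext_d \<omega> 0 1 = wirt_zbar (\<omega> 0 0)"
  "ext_d \<omega> 1 1 = (\<lambda>z. wirt_z (\<omega> 0 1) z - wirt_zbar (\<omega> 1 0) z)"
  by (simp_all add: fun_eq_iff ext_d_def)

lemma hodge_star_components:
  "hodge_star c \<omega> 0 0 = (\<lambda>z. - 2 * \<i> / of_real ((c z)\<^sup>2) * \<omega> 1 1 z)"
  "hodge_star c \<omega> 1 0 = (\<lambda>z. - \<i> * \<omega> 1 0 z)"
  "hodge_star c \<omega> 0 1 = (\<lambda>z. \<i> * \<omega> 0 1 z)"
  "hodge_star c \<omega> 1 1 = (\<lambda>z. \<i> / 2 * of_real ((c z)\<^sup>2) * \<omega> 0 0 z)"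
  by (simp_all add: fun_eq_iff hodge_star_def)

lemma laplacian_00:
  "laplacian c \<omega> 0 0 z = 2 * \<i> / of_real ((c z)\<^sup>2) *
    (wirt_z (\<lambda>z. \<i> * wirt_zbar (\<omega> 0 0) z) z - wirt_zbar (\<lambda>z. - \<i> * wirt_z (\<omega> 0 0) z) z)"
  unfolding laplacian_def codiff_def plus_fun_apply uminus_apply
    ext_d_components hodge_star_components by simp

lemma laplacian_11:
  "laplacian c \<omega> 1 1 z = wirt_z (\<lambda>z. - \<i> * wirt_zbar (hodge_star c \<omega> 0 0) z) z
    - wirt_zbar (\<lambda>z. - (- \<i>) * wirt_z (hodge_star c \<omega> 0 0) z) z"
proof -
  have "codiff c \<omega> 0 1 = (\<lambda>z. - \<i> * wirt_zbar (hodge_star c \<omega> 0 0) z)"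
    "codiff c \<omega> 1 0 = (\<lambda>z. - (- \<i>) * wirt_z (hodge_star c \<omega> 0 0) z)"
    by (simp_all add: fun_eq_iff codiff_def hodge_star_components(2,3)[of c "ext_d _", unfolded One_nat_def]
        ext_d_components(2,3)[unfolded One_nat_def])
  moreover have "codiff c (ext_d \<omega>) 1 1 z = 0"
    unfolding codiff_def uminus_apply hodge_star_components(4) ext_d_components by simp
  ultimately show ?thesis
    unfolding laplacian_def plus_fun_apply ext_d_components(4) by (simp only: add_0_right)
qed

text \<open>The factor \<open>k\<close> is \<open>\<i>\<close> for functions and \<open>- \<i>\<close> for \<open>(1,1)\<close>-forms.\<close>

lemma square_integrable_form_function_eq_0:
  assumes D: "smoothly_bounded_domain D" and f: "Ck_on 2 f D" and k: "k \<noteq> 0"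
    and lap: "\<And>z. z \<in> D \<Longrightarrow> wirt_z (\<lambda>z. k * wirt_zbar f z) z = wirt_zbar (\<lambda>z. - k * wirt_z f z) z"
    and F: "set_integrable lborel D F" "\<And>z. z \<in> D \<Longrightarrow> (cmod (f z))\<^sup>2 * (capacity_density D z)\<^sup>2 = F z"
    and z: "z \<in> D"
  shows "f z = 0"
proof -
  have oD: "open D" using D by (simp add: smoothly_bounded_domain_def)
  have L: "pderiv_x (pderiv_x f) w + pderiv_y (pderiv_y f) w = 0" if w: "w \<in> D" for w
    using wirtinger_laplacian[OF Ck_on_2_pderiv(2,3)[OF f oD w], of k] lap[OF w] k by simp
  have T0: "T (f z) = 0" if T: "bounded_linear T" "\<And>x. \<bar>T x\<bar> \<le> cmod x" for T :: "complex \<Rightarrow> real"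
  proof (rule re_hol_square_integrable_eq_0[OF D re_hol_linear_of_laplace[OF oD f T(1) L] F(1) _ z])
    fix w assume w: "w \<in> D"
    have "\<bar>T (f w)\<bar>\<^sup>2 \<le> (cmod (f w))\<^sup>2" using T(2) by (rule power_mono) simp
    then have "(T (f w))\<^sup>2 * (capacity_density D w)\<^sup>2 \<le> (cmod (f w))\<^sup>2 * (capacity_density D w)\<^sup>2"
      by (intro mult_right_mono) auto
    then show "(T (f w))\<^sup>2 * (capacity_density D w)\<^sup>2 \<le> F w" using F(2)[OF w] by simp
  qed
  show ?thesis
    using T0[OF bounded_linear_Re abs_Re_le_cmod] T0[OF bounded_linear_Im abs_Im_le_cmod]
    by (simp add: complex_eq_iff)
qed

lemma smooth_form_eq_0:
  assumes "\<omega> \<in> smooth_forms D p q" "\<And>z. z \<in> D \<Longrightarrow> \<omega> p q z = 0"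
  shows "\<omega> = 0"
proof (intro ext)
  fix r s z
  show "\<omega> r s z = 0 r s z"
    using assms by (cases "(r, s) = (p, q)"; cases "z \<in> D") (auto simp: smooth_forms_def)
qed

lemma L2_harmonic_functions_trivial:
  assumes D: "smoothly_bounded_domain D"
    and \<omega>: "\<omega> \<in> L2_harmonic_forms (capacity_density D) D 0 0"
  shows "\<omega> = 0"
proof (rule smooth_form_eq_0)
  define c where "c = capacity_density D"
  have c: "c z \<noteq> 0" for z unfolding c_def using capacity_density_pos[of D z] by simp
  show sm: "\<omega> \<in> smooth_forms D 0 0" using \<omega> by (simp add: L2_harmonic_forms_def)
  have other: "\<omega> r s z = 0" if "(r, s) \<noteq> (0, 0)" for r s z
    using sm that by (auto simp: smooth_forms_def)
  fix z assume z: "z \<in> D"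
  show "\<omega> 0 0 z = 0"
  proof (rule square_integrable_form_function_eq_0[OF D, where k = \<i> and f = "\<omega> 0 0"])
    show "Ck_on 2 (\<omega> 0 0) D" using sm by (auto simp: smooth_forms_def intro: smooth_on_imp_Ck_on)
    show "wirt_z (\<lambda>z. \<i> * wirt_zbar (\<omega> 0 0) z) w = wirt_zbar (\<lambda>z. - \<i> * wirt_z (\<omega> 0 0) z) w"
      if w: "w \<in> D" for w
    proof -
      have "laplacian c \<omega> 0 0 w = 0" using \<omega> w by (simp add: L2_harmonic_forms_def c_def)
      then show ?thesis using c[of w] unfolding laplacian_00 by simp
    qed
    show "set_integrable lborel D (\<lambda>z. form_norm_sq c \<omega> z * (c z)\<^sup>2)"
      using \<omega> by (simp add: L2_harmonic_forms_def c_def)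
    show "(cmod (\<omega> 0 0 w))\<^sup>2 * (capacity_density D w)\<^sup>2 = form_norm_sq c \<omega> w * (c w)\<^sup>2" for w
      by (simp add: form_norm_sq_def other c_def)
  qed (simp_all add: z)
qed

text \<open>A \<open>(1,1)\<close>-form is the Hodge dual of a function, which is harmonic as well and has the same
  pointwise norm. That function contains the factor \<open>1 / c\<^sup>2\<close>, so its differentiability rests on that of
  the Robin constant.\<close>

lemma L2_harmonic_11_forms_trivial:
  assumes D: "smoothly_bounded_domain D"
    and \<omega>: "\<omega> \<in> L2_harmonic_forms (capacity_density D) D 1 1"
  shows "\<omega> = 0"
proof (rule smooth_form_eq_0)
  interpret regular_domain D using D by (rule regular_domain_of_smoothly_bounded)
  define c where "c = capacity_density D"
  have c: "c z \<noteq> 0" for z unfolding c_def using capacity_density_pos[of D z] by simp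
  show sm: "\<omega> \<in> smooth_forms D 1 1" using \<omega> by (simp add: L2_harmonic_forms_def)
  have other: "\<omega> r s z = 0" if "(r, s) \<noteq> (1, 1)" for r s z
    using sm that by (auto simp: smooth_forms_def)
  define \<phi> where "\<phi> = hodge_star c \<omega> 0 0"
  have \<phi>: "\<phi> z = - 2 * \<i> / of_real ((c z)\<^sup>2) * \<omega> 1 1 z" for z by (simp add: \<phi>_def hodge_star_def)
  fix z assume z: "z \<in> D"
  have "\<phi> z = 0"
  proof (rule square_integrable_form_function_eq_0[OF D, where k = "- \<i>" and f = \<phi>])
    have "\<phi> = (\<lambda>w. of_real (exp (robin D w) ^ 2) * (- 2 * \<i> * \<omega> 1 1 w))"
      by (simp add: fun_eq_iff \<phi> c_def capacity_density_def exp_minus power_inverse divide_inverse mult_ac)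
    moreover have "Ck_on 2 (\<lambda>w. of_real (exp (robin D w) ^ 2) * (- 2 * \<i> * \<omega> 1 1 w)) D"
      using sm by (intro Ck_on_mult[OF open_D] Ck_on_bounded_linear[OF open_D bounded_linear_of_real]
          Ck_on_power[OF open_D] Ck_on_exp[OF open_D] Ck_on_robin Ck_on_const[OF open_D])
        (simp add: smooth_forms_def smooth_on_imp_Ck_on)
    ultimately show "Ck_on 2 \<phi> D" by (simp only:)
    show "wirt_z (\<lambda>z. - \<i> * wirt_zbar \<phi> z) w = wirt_zbar (\<lambda>z. - (- \<i>) * wirt_z \<phi> z) w"
      if w: "w \<in> D" for w
    proof -
      have "laplacian c \<omega> 1 1 w = 0" using \<omega> w by (simp add: L2_harmonic_forms_def c_def)
      then show ?thesis unfolding laplacian_11 \<phi>_def by simp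
    qed
    show "set_integrable lborel D (\<lambda>z. form_norm_sq c \<omega> z * (c z)\<^sup>2)"
      using \<omega> by (simp add: L2_harmonic_forms_def c_def)
    show "(cmod (\<phi> w))\<^sup>2 * (capacity_density D w)\<^sup>2 = form_norm_sq c \<omega> w * (c w)\<^sup>2" for w
      using other[of 0 0] other[of 0 1] other[of 1 0] c[of w]
      by (simp add: form_norm_sq_def \<phi> c_def[symmetric] norm_mult norm_divide norm_power
          power_mult_distrib power_divide atMost_Suc numeral_2_eq_2)
  qed (simp_all add: z)
  then show "\<omega> 1 1 z = 0" using c[of z] by (simp add: \<phi>)
qed

section \<open>Holomorphic and antiholomorphic forms\<close>

lemma ext_d_eq_0:
  assumes "open D" "z \<in> D" "\<And>r s w. w \<in> D \<Longrightarrow> \<eta> r s w = 0"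
  shows "ext_d \<eta> r s z = 0"
proof -
  have "pderiv_x (\<eta> a b) z = pderiv_x (\<lambda>w. 0) z" "pderiv_y (\<eta> a b) z = pderiv_y (\<lambda>w. 0) z" for a b
    by (rule pderiv_cong_open[OF assms(1,2)], rule assms(3), assumption)+
  then show ?thesis by (simp add: ext_d_def wirt_z_def wirt_zbar_def pderiv_x_def pderiv_y_def)
qed

lemma hodge_star_eq_0: "(\<And>r s. \<eta> r s z = 0) \<Longrightarrow> hodge_star c \<eta> r s z = 0"
  by (simp add: hodge_star_def)

text \<open>Closed and coclosed forms are harmonic.\<close>

lemma laplacian_eq_0:
  assumes "open D" "z \<in> D" "\<And>r s w. w \<in> D \<Longrightarrow> ext_d \<omega> r s w = 0"
    "\<And>r s w. w \<in> D \<Longrightarrow> ext_d (hodge_star c \<omega>) r s w = 0"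
  shows "laplacian c \<omega> r s z = 0"
proof -
  have "ext_d (codiff c \<omega>) r s z = 0"
    by (rule ext_d_eq_0[OF assms(1,2)]) (simp add: codiff_def hodge_star_eq_0 assms(4))
  moreover have "codiff c (ext_d \<omega>) r s z = 0"
    using ext_d_eq_0[OF assms(1,2), of "hodge_star c (ext_d \<omega>)"]
    by (simp add: codiff_def hodge_star_eq_0 assms(3))
  ultimately show ?thesis by (simp add: laplacian_def)
qed

lemma wirt_zbar_holomorphic:
  assumes "open D" "f holomorphic_on D" "z \<in> D" "\<And>w. w \<in> D \<Longrightarrow> g w = f w"
  shows "wirt_zbar g z = 0"
proof -
  have "(f has_derivative (\<lambda>v. deriv f z * v)) (at z)"
    using holomorphic_derivI[OF assms(2,1,3)] by (simp add: has_field_derivative_def)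
  note f' = pderiv_has_derivative[OF this]
  have "pderiv_x g z = pderiv_x f z" "pderiv_y g z = pderiv_y f z"
    using pderiv_cong_open[OF assms(1,3), of g f] assms(4) by blast+
  then show ?thesis unfolding wirt_zbar_def by (simp add: f' complex_eq_iff)
qed

lemma wirt_z_antiholomorphic:
  assumes "open D" "f holomorphic_on D" "z \<in> D" "\<And>w. w \<in> D \<Longrightarrow> g w = cnj (f w)"
  shows "wirt_z g z = 0"
proof -
  have "(f has_derivative (\<lambda>v. deriv f z * v)) (at z)"
    using holomorphic_derivI[OF assms(2,1,3)] by (simp add: has_field_derivative_def)
  then have "((\<lambda>w. cnj (f w)) has_derivative (\<lambda>v. cnj (deriv f z * v))) (at z)"
    by (rule has_derivative_cnj)
  note f' = pderiv_has_derivative[OF this]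
  have "pderiv_x g z = pderiv_x (\<lambda>w. cnj (f w)) z" "pderiv_y g z = pderiv_y (\<lambda>w. cnj (f w)) z"
    using pderiv_cong_open[OF assms(1,3), of g "\<lambda>w. cnj (f w)"] assms(4) by blast+
  then show ?thesis unfolding wirt_z_def by (simp add: f' complex_eq_iff)
qed

text \<open>The function \<open>b\<close> is the identity for \<open>(1,0)\<close>-forms and the conjugation for \<open>(0,1)\<close>-forms.\<close>

definition monomial_form :: "complex set \<Rightarrow> (complex \<Rightarrow> complex) \<Rightarrow> nat \<Rightarrow> nat \<Rightarrow> nat \<Rightarrow> form" where
  "monomial_form D b p q n r s z = (if (r, s) = (p, q) \<and> z \<in> D then b z ^ n else 0)"

text \<open>The factor \<open>c\<^sup>2\<close> of the volume form cancels against the pointwise norm of the \<open>1\<close>-form.\<close>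

lemma monomial_form_square_integrable:
  assumes D: "open D" "bounded D" and b: "continuous_on UNIV b" and c: "\<And>z. c z > 0"
    and pq: "p + q = 1"
  shows "set_integrable lborel D (\<lambda>z. form_norm_sq c (monomial_form D b p q n) z * (c z)\<^sup>2)"
proof -
  have "compact (closure D)" using D(2) by (simp add: compact_closure)
  moreover have "continuous_on (closure D) (\<lambda>z. 2 * (cmod (b z ^ n))\<^sup>2)"
    by (intro continuous_intros continuous_on_subset[OF b]) auto
  ultimately have "set_integrable lborel (closure D) (\<lambda>z. 2 * (cmod (b z ^ n))\<^sup>2)"
    unfolding set_integrable_def by (rule borel_integrable_compact)
  then have "set_integrable lborel D (\<lambda>z. 2 * (cmod (b z ^ n))\<^sup>2)"
    by (rule set_integrable_subset) (use D(1) closure_subset in auto)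
  moreover have "form_norm_sq c (monomial_form D b p q n) z * (c z)\<^sup>2 = 2 * (cmod (b z ^ n))\<^sup>2"
    if z: "z \<in> D" for z
  proof -
    have "p = 1 \<and> q = 0 \<or> p = 0 \<and> q = 1" using pq by linarith
    then show ?thesis using c[of z] z
      by (auto simp: form_norm_sq_def monomial_form_def atMost_Suc)
  qed
  then have "set_integrable lborel D (\<lambda>z. form_norm_sq c (monomial_form D b p q n) z * (c z)\<^sup>2)
      \<longleftrightarrow> set_integrable lborel D (\<lambda>z. 2 * (cmod (b z ^ n))\<^sup>2)"
    by (intro set_integrable_cong refl)
  ultimately show ?thesis by simp
qed

lemma monomial_form_10_harmonic:
  assumes D: "open D" "bounded D" and c: "\<And>z. c z > 0"
  shows "monomial_form D (\<lambda>z. z) 1 0 n \<in> L2_harmonic_forms c D 1 0"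
proof -
  let ?\<omega> = "monomial_form D (\<lambda>z. z) 1 0 n"
  have hol: "(\<lambda>z. z ^ n) holomorphic_on D" "(\<lambda>z. - \<i> * z ^ n) holomorphic_on D"
    by (intro holomorphic_intros)+
  have "Ck_on k (?\<omega> 1 0) D" for k
    using Ck_on_holomorphic[OF D(1) hol(1)] Ck_on_cong[OF D(1), of "?\<omega> 1 0" "\<lambda>z. z ^ n"]
    by (simp add: monomial_form_def)
  then have "?\<omega> \<in> smooth_forms D 1 0"
    by (auto simp: smooth_forms_def smooth_on_def monomial_form_def)
  moreover have "laplacian c ?\<omega> r s z = 0" if z: "z \<in> D" for r s z
  proof (rule laplacian_eq_0[OF D(1) z])
    fix r s w assume w: "w \<in> D"
    have 0: "?\<omega> 0 0 = (\<lambda>z. 0)" "?\<omega> 0 1 = (\<lambda>z. 0)" "?\<omega> 1 1 = (\<lambda>z. 0)"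
      by (simp_all add: monomial_form_def fun_eq_iff)
    have z0: "wirt_z (\<lambda>z. 0) w = 0" "wirt_zbar (\<lambda>z. 0) w = 0"
      by (simp_all add: wirt_z_def wirt_zbar_def pderiv_x_def pderiv_y_def)
    have "wirt_zbar (?\<omega> 1 0) w = 0"
      by (rule wirt_zbar_holomorphic[OF D(1) hol(1) w]) (simp add: monomial_form_def)
    then show "ext_d ?\<omega> r s w = 0" by (simp add: ext_d_def 0 z0 del: One_nat_def)
    have "wirt_zbar (\<lambda>z. - \<i> * ?\<omega> 1 0 z) w = 0"
      by (rule wirt_zbar_holomorphic[OF D(1) hol(2) w]) (simp add: monomial_form_def)
    then show "ext_d (hodge_star c ?\<omega>) r s w = 0"
      by (simp add: ext_d_def hodge_star_components 0 z0 del: One_nat_def)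
  qed
  ultimately show ?thesis
    using monomial_form_square_integrable[OF D continuous_on_id c, where p = 1 and q = 0 and n = n]
    by (simp add: L2_harmonic_forms_def)
qed

lemma monomial_form_01_harmonic:
  assumes D: "open D" "bounded D" and c: "\<And>z. c z > 0"
  shows "monomial_form D cnj 0 1 n \<in> L2_harmonic_forms c D 0 1"
proof -
  let ?\<omega> = "monomial_form D cnj 0 1 n"
  have hol: "(\<lambda>z. z ^ n) holomorphic_on D" "(\<lambda>z. - \<i> * z ^ n) holomorphic_on D"
    by (intro holomorphic_intros)+
  have "Ck_on k (?\<omega> 0 1) D" for k
    using Ck_on_bounded_linear[OF D(1) bounded_linear_cnj Ck_on_holomorphic[OF D(1) hol(1)]]
      Ck_on_cong[OF D(1), of "?\<omega> 0 1" "\<lambda>z. cnj (z ^ n)"]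
    by (simp add: monomial_form_def)
  then have "?\<omega> \<in> smooth_forms D 0 1"
    by (auto simp: smooth_forms_def smooth_on_def monomial_form_def)
  moreover have "laplacian c ?\<omega> r s z = 0" if z: "z \<in> D" for r s z
  proof (rule laplacian_eq_0[OF D(1) z])
    fix r s w assume w: "w \<in> D"
    have 0: "?\<omega> 0 0 = (\<lambda>z. 0)" "?\<omega> 1 0 = (\<lambda>z. 0)" "?\<omega> 1 1 = (\<lambda>z. 0)"
      by (simp_all add: monomial_form_def fun_eq_iff)
    have z0: "wirt_z (\<lambda>z. 0) w = 0" "wirt_zbar (\<lambda>z. 0) w = 0"
      by (simp_all add: wirt_z_def wirt_zbar_def pderiv_x_def pderiv_y_def)
    have "wirt_z (?\<omega> 0 1) w = 0"
      by (rule wirt_z_antiholomorphic[OF D(1) hol(1) w]) (simp add: monomial_form_def)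
    then show "ext_d ?\<omega> r s w = 0" by (simp add: ext_d_def 0 z0 del: One_nat_def)
    have "wirt_z (\<lambda>z. \<i> * ?\<omega> 0 1 z) w = 0"
      by (rule wirt_z_antiholomorphic[OF D(1) hol(2) w]) (simp add: monomial_form_def)
    then show "ext_d (hodge_star c ?\<omega>) r s w = 0"
      by (simp add: ext_d_def hodge_star_components 0 z0 del: One_nat_def)
  qed
  ultimately show ?thesis
    using monomial_form_square_integrable[OF D continuous_on_cnj[OF continuous_on_id] c, where p = 0 and q = 1 and n = n]
    by (simp add: L2_harmonic_forms_def)
qed

section \<open>Dimensions\<close>

lemma sum_form_apply: "(\<Sum>i\<in>A. f i :: form) p q z = (\<Sum>i\<in>A. f i p q z)"
  by (induction A rule: infinite_finite_induct) simp_all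

lemma form_dim_eq_0:
  assumes "V \<subseteq> {0}"
  shows "form_dim V = 0"
proof -
  have sub: "V \<subseteq> form.span {}" using assms by simp
  then have "form.dim V \<le> card ({} :: form set)" by (rule form.dim_le_card) simp
  moreover have "\<exists>B. finite B \<and> V \<subseteq> form.span B" using sub finite.emptyI by blast
  ultimately show ?thesis unfolding form_dim_def by (simp add: zero_enat_def)
qed

text \<open>A linear relation between monomial forms is a polynomial that vanishes on the infinite
  set \<open>b ` D\<close>.\<close>

lemma form_dim_monomials:
  assumes D: "open D" "D \<noteq> {}" and b: "inj b" and V: "\<And>n. monomial_form D b p q n \<in> V"
  shows "form_dim V = \<infinity>"
proof -
  let ?e = "monomial_form D b p q"
  have e: "?e n p q z = b z ^ n" if "z \<in> D" for n z using that by (simp add: monomial_form_def)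
  have "infinite D" using D finite_imp_not_open by blast
  then have infD: "infinite (b ` D)" using b by (metis finite_image_iff inj_on_subset subset_UNIV)
  have poly0: "P = 0" if "\<And>z. z \<in> D \<Longrightarrow> poly P (b z) = 0" for P :: "complex poly"
  proof (rule ccontr)
    assume "P \<noteq> 0"
    then have "finite {x. poly P x = 0}" by (rule poly_roots_finite)
    moreover have "b ` D \<subseteq> {x. poly P x = 0}" using that by blast
    ultimately show False using infD finite_subset by blast
  qed
  have inj: "inj ?e"
  proof (rule injI)
    fix m n assume mn: "?e m = ?e n"
    have "monom 1 m - monom 1 n = (0 :: complex poly)"
    proof (rule poly0)
      fix z assume "z \<in> D"
      then show "poly (monom 1 m - monom 1 n) (b z) = 0"
        using e[of z m] e[of z n] mn by (simp add: poly_monom)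
    qed
    then have "monom (1::complex) m = monom 1 n" by simp
    then show "m = n" by (metis degree_monom_eq one_neq_zero)
  qed
  have ind: "form.independent (range ?e)"
    unfolding form.dependent_explicit
  proof (clarify)
    fix U u v assume U: "finite U" "U \<subseteq> range ?e" and sum: "(\<Sum>v\<in>U. form_scale (u v) v) = 0"
      and v: "v \<in> U" "u v \<noteq> 0"
    obtain N where N: "U = ?e ` N" using U(2) by (auto simp: subset_image_iff)
    have injN: "inj_on ?e N" using inj by (rule inj_on_subset) simp
    have fN: "finite N" using U(1) injN unfolding N by (simp add: finite_image_iff)
    define P where "P = (\<Sum>n\<in>N. monom (u (?e n)) n)"
    have "P = 0"
    proof (rule poly0)
      fix z assume z: "z \<in> D"
      have "(\<Sum>v\<in>U. form_scale (u v) v) p q z = (\<Sum>n\<in>N. u (?e n) * b z ^ n)"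
        unfolding sum_form_apply N sum.reindex[OF injN] by (simp add: form_scale_def e[OF z])
      then show "poly P (b z) = 0" unfolding sum by (simp add: P_def poly_sum poly_monom)
    qed
    obtain m where m: "m \<in> N" "v = ?e m" using v(1) unfolding N by blast
    have "coeff P m = (\<Sum>n\<in>N. if n = m then u (?e n) else 0)"
      by (simp add: P_def coeff_sum)
    also have "\<dots> = u v" using m fN by simp
    finally show False using v(2) \<open>P = 0\<close> by simp
  qed
  have "\<not> (\<exists>B. finite B \<and> V \<subseteq> form.span B)"
  proof
    assume "\<exists>B. finite B \<and> V \<subseteq> form.span B"
    then obtain B where B: "finite B" "V \<subseteq> form.span B" by blast
    have "range ?e \<subseteq> form.span B" using V B(2) by blast
    then have "finite (range ?e)" using form.independent_span_bound[OF B(1) ind] by blast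
    then show False using inj finite_imageD by blast
  qed
  then show ?thesis unfolding form_dim_def by simp
qed

theorem theorem1p7:
  fixes D :: "complex set" and p q :: nat
  assumes "smoothly_bounded_domain D" and "p \<le> 1" and "q \<le> 1"
  shows "form_dim (L2_harmonic_forms (capacity_density D) D p q) =
           (if p + q \<noteq> 1 then 0 else \<infinity>)"
proof -
  have D: "open D" "bounded D" "D \<noteq> {}" using assms(1) by (auto simp: smoothly_bounded_domain_def)
  consider "p = 0 \<and> q = 0" | "p = 1 \<and> q = 1" | "p = 1 \<and> q = 0" | "p = 0 \<and> q = 1"
    using assms(2,3) by linarith
  then show ?thesis
  proof cases
    case 1
    then have "L2_harmonic_forms (capacity_density D) D p q \<subseteq> {0}"
      using L2_harmonic_functions_trivial[OF assms(1)] by blast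
    then show ?thesis using 1 by (simp add: form_dim_eq_0)
  next
    case 2
    then have "L2_harmonic_forms (capacity_density D) D p q \<subseteq> {0}"
      using L2_harmonic_11_forms_trivial[OF assms(1)] by blast
    then show ?thesis using 2 by (simp add: form_dim_eq_0)
  next
    case 3
    then show ?thesis
      using form_dim_monomials[OF D(1,3) _ monomial_form_10_harmonic[OF D(1,2) capacity_density_pos]]
      by simp
  next
    case 4
    have "inj cnj" by (rule injI) simp
    then show ?thesis
      using 4 form_dim_monomials[OF D(1,3) _ monomial_form_01_harmonic[OF D(1,2) capacity_density_pos]]
      by simp
  qed
qed

end
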